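(* For each integer $r \ge 4$, \[ \ln p(n,r) = \frac{1}{n-r+1}\binom{n}{r}\Bigl(\ln(n-r+1) + 1 - r + o(1)\Bigr) \qquad \text{as } n \to \infty . \]
   Context: A matroid of rank $r$ on ground set $E$ is paving if every subset $F\subseteq E$ with $|F|<r$ is independent. $p(n,r)$ denotes the number of paving matroids of rank $r$ on the ground set $[n]=\{1,\dots,n\}$. *)

theory Defs
  imports Complex_Main
begin

text \<open>A matroid on \<open>E\<close> is given by its family \<open>I\<close> of independent sets.\<close>

definition matroid :: "'a set \<Rightarrow> 'a set set \<Rightarrow> bool" where
  "matroid E I \<longleftrightarrow>
     finite E \<and> I \<subseteq> Pow E \<and>
     {} \<in> I \<and>
     (\<forall>X\<in>I. \<forall>Y\<subseteq>X. Y \<in> I) \<and>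
     (\<forall>X\<in>I. \<forall>Y\<in>I. card X < card Y \<longrightarrow> (\<exists>y\<in>Y - X. insert y X \<in> I))"

definition matroid_rank :: "'a set set \<Rightarrow> nat" where
  "matroid_rank I = Max (card ` I)"

definition paving :: "'a set \<Rightarrow> 'a set set \<Rightarrow> bool" where
  "paving E I \<longleftrightarrow> matroid E I \<and> (\<forall>F\<subseteq>E. card F < matroid_rank I \<longrightarrow> F \<in> I)"

definition paving_matroids :: "nat \<Rightarrow> nat \<Rightarrow> nat set set set" where
  "paving_matroids n r = {I. paving {1..n} I \<and> matroid_rank I = r}"

definition num_paving :: "nat \<Rightarrow> nat \<Rightarrow> nat" where
  "num_paving n r = card (paving_matroids n r)"

lemma finite_paving_matroids: "finite (paving_matroids n r)"
  by (rule finite_subset[of _ "Pow (Pow {1..n})"])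
     (auto simp: paving_matroids_def paving_def matroid_def)

end

theory Submission
  imports Defs "HOL-Library.FuncSet" "HOL-Library.Disjoint_Sets" "HOL-Real_Asymp.Real_Asymp"
begin

text \<open>
  Let \<open>H\<close> be the hypergraph whose vertices are the \<open>(r - 1)\<close>-subsets of \<open>{1..n}\<close> and whose edges are
  the shadows of the \<open>r\<close>-subsets: it is \<open>r\<close>-uniform, linear and regular of degree \<open>D = n - r + 1\<close>, and
  has \<open>N = (n choose (r - 1))\<close> vertices, so that the claim reads
  \<open>ln p(n,r) = N / r * (ln D + 1 - r + o(1))\<close>.

  Upper bound. A paving matroid is a family of blocks (hyperplanes) covering each vertex exactly once.
  A block with \<open>s > r\<close> elements is recorded by \<open>s - r + 1\<close> of its \<open>r\<close>-subsets while it covers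
  \<open>(s choose (r - 1))\<close> vertices, which is at least \<open>5 r / 4\<close> times as many because \<open>r \<ge> 4\<close>; so large and
  trivial blocks only contribute a factor \<open>exp (o(N))\<close>. The blocks with exactly \<open>r\<close> elements form a
  perfect matching of the remaining vertices, and the entropy argument of Linial and Luria bounds the
  number of those.

  Lower bound. Matchings of \<open>H\<close> give sparse paving matroids. Colouring an \<open>r\<close>-set by its sum modulo \<open>n\<close>
  (Graham and Sloane) is a proper edge colouring of \<open>H\<close>. Run through the colours in random order, and when a
  fraction \<open>q\<close> of the colours is left select each available edge of the current colour with probability
  \<open>1 / (n q ^ r)\<close>. No conflicts arise, so the entropy of the resulting matching is linear in the
  expected numbers of available edges. A second-moment potential shows that the
  degrees in the uncovered part stay close to \<open>n q ^ r\<close> until almost all vertices are covered.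
\<close>

section \<open>Perfect matchings of linear hypergraphs\<close>

text \<open>The constant 1 - r arises twice as an integral. Above: let a fraction x of the exposure
  times be still to come when the first vertex of an edge is reached. Another edge there is possible
  only if the matching edges at its r - 1 other vertices are all later, which concerns r (r - 1)
  vertices. Since 1 - x is the minimum of r uniform times, x has density r x^(r - 1), and the mean
  of ln (D x^(r (r - 1))) is ln D - (r - 1). Below: the colour reached at fraction q gains about N /
  (r n) times ln (n q^r) + 1, and the mean of r ln q over [0, 1] is -r. The obstacle below is that
  the process runs for almost n steps, over which all degrees would have to be concentrated; a bound
  that is linear in the state lets expectations suffice. The obstacle above is that there are D N /
  r candidates for recorded r-sets: a recorded set must lower the exponent by more than the ln D
  that its choice costs, and it lowers it by about 5/4 ln D. For r = 3 a block of 4 elements would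
  cover 6 vertices with 2 recorded sets, exactly r per set, and nothing would be won.\<close>

definition perfect_matchings :: "'a set set \<Rightarrow> 'a set \<Rightarrow> 'a set set set" where
  "perfect_matchings E U = {M. M \<subseteq> E \<and> disjoint M \<and> \<Union>M = U}"

text \<open>Suppose the edges of \<open>M\<close> are exposed vertex by vertex in the order \<open>\<rho>\<close>. When the first vertex of \<open>e\<close> is
  reached, \<open>open_edges E \<rho> M e\<close> consists of the edges through it that avoid all exposed edges.\<close>

definition open_edges :: "'a set set \<Rightarrow> ('a \<Rightarrow> nat) \<Rightarrow> 'a set set \<Rightarrow> 'a set \<Rightarrow> 'a set set" where
  "open_edges E \<rho> M e = {f\<in>E. f \<subseteq> \<Union>M \<and> Min (\<rho> ` e) \<in> \<rho> ` f \<and>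
     (\<forall>g\<in>M. g \<inter> f \<noteq> {} \<longrightarrow> Min (\<rho> ` e) \<le> Min (\<rho> ` g))}"

lemma finite_perfect_matchings: "finite E \<Longrightarrow> finite (perfect_matchings E U)"
  by (rule finite_subset[of _ "Pow E"]) (auto simp: perfect_matchings_def)

lemma perfect_matchingsD:
  assumes "M \<in> perfect_matchings E U"
  shows "M \<subseteq> E" "\<Union>M = U" "\<And>a b x. a \<in> M \<Longrightarrow> b \<in> M \<Longrightarrow> x \<in> a \<Longrightarrow> x \<in> b \<Longrightarrow> a = b"
  using assms unfolding perfect_matchings_def disjoint_def by blast+

lemma perfect_matchingsI:
  assumes "M \<subseteq> E" "\<Union>M = U" "\<And>a b x. a \<in> M \<Longrightarrow> b \<in> M \<Longrightarrow> x \<in> a \<Longrightarrow> x \<in> b \<Longrightarrow> a = b"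
  shows "M \<in> perfect_matchings E U"
  using assms unfolding perfect_matchings_def disjoint_def by blast

section \<open>Weights of perfect matchings under the exposure process\<close>

lemma sum_perfect_matchings_split:
  fixes w :: "'a set set \<Rightarrow> real"
  assumes "finite E" and v: "v \<in> U"
  shows "(\<Sum>M\<in>perfect_matchings E U. w M) =
    (\<Sum>e\<in>{e\<in>E. v \<in> e \<and> e \<subseteq> U}. \<Sum>M\<in>{M\<in>perfect_matchings E U. e \<in> M}. w M)"
proof -
  have "(\<Sum>e\<in>{e\<in>E. v \<in> e \<and> e \<subseteq> U}. \<Sum>M\<in>{M\<in>perfect_matchings E U. e \<in> M}. w M)
      = sum w (\<Union>e\<in>{e\<in>E. v \<in> e \<and> e \<subseteq> U}. {M\<in>perfect_matchings E U. e \<in> M})"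
  proof (rule sum.UNION_disjoint[symmetric])
    show "\<forall>i\<in>{e \<in> E. v \<in> e \<and> e \<subseteq> U}. \<forall>j\<in>{e \<in> E. v \<in> e \<and> e \<subseteq> U}. i \<noteq> j \<longrightarrow>
       {M \<in> perfect_matchings E U. i \<in> M} \<inter> {M \<in> perfect_matchings E U. j \<in> M} = {}"
      using perfect_matchingsD(3)[of _ E U _ _ v] by blast
  qed (use assms(1) finite_perfect_matchings[of E U] in simp_all)
  also have "(\<Union>e\<in>{e\<in>E. v \<in> e \<and> e \<subseteq> U}. {M\<in>perfect_matchings E U. e \<in> M}) = perfect_matchings E U"
  proof -
    have "\<exists>e\<in>{e\<in>E. v \<in> e \<and> e \<subseteq> U}. e \<in> M" if "M \<in> perfect_matchings E U" for M
      using perfect_matchingsD(1,2)[OF that] v by blast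
    thus ?thesis by blast
  qed
  finally show ?thesis by simp
qed

text \<open>If the exposure picks uniformly among the open edges at each new vertex, the product is
  the probability that it produces \<open>M\<close>; runs that get stuck explain why the total may
  be below 1. By induction on the size of \<open>U\<close>: the smallest vertex \<open>v\<close> has
  the same number of open edges, \<open>card F\<close>, whichever edge \<open>e\<close> covers it,
  and the rest is a perfect matching of \<open>U - e\<close>.\<close>

lemma kraft_perfect_matchings:
  assumes "finite E" "\<And>e. e \<in> E \<Longrightarrow> finite e" "{} \<notin> E" "finite U" "inj_on \<rho> U"
  shows "(\<Sum>M\<in>perfect_matchings E U. \<Prod>e\<in>M. 1 / real (card (open_edges E \<rho> M e))) \<le> 1"
  using assms(4,5)
proof (induction "card U" arbitrary: U rule: less_induct)
  case less
  show ?case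
  proof (cases "U = {}")
    case True
    have "perfect_matchings E U \<subseteq> {{}}"
      using True assms(3) by (auto simp: perfect_matchings_def)
    moreover have "{} \<in> perfect_matchings E U"
      using True by (simp add: perfect_matchings_def)
    ultimately have "perfect_matchings E U = {{}}" by blast
    thus ?thesis by simp
  next
    case False
    define m where "m = Min (\<rho> ` U)"
    have "m \<in> \<rho> ` U" unfolding m_def using False less.prems(1) by (intro Min_in) auto
    then obtain v where v: "v \<in> U" "\<rho> v = m" by auto
    have vmin: "\<rho> v \<le> \<rho> x" if "x \<in> U" for x
      using v that less.prems(1) by (auto simp: m_def)
    have vless: "\<rho> v < \<rho> x" if "x \<in> U" "x \<noteq> v" for x
      using vmin[OF that(1)] less.prems(2) v that by (metis inj_onD le_neq_implies_less)
    define F where "F = {e\<in>E. v \<in> e \<and> e \<subseteq> U}"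
    have finF: "finite F" using assms(1) by (simp add: F_def)
    let ?w = "\<lambda>M. \<Prod>e\<in>M. 1 / real (card (open_edges E \<rho> M e))"
    have Minv: "Min (\<rho> ` e) = \<rho> v" if "v \<in> e" "e \<subseteq> U" for e
    proof -
      have "finite (\<rho> ` e)" using that(2) less.prems(1) by (blast intro: finite_subset)
      thus ?thesis using that vmin by (intro Min_eqI) auto
    qed
    have step: "(\<Sum>M\<in>{M\<in>perfect_matchings E U. e \<in> M}. ?w M) \<le> 1 / real (card F)" if e: "e \<in> F" for e
    proof -
      have eE: "e \<in> E" "v \<in> e" "e \<subseteq> U" using e by (auto simp: F_def)
      have bij: "bij_betw (insert e) (perfect_matchings E (U - e)) {M\<in>perfect_matchings E U. e \<in> M}"
      proof (rule bij_betw_byWitness[where f' = "\<lambda>M. M - {e}"])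
        show "\<forall>M\<in>perfect_matchings E (U - e). insert e M - {e} = M"
          using perfect_matchingsD(2)[of _ E "U - e"] eE by blast
        show "\<forall>M\<in>{M \<in> perfect_matchings E U. e \<in> M}. insert e (M - {e}) = M" by blast
        show "insert e ` perfect_matchings E (U - e) \<subseteq> {M \<in> perfect_matchings E U. e \<in> M}"
        proof (intro image_subsetI CollectI conjI perfect_matchingsI)
          fix M assume M: "M \<in> perfect_matchings E (U - e)"
          show "insert e M \<subseteq> E" using perfect_matchingsD(1)[OF M] eE(1) by blast
          show "\<Union>(insert e M) = U" unfolding Union_insert perfect_matchingsD(2)[OF M] using eE(3) by blast
          show "e \<in> insert e M" by blast
        next
          fix M a b x assume M: "M \<in> perfect_matchings E (U - e)"
            and h: "a \<in> insert e M" "b \<in> insert e M" "x \<in> a" "x \<in> b"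
          have "x \<notin> e" if "x \<in> \<Union>M" using that perfect_matchingsD(2)[OF M] by blast
          thus "a = b" using h perfect_matchingsD(3)[OF M, of a b x] by blast
        qed
        show "(\<lambda>M. M - {e}) ` {M \<in> perfect_matchings E U. e \<in> M} \<subseteq> perfect_matchings E (U - e)"
        proof (intro image_subsetI perfect_matchingsI)
          fix M assume "M \<in> {M \<in> perfect_matchings E U. e \<in> M}"
          hence M: "M \<in> perfect_matchings E U" "e \<in> M" by auto
          show "M - {e} \<subseteq> E" using perfect_matchingsD(1)[OF M(1)] by blast
          show "\<Union>(M - {e}) = U - e"
            using perfect_matchingsD(2)[OF M(1)] perfect_matchingsD(3)[OF M(1) M(2)] by blast
          show "\<And>a b x. a \<in> M - {e} \<Longrightarrow> b \<in> M - {e} \<Longrightarrow> x \<in> a \<Longrightarrow> x \<in> b \<Longrightarrow> a = b"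
            using perfect_matchingsD(3)[OF M(1)] by blast
        qed
      qed
      have w: "?w (insert e M) = 1 / real (card F) * ?w M" if M: "M \<in> perfect_matchings E (U - e)" for M
      proof -
        have UM: "\<Union>M = U - e" and ME: "M \<subseteq> E" using perfect_matchingsD[OF M] by auto
        have eM: "e \<notin> M" using UM eE(2) by blast
        have finM: "finite M" using ME assms(1) by (rule finite_subset)
        \<comment> \<open>Nothing is exposed before the smallest vertex \<open>v\<close>, so all
          edges through it within \<open>U\<close> are open.\<close>
        have 1: "open_edges E \<rho> (insert e M) e = F"
        proof -
          have A: "\<And>g. g \<in> insert e M \<Longrightarrow> \<rho> v \<le> Min (\<rho> ` g)"
          proof -
            fix g assume g: "g \<in> insert e M"
            hence "g \<subseteq> e \<union> \<Union>M" by blast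
            hence gU: "g \<subseteq> U" unfolding UM using eE(3) by blast
            have "g \<in> E" using g eE ME by blast
            hence "finite g \<and> g \<noteq> {}" using assms(2,3) by blast
            thus "\<rho> v \<le> Min (\<rho> ` g)" using gU vmin by (subst Min_ge_iff) auto
          qed
          have B: "\<rho> v \<in> \<rho> ` f \<longleftrightarrow> v \<in> f" if "f \<subseteq> U" for f
            using that vless by (metis image_iff nat_neq_iff subsetD)
          have "\<Union>(insert e M) = U" using UM eE(3) by auto
          thus ?thesis
            unfolding open_edges_def F_def Minv[OF eE(2,3)]
            by (intro Collect_cong) (use A B in metis)
        qed
        \<comment> \<open>With \<open>e\<close> in the matching an open edge must avoid
          \<open>e\<close>, which is exposed earlier; without it an open edge must lie inside
          \<open>\<Union>M\<close>, that is \<open>U - e\<close>. Both conditions exclude exactly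
          the edges meeting \<open>e\<close>.\<close>
        have 2: "open_edges E \<rho> (insert e M) e' = open_edges E \<rho> M e'" if e': "e' \<in> M" for e'
        proof -
          have "e' \<in> E" using ME e' by blast
          hence fe: "finite e'" "e' \<noteq> {}" using assms(2,3) by blast+
          have "Min (\<rho> ` e') \<in> \<rho> ` e'" using fe by (intro Min_in) auto
          then obtain x where x: "x \<in> e'" "\<rho> x = Min (\<rho> ` e')" by auto
          have "x \<in> \<Union>M" using x e' by blast
          hence "x \<in> U" "x \<noteq> v" unfolding UM using eE(2) by blast+
          hence lt: "\<rho> v < Min (\<rho> ` e')" using vless[of x] x(2) by simp
          have "open_edges E \<rho> (insert e M) e' \<subseteq> open_edges E \<rho> M e'"
          proof
            fix f assume f: "f \<in> open_edges E \<rho> (insert e M) e'"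
            hence "e \<inter> f \<noteq> {} \<longrightarrow> Min (\<rho> ` e') \<le> Min (\<rho> ` e)" unfolding open_edges_def by blast
            hence ef: "e \<inter> f = {}" using lt Minv[OF eE(2,3)] by auto
            have "f \<subseteq> e \<union> \<Union>M" using f unfolding open_edges_def by blast
            hence "f \<subseteq> \<Union>M" using ef by blast
            thus "f \<in> open_edges E \<rho> M e'" using f unfolding open_edges_def by blast
          qed
          moreover have "open_edges E \<rho> M e' \<subseteq> open_edges E \<rho> (insert e M) e'"
          proof
            fix f assume f: "f \<in> open_edges E \<rho> M e'"
            hence "f \<subseteq> U - e" unfolding open_edges_def UM by blast
            hence "e \<inter> f = {}" by blast
            thus "f \<in> open_edges E \<rho> (insert e M) e'" using f unfolding open_edges_def by blast
          qed
          ultimately show ?thesis by blast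
        qed
        have "?w (insert e M) = 1 / real (card F) * (\<Prod>e'\<in>M. 1 / real (card (open_edges E \<rho> (insert e M) e')))"
          using finM eM 1 by (subst prod.insert) auto
        also have "(\<Prod>e'\<in>M. 1 / real (card (open_edges E \<rho> (insert e M) e'))) = ?w M"
          using 2 by (intro prod.cong) auto
        finally show ?thesis .
      qed
      have lt: "card (U - e) < card U" using eE v less.prems(1) by (intro psubset_card_mono) auto
      have "(\<Sum>M\<in>{M\<in>perfect_matchings E U. e \<in> M}. ?w M) = (\<Sum>M\<in>perfect_matchings E (U - e). ?w (insert e M))"
        using sum.reindex_bij_betw[OF bij, of ?w] by simp
      also have "\<dots> = (\<Sum>M\<in>perfect_matchings E (U - e). 1 / real (card F) * ?w M)"
        using w by (intro sum.cong refl) blast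
      also have "\<dots> = 1 / real (card F) * (\<Sum>M\<in>perfect_matchings E (U - e). ?w M)"
        by (simp add: sum_distrib_left)
      also have "\<dots> \<le> 1 / real (card F) * 1"
        using less.prems lt by (intro mult_left_mono less.hyps) (auto intro: inj_on_subset)
      finally show ?thesis by simp
    qed
    have "(\<Sum>M\<in>perfect_matchings E U. ?w M) = (\<Sum>e\<in>F. \<Sum>M\<in>{M\<in>perfect_matchings E U. e \<in> M}. ?w M)"
      unfolding F_def by (rule sum_perfect_matchings_split) (use assms(1) v in auto)
    also have "\<dots> \<le> (\<Sum>e\<in>F. 1 / real (card F))" by (rule sum_mono) (rule step)
    also have "\<dots> \<le> 1" by simp
    finally show ?thesis .
  qed
qed

text \<open>Gibbs inequality: the uniform distribution on \<open>P\<close> is compared with the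
  sub-probability weights of \<open>kraft_perfect_matchings\<close>. Termwise it is ln y \<le> y - 1
  for y = \<open>real (card P) * ?w M\<close>. The order \<open>\<rho>\<close> is still arbitrary,
  so the bound can be averaged over orders.\<close>

lemma ln_card_perfect_matchings_le:
  assumes "finite E" "\<And>e. e \<in> E \<Longrightarrow> finite e" "{} \<notin> E" "finite U" "inj_on \<rho> U"
  defines "P \<equiv> perfect_matchings E U"
  shows "real (card P) * ln (real (card P)) \<le>
    (\<Sum>M\<in>P. \<Sum>e\<in>M. ln (real (card (open_edges E \<rho> M e))))"
proof -
  let ?w = "\<lambda>M. \<Prod>e\<in>M. 1 / real (card (open_edges E \<rho> M e))"
  have finP: "finite P" using finite_perfect_matchings[OF assms(1)] by (simp add: P_def)
  show ?thesis
  proof (cases "P = {}")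
    case False
    hence c: "card P > 0" using finP by auto
    have "(\<Sum>M\<in>P. ln (real (card P)) - (\<Sum>e\<in>M. ln (real (card (open_edges E \<rho> M e)))))
       \<le> (\<Sum>M\<in>P. real (card P) * ?w M - 1)"
    proof (rule sum_mono)
      fix M assume M: "M \<in> P"
      have finM: "finite M" using perfect_matchingsD(1)[OF M[unfolded P_def]] assms(1) by (rule finite_subset)
      \<comment> \<open>The edge \<open>e\<close> itself is always open, so no quotient or logarithm
        below takes its default value at 0.\<close>
      have pos: "card (open_edges E \<rho> M e) > 0" if e: "e \<in> M" for e
      proof -
        have eE: "e \<in> E" using perfect_matchingsD(1)[OF M[unfolded P_def]] e by blast
        hence fe: "finite e" "e \<noteq> {}" using assms(2,3) by blast+
        have "Min (\<rho> ` e) \<in> \<rho> ` e" using fe by (intro Min_in) auto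
        moreover have "g = e" if "g \<in> M" "g \<inter> e \<noteq> {}" for g
          using perfect_matchingsD(3)[OF M[unfolded P_def] that(1) e] that(2) by blast
        ultimately have "e \<in> open_edges E \<rho> M e"
          unfolding open_edges_def using eE e by blast
        moreover have "finite (open_edges E \<rho> M e)" using assms(1) by (auto simp: open_edges_def)
        ultimately show ?thesis by (metis card_gt_0_iff empty_iff)
      qed
      have wpos: "?w M > 0" using pos by (intro prod_pos) auto
      have "ln (?w M) = - (\<Sum>e\<in>M. ln (real (card (open_edges E \<rho> M e))))"
        using pos finM by (subst ln_prod) (auto simp: ln_div sum_negf[symmetric] intro!: sum.cong)
      hence "ln (real (card P)) - (\<Sum>e\<in>M. ln (real (card (open_edges E \<rho> M e)))) = ln (real (card P) * ?w M)"
        using c wpos by (subst ln_mult) auto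
      also have "\<dots> \<le> real (card P) * ?w M - 1"
        using c wpos by (intro ln_le_minus_one) auto
      finally show "ln (real (card P)) - (\<Sum>e\<in>M. ln (real (card (open_edges E \<rho> M e)))) \<le> real (card P) * ?w M - 1" .
    qed
    also have "\<dots> = real (card P) * (\<Sum>M\<in>P. ?w M) - real (card P)"
      by (simp add: sum_subtractf sum_distrib_left)
    also have "\<dots> \<le> real (card P) * 1 - real (card P)"
      using kraft_perfect_matchings[OF assms(1-5)] unfolding P_def
      by (intro diff_right_mono mult_left_mono) auto
    finally show ?thesis by (simp add: sum_subtractf)
  qed auto
qed

section \<open>Averaging over independent random exposure times\<close>

lemma sum_PiE_Un:
  fixes h :: "('a \<Rightarrow> 'b) \<Rightarrow> 'c::comm_monoid_add"
  assumes "A \<inter> B = {}"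
  shows "(\<Sum>\<tau>\<in>PiE (A \<union> B) F. h \<tau>) =
    (\<Sum>\<sigma>\<in>PiE A F. \<Sum>\<tau>\<in>PiE B F. h (\<lambda>x. if x \<in> A then \<sigma> x else \<tau> x))"
proof -
  define j where "j = (\<lambda>\<tau> :: 'a \<Rightarrow> 'b. (restrict \<tau> A, restrict \<tau> B))"
  define i where "i = (\<lambda>(\<sigma> :: 'a \<Rightarrow> 'b, \<tau>) x. if x \<in> A then \<sigma> x else \<tau> x)"
  have ij: "i (j \<tau>) = \<tau>" "j \<tau> \<in> PiE A F \<times> PiE B F" if "\<tau> \<in> PiE (A \<union> B) F" for \<tau>
    using that by (fastforce simp: i_def j_def PiE_iff extensional_def)+
  have ji: "j (i p) = p" "i p \<in> PiE (A \<union> B) F" if p0: "p \<in> PiE A F \<times> PiE B F" for p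
  proof -
    obtain \<sigma> \<tau> where p: "p = (\<sigma>, \<tau>)" "\<sigma> \<in> PiE A F" "\<tau> \<in> PiE B F" using p0 by blast
    have "restrict (i p) A = \<sigma>" "restrict (i p) B = \<tau>"
      using p assms by (auto simp: i_def restrict_def PiE_iff extensional_def fun_eq_iff)
    thus "j (i p) = p" using p by (simp add: j_def)
    show "i p \<in> PiE (A \<union> B) F" using p by (auto simp: i_def PiE_iff extensional_def)
  qed
  have "(\<Sum>\<tau>\<in>PiE (A \<union> B) F. h \<tau>) = (\<Sum>p\<in>PiE A F \<times> PiE B F. h (i p))"
    by (rule sum.reindex_bij_witness[where i = i and j = j]) (use ij ji in auto)
  also have "\<dots> = (\<Sum>\<sigma>\<in>PiE A F. \<Sum>\<tau>\<in>PiE B F. h (\<lambda>x. if x \<in> A then \<sigma> x else \<tau> x))"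
    by (simp add: sum.cartesian_product i_def case_prod_unfold)
  finally show ?thesis .
qed

text \<open>Jensen's inequality for the concave logarithm, via its tangent at
  \<open>B\<close>.\<close>

lemma sum_ln_le_card_mult_ln_avg:
  fixes y :: "'a \<Rightarrow> real"
  assumes "finite A" "A \<noteq> {}" "\<And>x. x \<in> A \<Longrightarrow> y x > 0" "sum y A \<le> real (card A) * B" "B > 0"
  shows "(\<Sum>x\<in>A. ln (y x)) \<le> real (card A) * ln B"
proof -
  have "(\<Sum>x\<in>A. ln (y x) - ln B) \<le> (\<Sum>x\<in>A. y x / B - 1)"
  proof (rule sum_mono)
    fix x assume "x \<in> A"
    thus "ln (y x) - ln B \<le> y x / B - 1"
      using assms(3)[of x] assms(5) ln_le_minus_one[of "y x / B"] by (simp add: ln_div)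
  qed
  also have "\<dots> = sum y A / B - real (card A)" by (simp add: sum_subtractf sum_divide_distrib)
  also have "\<dots> \<le> 0" using assms by (simp add: divide_le_eq)
  finally show ?thesis by (simp add: sum_subtractf)
qed

lemma real_card_filter:
  "finite A \<Longrightarrow> real (card {x\<in>A. P x}) = (\<Sum>x\<in>A. if P x then 1 else 0)"
  by (simp add: sum.If_cases Int_def)

lemma card_PiE_atLeast:
  fixes L t :: nat
  assumes "finite B" "G \<subseteq> B" "t \<le> L" "L > 0"
  shows "real (card {\<tau>\<in>PiE B (\<lambda>_. {..<L}). \<forall>x\<in>G. t \<le> \<tau> x}) = real L ^ card B * (real (L - t) / real L) ^ card G"
proof -
  have "{\<tau>\<in>PiE B (\<lambda>_. {..<L}). \<forall>x\<in>G. t \<le> \<tau> x} = PiE B (\<lambda>x. if x \<in> G then {t..<L} else {..<L})"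
    using assms(2) by (auto simp: PiE_iff extensional_def split: if_splits)
  hence "card {\<tau>\<in>PiE B (\<lambda>_. {..<L}). \<forall>x\<in>G. t \<le> \<tau> x} = (\<Prod>x\<in>B. card (if x \<in> G then {t..<L} else {..<L}))"
    using assms(1) by (simp add: card_PiE)
  also have "\<dots> = (\<Prod>x\<in>B. if x \<in> G then L - t else L)"
    by (rule prod.cong) auto
  also have "\<dots> = (L - t) ^ card G * L ^ card (B - G)"
    using assms(1,2) by (simp add: prod.If_cases Int_absorb1 Diff_eq)
  finally have "real (card {\<tau>\<in>PiE B (\<lambda>_. {..<L}). \<forall>x\<in>G. t \<le> \<tau> x}) = real (L - t) ^ card G * real L ^ card (B - G)"
    by (metis of_nat_mult of_nat_power)
  moreover have "card B = card G + card (B - G)"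
    using assms(1,2) by (simp add: card_Diff_subset finite_subset card_mono)
  ultimately show ?thesis using assms by (simp add: power_add power_divide)
qed

text \<open>Distribution of the minimum of \<open>k\<close> independent times:
  \<open>(L - t) ^ k\<close> assignments have all values at least \<open>t\<close>.\<close>

lemma sum_PiE_Min:
  fixes \<phi> :: "nat \<Rightarrow> real"
  assumes "finite e" "card e = k" "k > 0"
  shows "(\<Sum>\<sigma>\<in>PiE e (\<lambda>_. {..<L}). \<phi> (Min (\<sigma> ` e))) =
    (\<Sum>t<L. (real (L - t) ^ k - real (L - Suc t) ^ k) * \<phi> t)"
proof -
  have ne: "e \<noteq> {}" using assms by auto
  let ?S = "PiE e (\<lambda>_. {..<L})"
  have fin: "finite ?S" using assms by (auto intro: finite_PiE)
  have img: "(\<lambda>\<sigma>. Min (\<sigma> ` e)) ` ?S \<subseteq> {..<L}"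
  proof (rule image_subsetI)
    fix \<sigma> assume s: "\<sigma> \<in> ?S"
    have "Min (\<sigma> ` e) \<in> \<sigma> ` e" using assms ne by (intro Min_in) auto
    thus "Min (\<sigma> ` e) \<in> {..<L}" using s by (auto simp: PiE_iff)
  qed
  have "(\<Sum>\<sigma>\<in>?S. \<phi> (Min (\<sigma> ` e))) = (\<Sum>t<L. \<Sum>\<sigma>\<in>{\<sigma>\<in>?S. Min (\<sigma> ` e) = t}. \<phi> (Min (\<sigma> ` e)))"
    by (rule sum.group[symmetric]) (use fin img in auto)
  also have "\<dots> = (\<Sum>t<L. real (card {\<sigma>\<in>?S. Min (\<sigma> ` e) = t}) * \<phi> t)"
    by (intro sum.cong refl) simp
  also have "\<dots> = (\<Sum>t<L. (real (L - t) ^ k - real (L - Suc t) ^ k) * \<phi> t)"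
  proof (rule sum.cong)
    fix t assume "t \<in> {..<L}"
    have iff: "Min (\<sigma> ` e) = t \<longleftrightarrow> (\<forall>x\<in>e. t \<le> \<sigma> x) \<and> \<not> (\<forall>x\<in>e. Suc t \<le> \<sigma> x)" for \<sigma> :: "'a \<Rightarrow> nat"
    proof -
      have "Min (\<sigma> ` e) = t \<longleftrightarrow> t \<le> Min (\<sigma> ` e) \<and> \<not> Suc t \<le> Min (\<sigma> ` e)" by linarith
      thus ?thesis using assms(1) ne by simp
    qed
    have PiE: "PiE e (\<lambda>_. {s..<L}) = {\<sigma>\<in>?S. \<forall>x\<in>e. s \<le> \<sigma> x}" for s
      by (auto simp: PiE_iff extensional_def)
    have "{\<sigma>\<in>?S. Min (\<sigma> ` e) = t} = PiE e (\<lambda>_. {t..<L}) - PiE e (\<lambda>_. {Suc t..<L})"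
      unfolding PiE iff by blast
    moreover have "PiE e (\<lambda>_. {Suc t..<L}) \<subseteq> PiE e (\<lambda>_. {t..<L})" by (intro PiE_mono) auto
    moreover have "finite (PiE e (\<lambda>_. {t..<L}))" "finite (PiE e (\<lambda>_. {Suc t..<L}))"
      using assms by (auto intro: finite_PiE)
    ultimately have "real (card {\<sigma>\<in>?S. Min (\<sigma> ` e) = t})
        = real (card (PiE e (\<lambda>_. {t..<L}))) - real (card (PiE e (\<lambda>_. {Suc t..<L})))"
      by (simp add: card_Diff_subset card_mono of_nat_diff)
    also have "\<dots> = real (L - t) ^ k - real (L - Suc t) ^ k"
      using assms by (simp add: card_PiE)
    finally show "real (card {\<sigma>\<in>?S. Min (\<sigma> ` e) = t}) * \<phi> t = (real (L - t) ^ k - real (L - Suc t) ^ k) * \<phi> t" by simp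
  qed simp
  finally show ?thesis .
qed

text \<open>Source of the exponent \<open>k * (k - 1)\<close>. Since \<open>f\<close> meets
  \<open>e\<close> without being equal to it, it is not in \<open>M\<close>; by linearity its
  \<open>k\<close> vertices lie on \<open>k\<close> different edges of \<open>M\<close>, and those
  through the vertices other than \<open>v\<close> are disjoint from each other and from
  \<open>e\<close>.\<close>

lemma card_Union_touching_ge:
  assumes M: "M \<in> perfect_matchings E U" and fin: "finite U"
    and unif: "\<And>e. e \<in> E \<Longrightarrow> card e = k"
    and linear: "\<And>e f. e \<in> E \<Longrightarrow> f \<in> E \<Longrightarrow> e \<noteq> f \<Longrightarrow> card (e \<inter> f) \<le> 1"
    and e: "e \<in> M" and f: "f \<in> E" "f \<subseteq> U" "f \<noteq> e" "v \<in> e" "v \<in> f"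
  shows "k * (k - 1) \<le> card (\<Union>{g\<in>M. g \<inter> f \<noteq> {}} - e)"
proof -
  note D = perfect_matchingsD[OF M]
  have lin: "x = y" if "g \<in> E" "h \<in> E" "g \<noteq> h" "x \<in> g" "x \<in> h" "y \<in> g" "y \<in> h" "finite g" for g h x y
  proof -
    have "card (g \<inter> h) \<le> Suc 0" "finite (g \<inter> h)" using linear[OF that(1-3)] that(8) by auto
    thus ?thesis using card_le_Suc0_iff_eq[of "g \<inter> h"] that(4-7) by blast
  qed
  have finE: "finite g" if "g \<in> M" for g
    using that D(2) fin by (metis Union_upper finite_subset)
  have "\<forall>w\<in>f. \<exists>g\<in>M. w \<in> g" using f(2) D(2) by blast
  then obtain G where G: "\<And>w. w \<in> f \<Longrightarrow> G w \<in> M" "\<And>w. w \<in> f \<Longrightarrow> w \<in> G w" by metis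
  have fM: "f \<notin> M" using D(3)[OF _ e, of f v] f by blast
  have ffin: "finite f" using f(2) fin by (rule finite_subset)
  have inj: "w = w'" if "w \<in> f" "w' \<in> f" "G w = G w'" for w w'
    using lin[of "f" "G w" w w'] that G[of w] G[of w'] D(1) fM f ffin by (metis subsetD)
  have Gv: "G v = e" using D(3)[OF G(1)[OF f(5)] e G(2)[OF f(5)] f(4)] .
  have sub: "(\<Union>w\<in>f - {v}. G w) \<subseteq> \<Union>{g\<in>M. g \<inter> f \<noteq> {}} - e"
  proof (rule UN_least)
    fix w assume w: "w \<in> f - {v}"
    have "G w \<noteq> e" using inj[of w v] Gv w f(5) by blast
    hence "G w \<inter> e = {}" using D(3)[OF G(1) e, of w] w by blast
    moreover have "G w \<in> {g\<in>M. g \<inter> f \<noteq> {}}" using G[of w] w by blast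
    ultimately show "G w \<subseteq> \<Union>{g\<in>M. g \<inter> f \<noteq> {}} - e" by blast
  qed
  have "card (\<Union>w\<in>f - {v}. G w) = (\<Sum>w\<in>f - {v}. card (G w))"
  proof (rule card_UN_disjoint)
    show "\<forall>i\<in>f - {v}. \<forall>j\<in>f - {v}. i \<noteq> j \<longrightarrow> G i \<inter> G j = {}"
    proof (intro ballI impI)
      fix i j assume ij: "i \<in> f - {v}" "j \<in> f - {v}" "i \<noteq> j"
      hence "G i \<noteq> G j" using inj[of i j] by blast
      thus "G i \<inter> G j = {}" using D(3)[OF G(1) G(1), of i j] ij by blast
    qed
  qed (use ffin G(1) finE in auto)
  also have "\<dots> = (\<Sum>w\<in>f - {v}. k)"
  proof (rule sum.cong)
    fix w assume "w \<in> f - {v}"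
    hence "G w \<in> E" using G(1) D(1) by blast
    thus "card (G w) = k" by (rule unif)
  qed simp
  also have "\<dots> = k * (k - 1)" using f ffin unif by simp
  finally have "k * (k - 1) = card (\<Union>w\<in>f - {v}. G w)" by simp
  also have "\<dots> \<le> card (\<Union>{g\<in>M. g \<inter> f \<noteq> {}} - e)"
  proof (rule card_mono[OF _ sub])
    have "\<Union>{g\<in>M. g \<inter> f \<noteq> {}} - e \<subseteq> U" using D(2) by blast
    thus "finite (\<Union>{g\<in>M. g \<inter> f \<noteq> {}} - e)" using fin by (rule finite_subset)
  qed
  finally show ?thesis .
qed

text \<open>A random order is sampled by independent uniform times in \<open>{..<L}\<close>, ties being broken by the fixed
  numbering \<open>idx\<close>; here the times of the vertices of \<open>e\<close> are conditioned to be \<open>\<sigma>\<close>.\<close>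

lemma sum_ln_open_edges_le:
  fixes idx :: "'a \<Rightarrow> nat"
  assumes finE: "finite E" and fin: "finite U"
    and unif: "\<And>e. e \<in> E \<Longrightarrow> card e = k" and k: "k > 0"
    and linear: "\<And>e f. e \<in> E \<Longrightarrow> f \<in> E \<Longrightarrow> e \<noteq> f \<Longrightarrow> card (e \<inter> f) \<le> 1"
    and deg: "\<And>v. v \<in> U \<Longrightarrow> card {f\<in>E. v \<in> f \<and> f \<subseteq> U} \<le> D"
    and L: "L > 0"
    and idx: "inj_on idx U" "\<And>v. v \<in> U \<Longrightarrow> idx v < n"
    and M: "M \<in> perfect_matchings E U" and e: "e \<in> M"
    and \<sigma>: "\<sigma> \<in> PiE e (\<lambda>_. {..<L})"
  defines "t \<equiv> Min (\<sigma> ` e)"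
  defines "\<rho> \<equiv> \<lambda>\<tau> x. (if x \<in> e then \<sigma> x else \<tau> x) * n + idx x"
  shows "(\<Sum>\<tau>\<in>PiE (U - e) (\<lambda>_. {..<L}). ln (real (card (open_edges E (\<rho> \<tau>) M e))))
     \<le> real L ^ (card U - k) * ln (1 + real D * (real (L - t) / real L) ^ (k * (k - 1)))"
proof -
  note D = perfect_matchingsD[OF M]
  have eE: "e \<in> E" "e \<subseteq> U" using e D(1,2) by blast+
  have fe: "finite e" "e \<noteq> {}" using unif[OF eE(1)] k by (auto intro: card_ge_0_finite)
  have cardT: "card (PiE (U - e) (\<lambda>_. {..<L})) = L ^ (card U - k)"
    using fin eE fe unif by (simp add: card_PiE card_Diff_subset)
  define \<rho>' where "\<rho>' = (\<lambda>x. \<sigma> x * n + idx x)"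
  have "Min (\<rho>' ` e) \<in> \<rho>' ` e" using fe by (intro Min_in) auto
  then obtain v where v: "v \<in> e" "\<rho>' v = Min (\<rho>' ` e)" by auto
  have Minr: "Min (\<rho> \<tau> ` e) = \<rho> \<tau> v" for \<tau>
  proof -
    have "\<rho> \<tau> ` e = \<rho>' ` e" by (rule image_cong) (auto simp: \<rho>_def \<rho>'_def)
    thus ?thesis using v by (simp add: \<rho>_def \<rho>'_def)
  qed
  have n: "n > 0" using idx(2)[of v] v(1) eE by auto
  \<comment> \<open>The order is lexicographic by time and then by index: \<open>div n\<close>
    recovers the time, \<open>mod n\<close> the index.\<close>
  have dv: "\<rho> \<tau> x div n = (if x \<in> e then \<sigma> x else \<tau> x)" if "x \<in> U" for x \<tau>
    using idx(2)[OF that] by (simp add: \<rho>_def)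
  have md: "\<rho> \<tau> x mod n = idx x" if "x \<in> U" for x \<tau>
    using idx(2)[OF that] by (simp add: \<rho>_def)
  have inj: "inj_on (\<rho> \<tau>) U" for \<tau>
    using md idx(1) by (metis inj_on_def)
  have sv: "\<sigma> v = t"
    unfolding t_def
  proof (rule Min_eqI[symmetric])
    fix y assume "y \<in> \<sigma> ` e"
    then obtain x where x: "x \<in> e" "y = \<sigma> x" by auto
    have "\<rho> \<sigma> v \<le> \<rho> \<sigma> x" using Minr[of \<sigma>] x(1) fe by (metis Min_le finite_imageI imageI)
    hence "\<rho> \<sigma> v div n \<le> \<rho> \<sigma> x div n" by (rule div_le_mono)
    moreover have "v \<in> U" "x \<in> U" using v(1) x(1) eE(2) by blast+
    ultimately show "\<sigma> v \<le> y" using dv[of v \<sigma>] dv[of x \<sigma>] x by simp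
  qed (use fe v in auto)
  have tL: "t < L" using sv v(1) \<sigma> by (auto simp: PiE_iff)
  define F where "F = {f\<in>E. v \<in> f \<and> f \<subseteq> U \<and> f \<noteq> e}"
  define G where "G = (\<lambda>f. \<Union>{g\<in>M. g \<inter> f \<noteq> {}} - e)"
  define x where "x = real (L - t) / real L"
  have x: "0 \<le> x" "x \<le> 1" using tL by (auto simp: x_def)
  have finF: "finite F" using finE by (simp add: F_def)
  have cF: "card F \<le> D"
  proof -
    have "card F \<le> card {f\<in>E. v \<in> f \<and> f \<subseteq> U}"
      using finE by (intro card_mono) (auto simp: F_def)
    also have "\<dots> \<le> D" using deg v eE by blast
    finally show ?thesis .
  qed
  \<comment> \<open>Only the weak inequality between times is kept, so ties broken by
    \<open>idx\<close> can only enlarge the right-hand side.\<close>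
  have sub: "open_edges E (\<rho> \<tau>) M e \<subseteq> insert e {f\<in>F. \<forall>y\<in>G f. t \<le> \<tau> y}" for \<tau>
  proof
    fix f assume f: "f \<in> open_edges E (\<rho> \<tau>) M e"
    hence fE: "f \<in> E" and fU: "f \<subseteq> U" and vf: "\<rho> \<tau> v \<in> \<rho> \<tau> ` f"
      and ok: "\<And>g. g \<in> M \<Longrightarrow> g \<inter> f \<noteq> {} \<Longrightarrow> \<rho> \<tau> v \<le> Min (\<rho> \<tau> ` g)"
      unfolding open_edges_def Minr D(2) by blast+
    have vf: "v \<in> f" 
    proof -
      obtain w where w: "w \<in> f" "\<rho> \<tau> v = \<rho> \<tau> w" using vf by blast
      have "v \<in> U" "w \<in> U" using w(1) v(1) eE(2) fU by blast+
      thus ?thesis using inj_onD[OF inj w(2)] w(1) by simp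
    qed
    have "t \<le> \<tau> y" if y: "y \<in> G f" for y
    proof -
      obtain g where g: "g \<in> M" "g \<inter> f \<noteq> {}" "y \<in> g" "y \<notin> e" using y by (auto simp: G_def)
      have "g \<subseteq> U" using g D(2) by blast
      hence yU: "y \<in> U" "finite g" using g fin finite_subset by blast+
      have "\<rho> \<tau> v \<le> \<rho> \<tau> y" using ok[OF g(1,2)] Min_le[OF finite_imageI[OF yU(2)] imageI[OF g(3)], of "\<rho> \<tau>"] by (rule order_trans)
      hence "\<rho> \<tau> v div n \<le> \<rho> \<tau> y div n" by (rule div_le_mono)
      moreover have "v \<in> U" using v(1) eE(2) by blast
      ultimately show ?thesis using dv[of v \<tau>] dv[of y \<tau>] v(1) g(4) yU sv by simp
    qed
    thus "f \<in> insert e {f\<in>F. \<forall>y\<in>G f. t \<le> \<tau> y}"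
      unfolding F_def using fE fU vf by blast
  qed
  have bound: "card (open_edges E (\<rho> \<tau>) M e) \<le> 1 + card {f\<in>F. \<forall>y\<in>G f. t \<le> \<tau> y}" for \<tau>
  proof -
    have "card (open_edges E (\<rho> \<tau>) M e) \<le> card (insert e {f\<in>F. \<forall>y\<in>G f. t \<le> \<tau> y})"
      using sub finF by (intro card_mono) auto
    also have "\<dots> \<le> 1 + card {f\<in>F. \<forall>y\<in>G f. t \<le> \<tau> y}"
      using finF by (simp add: card_insert_if)
    finally show ?thesis .
  qed
  let ?T = "PiE (U - e) (\<lambda>_. {..<L})"
  have finT: "finite ?T" using fin by (auto intro: finite_PiE)
  have one: "real (card {\<tau>\<in>?T. \<forall>y\<in>G f. t \<le> \<tau> y}) \<le> real L ^ (card U - k) * x ^ (k * (k - 1))"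
    if f: "f \<in> F" for f
  proof -
    have GU: "G f \<subseteq> U - e" using D(2) by (auto simp: G_def)
    have "real (card {\<tau>\<in>?T. \<forall>y\<in>G f. t \<le> \<tau> y}) = real L ^ card (U - e) * x ^ card (G f)"
      unfolding x_def using fin GU tL L by (intro card_PiE_atLeast) auto
    also have "card (U - e) = card U - k" using fin eE fe unif by (simp add: card_Diff_subset)
    also have "real L ^ (card U - k) * x ^ card (G f) \<le> real L ^ (card U - k) * x ^ (k * (k - 1))"
    proof (intro mult_left_mono power_decreasing)
      show "k * (k - 1) \<le> card (G f)" unfolding G_def
        by (rule card_Union_touching_ge[OF M fin unif linear e])
           (use f v in \<open>auto simp: F_def\<close>)
    qed (use x in auto)
    finally show ?thesis .
  qed
  \<comment> \<open>The summand 1 stands for \<open>e\<close> itself; each of the at most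
    \<open>D\<close> other edges survives with probability at most \<open>x ^ (k * (k - 1))\<close>.
    Jensen's inequality below then moves the logarithm outside the average.\<close>
  have sumle: "(\<Sum>\<tau>\<in>?T. real (card (open_edges E (\<rho> \<tau>) M e))) \<le> real (card ?T) * (1 + real D * x ^ (k * (k - 1)))"
  proof -
    have "(\<Sum>\<tau>\<in>?T. real (card (open_edges E (\<rho> \<tau>) M e))) \<le> (\<Sum>\<tau>\<in>?T. 1 + real (card {f\<in>F. \<forall>y\<in>G f. t \<le> \<tau> y}))"
      by (intro sum_mono) (use of_nat_mono[OF bound, where ?'a = real] in simp)
    also have "\<dots> = real (card ?T) + (\<Sum>\<tau>\<in>?T. \<Sum>f\<in>F. if \<forall>y\<in>G f. t \<le> \<tau> y then 1 else 0)"
      using finF by (simp add: sum.distrib real_card_filter)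
    also have "(\<Sum>\<tau>\<in>?T. \<Sum>f\<in>F. if \<forall>y\<in>G f. t \<le> \<tau> y then 1 else 0) = (\<Sum>f\<in>F. real (card {\<tau>\<in>?T. \<forall>y\<in>G f. t \<le> \<tau> y}))"
      using finT by (subst sum.swap) (simp add: real_card_filter)
    also have "\<dots> \<le> (\<Sum>f\<in>F. real L ^ (card U - k) * x ^ (k * (k - 1)))"
      by (intro sum_mono one)
    also have "\<dots> = real (card F) * (real L ^ (card U - k) * x ^ (k * (k - 1)))" by simp
    also have "\<dots> \<le> real D * (real L ^ (card U - k) * x ^ (k * (k - 1)))"
      using cF x by (intro mult_right_mono) auto
    finally show ?thesis unfolding cardT by (simp add: algebra_simps)
  qed
  have "(\<Sum>\<tau>\<in>?T. ln (real (card (open_edges E (\<rho> \<tau>) M e)))) \<le> real (card ?T) * ln (1 + real D * x ^ (k * (k - 1)))"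
  proof (rule sum_ln_le_card_mult_ln_avg[OF finT _ _ sumle])
    show "?T \<noteq> {}" using cardT L by (metis card.empty power_not_zero less_numeral_extra(3) gr0_conv_Suc nat.distinct(1))
    show "0 < 1 + real D * x ^ (k * (k - 1))" using x by (intro add_pos_nonneg) auto
    fix \<tau> assume "\<tau> \<in> ?T"
    have "g = e" if "g \<in> M" "g \<inter> e \<noteq> {}" for g using D(3)[OF that(1) e] that(2) by blast
    hence "\<forall>g\<in>M. g \<inter> e \<noteq> {} \<longrightarrow> \<rho> \<tau> v \<le> Min (\<rho> \<tau> ` g)" using Minr[of \<tau>] by (metis order_refl)
    hence "e \<in> open_edges E (\<rho> \<tau>) M e"
      unfolding open_edges_def Minr D(2) using eE v(1) by blast
    moreover have "finite (open_edges E (\<rho> \<tau>) M e)" using finE by (simp add: open_edges_def)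
    ultimately show "0 < real (card (open_edges E (\<rho> \<tau>) M e))" by (metis card_gt_0_iff empty_iff of_nat_0_less_iff)
  qed
  thus ?thesis unfolding x_def cardT by simp
qed

text \<open>The Gibbs bound is averaged over all assignments of times and the sums are exchanged.
  The averaged bound for one edge involves only the minimum of \<open>k\<close> times, hence is the
  same for all edges of all matchings, and each matching has \<open>card U / k\<close>
  edges.\<close>

lemma ln_card_perfect_matchings_le_sum:
  assumes finE: "finite E" and fin: "finite U"
    and unif: "\<And>e. e \<in> E \<Longrightarrow> card e = k" and k: "k > 0"
    and linear: "\<And>e f. e \<in> E \<Longrightarrow> f \<in> E \<Longrightarrow> e \<noteq> f \<Longrightarrow> card (e \<inter> f) \<le> 1"
    and deg: "\<And>v. v \<in> U \<Longrightarrow> card {f\<in>E. v \<in> f \<and> f \<subseteq> U} \<le> D"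
    and L: "L > 0" and ne: "perfect_matchings E U \<noteq> {}"
  shows "ln (real (card (perfect_matchings E U))) \<le> real (card U) / real k *
    ((\<Sum>t<L. (real (L - t) ^ k - real (L - Suc t) ^ k) * ln (1 + real D * (real (L - t) / real L) ^ (k * (k - 1)))) / real L ^ k)"
proof -
  let ?P = "perfect_matchings E U"
  let ?F = "\<lambda>_::'a. {..<L}"
  define S where "S = (\<Sum>t<L. (real (L - t) ^ k - real (L - Suc t) ^ k) * ln (1 + real D * (real (L - t) / real L) ^ (k * (k - 1))))"
  obtain idx :: "'a \<Rightarrow> nat" and n where idx: "idx ` U = {i. i < n}" "inj_on idx U"
    using finite_imp_inj_to_nat_seg[OF fin] by auto
  have idxn: "idx v < n" if "v \<in> U" for v using idx(1) that by auto
  define \<rho> where "\<rho> = (\<lambda>\<tau> x. \<tau> x * n + idx x)"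
  have inj: "inj_on (\<rho> \<tau>) U" for \<tau>
  proof (rule inj_onI)
    fix x y assume xy: "x \<in> U" "y \<in> U" "\<rho> \<tau> x = \<rho> \<tau> y"
    have "\<rho> \<tau> x mod n = idx x" "\<rho> \<tau> y mod n = idx y"
      using idxn[OF xy(1)] idxn[OF xy(2)] by (simp_all add: \<rho>_def)
    thus "x = y" using xy idx(2) by (metis inj_onD)
  qed
  let ?T = "PiE U ?F"
  have finT: "finite ?T" using fin by (auto intro: finite_PiE)
  have cardT: "card ?T = L ^ card U" using fin by (simp add: card_PiE)
  have E1: "\<And>e. e \<in> E \<Longrightarrow> finite e" "{} \<notin> E" using unif k by (metis card.infinite less_numeral_extra(3), metis card.empty less_numeral_extra(3))
  have edge: "(\<Sum>\<tau>\<in>?T. ln (real (card (open_edges E (\<rho> \<tau>) M e)))) \<le> real L ^ (card U - k) * S"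
    if M: "M \<in> ?P" and e: "e \<in> M" for M e
  proof -
    have eE: "e \<in> E" "e \<subseteq> U" using e perfect_matchingsD(1,2)[OF M] by blast+
    hence "U = e \<union> (U - e)" by blast
    hence "(\<Sum>\<tau>\<in>?T. ln (real (card (open_edges E (\<rho> \<tau>) M e)))) =
       (\<Sum>\<sigma>\<in>PiE e ?F. \<Sum>\<tau>\<in>PiE (U - e) ?F. ln (real (card (open_edges E (\<rho> (\<lambda>x. if x \<in> e then \<sigma> x else \<tau> x)) M e))))"
      using sum_PiE_Un[of e "U - e" "\<lambda>\<tau>. ln (real (card (open_edges E (\<rho> \<tau>) M e)))" ?F] by auto
    also have "\<dots> \<le> (\<Sum>\<sigma>\<in>PiE e ?F. real L ^ (card U - k) * ln (1 + real D * (real (L - Min (\<sigma> ` e)) / real L) ^ (k * (k - 1))))"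
      unfolding \<rho>_def
      by (intro sum_mono sum_ln_open_edges_le[OF finE fin unif k linear deg L idx(2) idxn M e])
    also have "\<dots> = real L ^ (card U - k) * (\<Sum>\<sigma>\<in>PiE e ?F. ln (1 + real D * (real (L - Min (\<sigma> ` e)) / real L) ^ (k * (k - 1))))"
      by (simp add: sum_distrib_left)
    also have "\<dots> = real L ^ (card U - k) * S"
      unfolding S_def using sum_PiE_Min[of e k "\<lambda>t. ln (1 + real D * (real (L - t) / real L) ^ (k * (k - 1)))" L]
        eE unif k E1 by simp
    finally show ?thesis .
  qed
  have cM: "real k * real (card M) = real (card U)" if M: "M \<in> ?P" for M
  proof -
    have "card (\<Union>M) = (\<Sum>e\<in>M. card e)"
      using M E1 by (intro card_Union_disjoint) (auto simp: perfect_matchings_def)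
    also have "\<dots> = (\<Sum>e\<in>M. k)" using perfect_matchingsD(1)[OF M] unif by (intro sum.cong refl) blast
    finally have "card U = card M * k" unfolding perfect_matchingsD(2)[OF M] by simp
    thus ?thesis by simp
  qed
  \<comment> \<open>Guards the truncated subtraction \<open>card U - k\<close> when the powers of
    \<open>L\<close> are split.\<close>
  have kU: "k \<le> card U" if "U \<noteq> {}"
  proof -
    obtain M where M: "M \<in> ?P" using ne by auto
    have "card M \<noteq> 0" using cM[OF M] that fin by auto
    hence "real k * 1 \<le> real k * real (card M)" by (intro mult_left_mono) auto
    thus ?thesis using cM[OF M] by simp
  qed
  have "real (card ?T) * (real (card ?P) * ln (real (card ?P))) = (\<Sum>\<tau>\<in>?T. real (card ?P) * ln (real (card ?P)))" by simp
  also have "\<dots> \<le> (\<Sum>\<tau>\<in>?T. \<Sum>M\<in>?P. \<Sum>e\<in>M. ln (real (card (open_edges E (\<rho> \<tau>) M e))))"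
    by (intro sum_mono ln_card_perfect_matchings_le finE fin E1 inj)
  also have "\<dots> = (\<Sum>M\<in>?P. \<Sum>e\<in>M. \<Sum>\<tau>\<in>?T. ln (real (card (open_edges E (\<rho> \<tau>) M e))))"
    by (subst sum.swap, rule sum.cong[OF refl], subst sum.swap) simp
  also have "\<dots> \<le> (\<Sum>M\<in>?P. \<Sum>e\<in>M. real L ^ (card U - k) * S)"
    by (intro sum_mono edge)
  also have "\<dots> = (\<Sum>M\<in>?P. real (card U) / real k * (real L ^ (card U - k) * S))"
    using cM k by (intro sum.cong) (auto simp: field_simps)
  also have "\<dots> = real (card ?P) * (real (card U) / real k * (real L ^ (card U - k) * S))" by simp
  finally have "real (card ?P) * (real L ^ card U * ln (real (card ?P))) \<le> real (card ?P) * (real (card U) / real k * (real L ^ (card U - k) * S))"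
    unfolding cardT by (simp add: mult_ac)
  hence "real L ^ card U * ln (real (card ?P)) \<le> real (card U) / real k * (real L ^ (card U - k) * S)"
    by (rule mult_left_le_imp_le) (use ne finite_perfect_matchings[OF finE, of U] in \<open>simp add: card_gt_0_iff\<close>)
  also have "\<dots> = real L ^ card U * (real (card U) / real k * (S / real L ^ k))"
  proof (cases "U = {}")
    case False
    hence "real L ^ card U = real L ^ (card U - k) * real L ^ k" using kU by (simp flip: power_add)
    thus ?thesis using L by simp
  qed simp
  finally show ?thesis unfolding S_def[symmetric] by (rule mult_left_le_imp_le) (use L in simp)
qed

section \<open>Evaluating the entropy sum\<close>

lemma power_diff_le_mult:
  fixes a b :: real
  assumes "0 \<le> b" "b \<le> a"
  shows "a ^ k - b ^ k \<le> real k * (a - b) * a ^ (k - 1)"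
proof (induction k)
  case (Suc k)
  have "a ^ Suc k - b ^ Suc k = a * (a ^ k - b ^ k) + (a - b) * b ^ k" by (simp add: algebra_simps)
  also have "\<dots> \<le> a * (real k * (a - b) * a ^ (k - 1)) + (a - b) * a ^ k"
    using Suc assms by (intro add_mono mult_left_mono power_mono) auto
  also have "\<dots> = real (Suc k) * (a - b) * a ^ k"
    by (cases k) (simp_all add: algebra_simps)
  finally show ?case by simp
qed simp

text \<open>Discrete form of the integral of k x^(k - 1) ln x from 0 to L, which is L^k ln L - L^k /
  k; the last term bounds the error of the Riemann sum.\<close>

lemma sum_power_diff_mult_ln_le:
  assumes "k \<ge> 2"
  shows "(\<Sum>j=1..L. (real j ^ k - real (j - 1) ^ k) * ln (real j))
    \<le> real L ^ k * ln (real L) - real L ^ k / real k + 2 * real L ^ (k - 1)"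
proof (induction L)
  case 0
  thus ?case using assms by (simp add: power_0_left)
next
  case (Suc L)
  show ?case
  proof (cases "L = 0")
    case True
    thus ?thesis using assms by (simp add: divide_simps)
  next
    case False
    define x where "x = real L"
    have x: "x > 0" "real (Suc L) = x + 1" using False by (auto simp: x_def)
    obtain m where m: "k = m + 2" using assms by (metis add.commute le_Suc_ex)
    have "1 / (x + 1) \<le> ln ((x + 1) / x)"
    proof -
      have "ln (x / (x + 1)) \<le> x / (x + 1) - 1" using x by (intro ln_le_minus_one) auto
      thus ?thesis using x by (simp add: ln_div field_simps)
    qed
    hence "x ^ k * (1 / (x + 1)) \<le> x ^ k * (ln (x + 1) - ln x)"
      using x by (intro mult_left_mono) (auto simp: ln_div)
    moreover have "2 * x ^ (k - 1) \<le> x ^ k * (1 / (x + 1)) + (x + 1) ^ (k - 1)"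
    proof -
      have "(x * x / (x + 1)) + (x + 1) - 2 * x = 1 / (x + 1)" using x by (simp add: field_simps)
      hence "2 * x \<le> x * x / (x + 1) + (x + 1)" using x by (smt (verit) divide_nonneg_pos)
      hence "x ^ m * (2 * x) \<le> x ^ m * (x * x / (x + 1) + (x + 1))" using x by (intro mult_left_mono) auto
      also have "\<dots> = x ^ k * (1 / (x + 1)) + x ^ m * (x + 1)" by (simp add: m algebra_simps power2_eq_square)
      also have "\<dots> \<le> x ^ k * (1 / (x + 1)) + (x + 1) ^ m * (x + 1)"
        using x by (intro add_left_mono mult_right_mono power_mono) auto
      finally show ?thesis by (simp add: m mult_ac)
    qed
    moreover have "((x + 1) ^ k - x ^ k) / real k \<le> (x + 1) ^ (k - 1)"
      using power_diff_le_mult[of x "x + 1" k] x assms by (simp add: field_simps)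
    moreover have "(\<Sum>j=1..Suc L. (real j ^ k - real (j - 1) ^ k) * ln (real j))
       = (\<Sum>j=1..L. (real j ^ k - real (j - 1) ^ k) * ln (real j)) + ((x + 1) ^ k - x ^ k) * ln (x + 1)"
      by (simp add: x_def add.commute)
    ultimately show ?thesis using Suc unfolding x(2) x_def[symmetric]
      by (simp add: algebra_simps diff_divide_distrib)
  qed
qed

text \<open>The bound is linear in \<open>z\<close> on purpose: in the application \<open>z\<close>
  is of order x^(-(k - 1)), which the weight k x^(k - 1) makes integrable at 0, whereas
  \<open>z ^ k\<close> would not be.\<close>

lemma ln_one_plus_power_le:
  fixes z :: real
  assumes "z \<ge> 0" "k > 0"
  shows "ln (1 + z ^ k) \<le> real k * z"
proof -
  have "1 + z ^ k \<le> (1 + z) ^ k" using assms(2)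
  proof (induction k rule: nat_induct_non_zero)
    case (Suc n)
    have "1 + z ^ Suc n \<le> (1 + z) * (1 + z ^ n)" using assms by (simp add: algebra_simps)
    also have "\<dots> \<le> (1 + z) * (1 + z) ^ n" using Suc assms by (intro mult_left_mono) auto
    finally show ?case by simp
  qed simp
  hence "ln (1 + z ^ k) \<le> ln ((1 + z) ^ k)" using assms by (subst ln_le_cancel_iff) (auto intro: add_pos_nonneg)
  also have "\<dots> = real k * ln (1 + z)" using assms by (simp add: ln_realpow)
  also have "\<dots> \<le> real k * z" using assms by (intro mult_left_mono ln_add_one_self_le_self) auto
  finally show ?thesis .
qed

text \<open>With x = (L - t) / L the logarithm splits as ln D + k (k - 1) ln x + ln (1 + z^k), where
  z = c / x^(k - 1) and c = D^(-1/k). Against the distribution of the minimum, the first two terms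
  give ln D + 1 - k up to a discretisation error of order 1 / L; the third is at most k z, and the
  weight of order x^(k - 1) cancels the denominator of z.\<close>

lemma entropy_sum_le:
  assumes k: "k \<ge> 2" and D: "D \<ge> 1" and L: "L > 0"
  shows "(\<Sum>t<L. (real (L - t) ^ k - real (L - Suc t) ^ k) * ln (1 + real D * (real (L - t) / real L) ^ (k * (k - 1)))) / real L ^ k
    \<le> ln (real D) + 1 - real k + (real k)\<^sup>2 * real D powr (-1 / real k) + 2 * real k * (real k - 1) / real L"
proof -
  define c where "c = real D powr (-1 / real k)"
  have c: "c > 0" using D by (simp add: c_def)
  have ck: "c ^ k = 1 / real D"
  proof -
    have "c ^ k = c powr real k" using c by (simp add: powr_realpow)
    also have "\<dots> = real D powr (-1)" using k by (simp add: c_def powr_powr)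
    finally show ?thesis using D by (simp add: powr_minus_divide)
  qed
  define m where "m = (\<lambda>j. real j ^ k - real (j - 1) ^ k)"
  have mass: "0 \<le> m j" "m j \<le> real k * real j ^ (k - 1)" if "j \<ge> 1" for j
  proof -
    have "real (j - 1) \<le> real j" "real j - real (j - 1) = 1" using that by auto
    thus "0 \<le> m j" "m j \<le> real k * real j ^ (k - 1)"
      using power_diff_le_mult[of "real (j - 1)" "real j" k] by (auto simp: m_def power_mono)
  qed
  have summand: "m j * ln (1 + real D * (real j / real L) ^ (k * (k - 1)))
      \<le> m j * (ln (real D) - real (k * (k - 1)) * ln (real L)) + real (k * (k - 1)) * (m j * ln (real j)) + (real k)\<^sup>2 * c * real L ^ (k - 1)"
    if j: "j \<ge> 1" "j \<le> L" for j
  proof -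
    define x where "x = real j / real L"
    have x: "x > 0" using j by (simp add: x_def)
    define z where "z = c / x ^ (k - 1)"
    have z: "z \<ge> 0" using c x by (simp add: z_def)
    have zk: "z ^ k = 1 / (real D * x ^ (k * (k - 1)))"
      by (simp add: z_def power_divide ck mult.commute flip: power_mult)
    have "1 + real D * x ^ (k * (k - 1)) = real D * x ^ (k * (k - 1)) * (1 + z ^ k)"
      using D x unfolding zk by (simp add: field_simps)
    moreover have "1 + z ^ k > 0" using z by (simp add: add_pos_nonneg)
    ultimately have "ln (1 + real D * x ^ (k * (k - 1))) = ln (real D) + real (k * (k - 1)) * ln x + ln (1 + z ^ k)"
      using D x z by (simp add: ln_mult ln_realpow del: of_nat_mult)
    also have "\<dots> \<le> ln (real D) + real (k * (k - 1)) * ln x + real k * z"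
      using ln_one_plus_power_le[OF z] k by simp
    finally have "m j * ln (1 + real D * x ^ (k * (k - 1))) \<le> m j * (ln (real D) + real (k * (k - 1)) * ln x + real k * z)"
      using mass(1)[OF j(1)] by (rule mult_left_mono)
    also have "\<dots> = m j * (ln (real D) + real (k * (k - 1)) * ln x) + m j * (real k * z)"
      by (simp add: algebra_simps)
    also have "m j * (real k * z) \<le> real k * real j ^ (k - 1) * (real k * z)"
      using mass(2)[OF j(1)] z by (intro mult_right_mono) auto
    also have "real k * real j ^ (k - 1) * (real k * z) = (real k)\<^sup>2 * c * real L ^ (k - 1)"
      using j by (simp add: z_def x_def field_simps power2_eq_square)
    finally show ?thesis using j L unfolding x_def by (simp add: ln_div algebra_simps)
  qed
  have summ: "(\<Sum>j=1..L. m j) = real L ^ k"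
  proof (induction L)
    case 0
    thus ?case using k by simp
  next
    case (Suc L)
    thus ?case by (simp add: m_def)
  qed
  have "(\<Sum>t<L. (real (L - t) ^ k - real (L - Suc t) ^ k) * ln (1 + real D * (real (L - t) / real L) ^ (k * (k - 1))))
     = (\<Sum>j=1..L. m j * ln (1 + real D * (real j / real L) ^ (k * (k - 1))))"
    by (rule sum.reindex_bij_witness[where i = "\<lambda>j. L - j" and j = "\<lambda>t. L - t"]) (auto simp: m_def)
  also have "\<dots> \<le> (\<Sum>j=1..L. m j * (ln (real D) - real (k * (k - 1)) * ln (real L)) + real (k * (k - 1)) * (m j * ln (real j)) + (real k)\<^sup>2 * c * real L ^ (k - 1))"
    by (intro sum_mono summand) auto
  also have "\<dots> = real L ^ k * (ln (real D) - real (k * (k - 1)) * ln (real L))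
     + real (k * (k - 1)) * (\<Sum>j=1..L. m j * ln (real j)) + real L * ((real k)\<^sup>2 * c * real L ^ (k - 1))"
    by (simp add: sum.distrib summ[unfolded One_nat_def] flip: sum_distrib_left sum_distrib_right)
  also have "\<dots> \<le> real L ^ k * (ln (real D) - real (k * (k - 1)) * ln (real L))
     + real (k * (k - 1)) * (real L ^ k * ln (real L) - real L ^ k / real k + 2 * real L ^ (k - 1)) + real L * ((real k)\<^sup>2 * c * real L ^ (k - 1))"
    unfolding m_def using sum_power_diff_mult_ln_le[OF k] by (intro add_mono mult_left_mono order_refl) auto
  also have "\<dots> = real L ^ k * (ln (real D) + 1 - real k + (real k)\<^sup>2 * c + 2 * real k * (real k - 1) / real L)"
  proof -
    have "real L ^ k = real L * real L ^ (k - 1)" using k by (cases k) auto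
    thus ?thesis using k L by (simp add: field_simps of_nat_diff)
  qed
  finally show ?thesis unfolding c_def[symmetric] using L by (simp add: divide_le_eq mult.commute)
qed

text \<open>The left-hand side does not involve the discretisation \<open>L\<close>, so its error
  disappears in the limit. In exponential form there are at most ((1 + o(1)) D / e^(k - 1))^(|U| /
  k) perfect matchings as D grows.\<close>

theorem ln_card_perfect_matchings_linear_le:
  assumes "finite E" and "finite U"
    and "\<And>e. e \<in> E \<Longrightarrow> card e = k" and k: "k \<ge> 2"
    and "\<And>e f. e \<in> E \<Longrightarrow> f \<in> E \<Longrightarrow> e \<noteq> f \<Longrightarrow> card (e \<inter> f) \<le> 1"
    and "\<And>v. v \<in> U \<Longrightarrow> card {f\<in>E. v \<in> f \<and> f \<subseteq> U} \<le> D"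
    and D: "D \<ge> 1" and "perfect_matchings E U \<noteq> {}"
  shows "ln (real (card (perfect_matchings E U))) \<le>
    real (card U) / real k * (ln (real D) + 1 - real k + (real k)\<^sup>2 * real D powr (-1 / real k))"
proof -
  define Y where "Y = ln (real D) + 1 - real k + (real k)\<^sup>2 * real D powr (-1 / real k)"
  define C where "C = 2 * real k * (real k - 1)"
  define N where "N = real (card U) / real k"
  have bound: "ln (real (card (perfect_matchings E U))) \<le> N * (Y + C / real (Suc L))" for L
  proof -
    have "ln (real (card (perfect_matchings E U))) \<le> N * ((\<Sum>t<Suc L. (real (Suc L - t) ^ k - real (Suc L - Suc t) ^ k) *
        ln (1 + real D * (real (Suc L - t) / real (Suc L)) ^ (k * (k - 1)))) / real (Suc L) ^ k)"
      unfolding N_def by (rule ln_card_perfect_matchings_le_sum) (use assms in auto)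
    also have "\<dots> \<le> N * (Y + C / real (Suc L))"
      using entropy_sum_le[OF k D, of "Suc L"] unfolding Y_def C_def N_def
      by (intro mult_left_mono) (auto simp del: of_nat_Suc)
    finally show ?thesis .
  qed
  have "(\<lambda>L. C / real (Suc L)) \<longlonglongrightarrow> 0"
    by (rule LIMSEQ_Suc) (rule lim_const_over_n)
  hence "(\<lambda>L. N * (Y + C / real (Suc L))) \<longlonglongrightarrow> N * (Y + 0)"
    by (intro tendsto_intros)
  hence "ln (real (card (perfect_matchings E U))) \<le> N * (Y + 0)"
    by (rule LIMSEQ_le_const) (use bound in blast)
  thus ?thesis by (simp add: N_def Y_def)
qed

section \<open>Random subsets\<close>

text \<open>A finite weighted sum instead of a measure: the expectations computed below are then
  polynomial identities in \<open>p\<close>, and bounds on \<open>p\<close> enter only with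
  inequalities.\<close>

definition expect_subset :: "real \<Rightarrow> 'b set \<Rightarrow> ('b set \<Rightarrow> real) \<Rightarrow> real" where
  "expect_subset p A f = (\<Sum>S\<in>Pow A. p ^ card S * (1 - p) ^ card (A - S) * f S)"

text \<open>Independence of the elements, as an expanded product; the event probabilities below are
  special cases.\<close>

lemma expect_subset_prod:
  assumes "finite A"
  shows "expect_subset p A (\<lambda>S. (\<Prod>x\<in>S. a x) * (\<Prod>x\<in>A - S. b x)) = (\<Prod>x\<in>A. p * a x + (1 - p) * b x)"
proof -
  have "(\<Prod>x\<in>A. p * a x + (1 - p) * b x) = (\<Sum>S\<in>Pow A. (\<Prod>x\<in>S. p * a x) * (\<Prod>x\<in>A - S. (1 - p) * b x))"
    by (rule prod_add[OF assms])
  thus ?thesis unfolding expect_subset_def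
    by (simp add: prod.distrib mult_ac)
qed

lemma expect_subset_const [simp]:
  assumes "finite A"
  shows "expect_subset p A (\<lambda>_. c) = c"
proof -
  have "expect_subset p A (\<lambda>_. c) = c * expect_subset p A (\<lambda>S. (\<Prod>x\<in>S. 1) * (\<Prod>x\<in>A - S. 1))"
    unfolding expect_subset_def by (simp add: sum_distrib_left mult_ac)
  also have "\<dots> = c" unfolding expect_subset_prod[OF assms] by simp
  finally show ?thesis .
qed

lemma expect_subset_disjoint:
  assumes "finite A" "G \<subseteq> A"
  shows "expect_subset p A (\<lambda>S. if S \<inter> G = {} then 1 else 0) = (1 - p) ^ card G"
proof -
  let ?a = "\<lambda>x. if x \<in> G then 0 else 1 :: real"
  have "(if S \<inter> G = {} then 1 else 0) = (\<Prod>x\<in>S. ?a x) * (\<Prod>x\<in>A - S. 1)" if "S \<subseteq> A" for S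
  proof (cases "S \<inter> G = {}")
    case True
    hence "(\<Prod>x\<in>S. ?a x) = (\<Prod>x\<in>S. 1)" by (intro prod.cong) auto
    thus ?thesis using True by simp
  qed (use finite_subset[OF that assms(1)] in auto)
  hence "expect_subset p A (\<lambda>S. if S \<inter> G = {} then 1 else 0) =
      expect_subset p A (\<lambda>S. (\<Prod>x\<in>S. ?a x) * (\<Prod>x\<in>A - S. 1))"
    unfolding expect_subset_def by (intro sum.cong) auto
  also have "\<dots> = (\<Prod>x\<in>A. if x \<in> G then 1 - p else 1)"
    unfolding expect_subset_prod[OF assms(1)] by (rule prod.cong) auto
  also have "\<dots> = (1 - p) ^ card G"
    using assms by (simp add: prod.If_cases Int_absorb1)
  finally show ?thesis .
qed

lemma expect_subset_superset:
  assumes "finite A" "G \<subseteq> A"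
  shows "expect_subset p A (\<lambda>S. if G \<subseteq> S then 1 else 0) = p ^ card G"
proof -
  let ?b = "\<lambda>x. if x \<in> G then 0 else 1 :: real"
  have "(if G \<subseteq> S then 1 else 0) = (\<Prod>x\<in>S. 1) * (\<Prod>x\<in>A - S. ?b x)" if "S \<subseteq> A" for S
  proof (cases "G \<subseteq> S")
    case True
    hence "(\<Prod>x\<in>A - S. ?b x) = (\<Prod>x\<in>A - S. 1)" by (intro prod.cong) auto
    thus ?thesis using True by simp
  qed (use assms in auto)
  hence "expect_subset p A (\<lambda>S. if G \<subseteq> S then 1 else 0) =
      expect_subset p A (\<lambda>S. (\<Prod>x\<in>S. 1) * (\<Prod>x\<in>A - S. ?b x))"
    unfolding expect_subset_def by (intro sum.cong) auto
  also have "\<dots> = (\<Prod>x\<in>A. if x \<in> G then p else 1)"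
    unfolding expect_subset_prod[OF assms(1)] by (rule prod.cong) auto
  also have "\<dots> = p ^ card G"
    using assms by (simp add: prod.If_cases Int_absorb1)
  finally show ?thesis .
qed

lemma expect_subset_add:
  "expect_subset p A (\<lambda>S. f S + g S) = expect_subset p A f + expect_subset p A g"
  by (simp add: expect_subset_def sum.distrib algebra_simps)

lemma expect_subset_diff:
  "expect_subset p A (\<lambda>S. f S - g S) = expect_subset p A f - expect_subset p A g"
  by (simp add: expect_subset_def sum_subtractf algebra_simps)

lemma expect_subset_cmult:
  "expect_subset p A (\<lambda>S. c * f S) = c * expect_subset p A f"
  by (simp add: expect_subset_def sum_distrib_left algebra_simps)

lemma expect_subset_sum:
  "expect_subset p A (\<lambda>S. \<Sum>i\<in>I. f i S) = (\<Sum>i\<in>I. expect_subset p A (f i))"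
  unfolding expect_subset_def by (subst sum.swap) (simp add: sum_distrib_left)

lemma expect_subset_cong:
  "(\<And>S. S \<subseteq> A \<Longrightarrow> f S = g S) \<Longrightarrow> expect_subset p A f = expect_subset p A g"
  unfolding expect_subset_def by (intro sum.cong) auto

lemma expect_subset_mono:
  assumes "0 \<le> p" "p \<le> 1" "\<And>S. S \<subseteq> A \<Longrightarrow> f S \<le> g S"
  shows "expect_subset p A f \<le> expect_subset p A g"
  unfolding expect_subset_def using assms by (intro sum_mono mult_left_mono) auto

lemma expect_subset_card_Int:
  assumes "finite A" "B \<subseteq> A"
  shows "expect_subset p A (\<lambda>S. real (card (S \<inter> B))) = p * real (card B)"
proof -
  have finB: "finite B" using assms finite_subset by blast
  have "real (card (S \<inter> B)) = (\<Sum>x\<in>B. if {x} \<subseteq> S then 1 else 0)" for S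
    using finB by (simp add: sum.If_cases Int_commute Int_def)
  hence "expect_subset p A (\<lambda>S. real (card (S \<inter> B))) =
      (\<Sum>x\<in>B. expect_subset p A (\<lambda>S. if {x} \<subseteq> S then 1 else 0))"
    by (simp only: expect_subset_sum)
  also have "\<dots> = (\<Sum>x\<in>B. p)"
    using assms by (intro sum.cong refl) (subst expect_subset_superset, auto)
  finally show ?thesis by simp
qed

lemma expect_subset_card_Int_square_le:
  assumes "finite A" "B \<subseteq> A" "0 \<le> p"
  shows "expect_subset p A (\<lambda>S. (real (card (S \<inter> B)))\<^sup>2) \<le> p * real (card B) + (p * real (card B))\<^sup>2"
proof -
  have finB: "finite B" using assms finite_subset by blast
  have c: "real (card (S \<inter> B)) = (\<Sum>x\<in>B. if x \<in> S then 1 else 0)" for S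
    using finB by (simp add: sum.If_cases Int_commute Int_def)
  have "(real (card (S \<inter> B)))\<^sup>2 = (\<Sum>x\<in>B. \<Sum>y\<in>B. if {x, y} \<subseteq> S then 1 else 0)" for S
    unfolding c power2_eq_square sum_product by (intro sum.cong refl) auto
  hence "expect_subset p A (\<lambda>S. (real (card (S \<inter> B)))\<^sup>2) =
      (\<Sum>x\<in>B. \<Sum>y\<in>B. expect_subset p A (\<lambda>S. if {x, y} \<subseteq> S then 1 else 0))"
    by (simp only: expect_subset_sum)
  also have "\<dots> = (\<Sum>x\<in>B. \<Sum>y\<in>B. p ^ card {x, y})"
    using assms by (intro sum.cong refl) (subst expect_subset_superset, auto)
  also have "\<dots> \<le> (\<Sum>x\<in>B. \<Sum>y\<in>B. (if x = y then p else 0) + p\<^sup>2)"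
    using assms by (intro sum_mono) (auto simp: card_insert_if power2_eq_square)
  also have "\<dots> = p * real (card B) + (p * real (card B))\<^sup>2"
    using finB by (simp add: sum.distrib power2_eq_square algebra_simps)
  finally show ?thesis .
qed

section \<open>Entropy of random subsets, and elementary inequalities\<close>

definition binary_entropy :: "real \<Rightarrow> real" where
  "binary_entropy p = - p * ln p - (1 - p) * ln (1 - p)"

text \<open>With \<open>binary_entropy_le\<close> this gives ln (1 / p) + 1, up to an error
  \<open>p\<close>, as the entropy per expected selected element. The 1 in it is the 1 in the final
  formula.\<close>

lemma binary_entropy_ge:
  assumes "0 < p" "p < 1"
  shows "p * (ln (1 / p) + 1 - p) \<le> binary_entropy p"
proof -
  have "ln (1 - p) \<le> - p" using ln_le_minus_one[of "1 - p"] assms by simp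
  hence "(1 - p) * ln (1 - p) \<le> (1 - p) * (- p)" using assms by (intro mult_left_mono) auto
  thus ?thesis using assms by (simp add: binary_entropy_def ln_div algebra_simps)
qed

lemma binary_entropy_le:
  assumes "0 < p" "p < 1"
  shows "binary_entropy p \<le> p * (ln (1 / p) + 1)"
proof -
  have "ln (1 / (1 - p)) \<le> 1 / (1 - p) - 1" using assms by (intro ln_le_minus_one) auto
  hence "(1 - p) * ln (1 / (1 - p)) \<le> (1 - p) * (1 / (1 - p) - 1)" using assms by (intro mult_left_mono) auto
  thus ?thesis using assms by (simp add: binary_entropy_def ln_div algebra_simps)
qed

text \<open>Gibbs variational principle: the logarithm of a partition function is at least the mean
  of \<open>ln (Z S)\<close> plus the entropy, for any distribution of S; here it is the product
  distribution of \<open>expect_subset\<close>. This turns the random selection from one colour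
  class into a count, with no event to be conditioned on.\<close>

lemma ln_sum_Pow_ge:
  assumes "finite A" "0 < p" "p < 1" and Z: "\<And>S. S \<subseteq> A \<Longrightarrow> Z S > 0"
  shows "expect_subset p A (\<lambda>S. ln (Z S)) + real (card A) * binary_entropy p \<le> ln (\<Sum>S\<in>Pow A. Z S)"
proof -
  define w where "w = (\<lambda>S. p ^ card S * (1 - p) ^ card (A - S))"
  have w: "w S > 0" for S using assms by (simp add: w_def)
  have sw: "(\<Sum>S\<in>Pow A. w S) = 1"
    using expect_subset_const[OF assms(1), of p 1] by (simp add: expect_subset_def w_def)
  define Y where "Y = (\<Sum>S\<in>Pow A. Z S)"
  have Y: "Y > 0" unfolding Y_def using assms by (intro sum_pos) auto
  have ent: "(\<Sum>S\<in>Pow A. w S * (- ln (w S))) = real (card A) * binary_entropy p"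
  proof -
    have "(\<Sum>S\<in>Pow A. w S * (- ln (w S))) = expect_subset p A (\<lambda>S. - ln (w S))"
      by (simp add: expect_subset_def w_def)
    also have "\<dots> = expect_subset p A (\<lambda>S. - ln (1 - p) * real (card A) - (ln p - ln (1 - p)) * real (card (S \<inter> A)))"
    proof (rule expect_subset_cong)
      fix S assume S: "S \<subseteq> A"
      have "real (card (A - S)) = real (card A) - real (card S)"
        using S assms(1) by (simp add: card_Diff_subset finite_subset card_mono of_nat_diff)
      moreover have "S \<inter> A = S" using S by blast
      ultimately show "- ln (w S) = - ln (1 - p) * real (card A) - (ln p - ln (1 - p)) * real (card (S \<inter> A))"
        using assms(2,3) by (simp add: w_def ln_mult ln_realpow left_diff_distrib right_diff_distrib mult.commute)
    qed
    also have "\<dots> = - ln (1 - p) * real (card A) - (ln p - ln (1 - p)) * (p * real (card A))"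
      using assms(1) by (simp add: expect_subset_diff expect_subset_cmult expect_subset_card_Int)
    finally show ?thesis by (simp add: binary_entropy_def algebra_simps)
  qed
  have "(\<Sum>S\<in>Pow A. w S * (ln (Z S) - ln (w S) - ln Y)) \<le> (\<Sum>S\<in>Pow A. Z S / Y - w S)"
  proof (rule sum_mono)
    fix S assume "S \<in> Pow A"
    hence z: "Z S > 0" using Z by auto
    have "ln (Z S) - ln (w S) - ln Y = ln (Z S / (w S * Y))" using z w[of S] Y by (simp add: ln_div ln_mult)
    also have "\<dots> \<le> Z S / (w S * Y) - 1" using z w[of S] Y by (intro ln_le_minus_one) auto
    finally have "w S * (ln (Z S) - ln (w S) - ln Y) \<le> w S * (Z S / (w S * Y) - 1)"
      using w[of S] by (intro mult_left_mono) auto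
    also have "\<dots> = Z S / Y - w S" using w[of S] Y by (simp add: field_simps)
    finally show "w S * (ln (Z S) - ln (w S) - ln Y) \<le> Z S / Y - w S" .
  qed
  also have "\<dots> = 0" using sw Y by (simp add: sum_subtractf Y_def flip: sum_divide_distrib)
  finally have "(\<Sum>S\<in>Pow A. w S * ln (Z S)) + (\<Sum>S\<in>Pow A. w S * (- ln (w S))) - (\<Sum>S\<in>Pow A. w S) * ln Y \<le> 0"
    by (simp add: algebra_simps sum.distrib sum_subtractf sum_distrib_left sum_negf)
  thus ?thesis unfolding sw ent Y_def[symmetric]
    by (simp add: expect_subset_def w_def)
qed

text \<open>Equivalent to n! \<ge> (n / e)^n; the discrete form of the mean -1 of ln on
  [0, 1].\<close>

lemma sum_ln_ratio_ge:
  assumes "n > 0"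
  shows "- real n \<le> (\<Sum>j=1..n. ln (real j / real n))"
proof -
  have *: "real n * ln (real n) - real n \<le> (\<Sum>j=1..n. ln (real j))" for n
  proof (induction n)
    case (Suc n)
    show ?case
    proof (cases "n = 0")
      case False
      have "ln ((real n + 1) / real n) \<le> (real n + 1) / real n - 1"
        using False by (intro ln_le_minus_one) (auto intro: divide_pos_pos)
      hence "ln (real n + 1) - ln (real n) \<le> 1 / real n" using False by (simp add: ln_div field_simps)
      hence "real n * (ln (real n + 1) - ln (real n)) \<le> real n * (1 / real n)" by (intro mult_left_mono) auto
      hence "real n * ln (real n + 1) - 1 \<le> real n * ln (real n)" using False by (simp add: algebra_simps)
      thus ?thesis using Suc by (simp add: algebra_simps)
    qed simp
  qed simp
  have "(\<Sum>j=1..n. ln (real j / real n)) = (\<Sum>j=1..n. ln (real j)) - real n * ln (real n)"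
    using assms by (simp add: ln_div sum_subtractf)
  thus ?thesis using *[of n] by simp
qed

lemma power_diff_ge_mult:
  fixes a b :: real
  assumes "0 \<le> b" "b \<le> a"
  shows "real k * (a - b) * b ^ (k - 1) \<le> a ^ k - b ^ k"
proof (induction k)
  case (Suc k)
  have "real (Suc k) * (a - b) * b ^ k = b * (real k * (a - b) * b ^ (k - 1)) + (a - b) * b ^ k"
    by (cases k) (simp_all add: algebra_simps)
  also have "\<dots> \<le> b * (a ^ k - b ^ k) + (a - b) * a ^ k"
    using Suc assms by (intro add_mono mult_left_mono power_mono) auto
  also have "\<dots> = a ^ Suc k - b ^ Suc k" by (simp add: algebra_simps)
  finally show ?case by simp
qed simp

text \<open>The union bound and its second-order counterpart for at least one of \<open>m\<close>
  independent events of probability \<open>p\<close>.\<close>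

lemma power_one_minus_bounds:
  fixes p :: real
  assumes "0 \<le> p" "p \<le> 1"
  shows "1 - (1 - p) ^ m \<le> p * real m" "p * real m - (p * real m)\<^sup>2 \<le> 1 - (1 - p) ^ m"
proof -
  show "1 - (1 - p) ^ m \<le> p * real m"
    using Bernoulli_inequality[of "- p" m] assms by (simp add: mult.commute)
  show "p * real m - (p * real m)\<^sup>2 \<le> 1 - (1 - p) ^ m"
  proof (induction m)
    case (Suc m)
    have ge: "1 - p * real m \<le> (1 - p) ^ m"
      using Bernoulli_inequality[of "- p" m] assms by (simp add: mult.commute)
    have "1 - (1 - p) ^ Suc m = (1 - (1 - p) ^ m) + p * (1 - p) ^ m" by (simp add: algebra_simps)
    also have "\<dots> \<ge> (p * real m - (p * real m)\<^sup>2) + p * (1 - p * real m)"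
      using Suc ge assms by (intro add_mono mult_left_mono) auto
    finally have *: "(p * real m - (p * real m)\<^sup>2) + p * (1 - p * real m) \<le> 1 - (1 - p) ^ Suc m" .
    have "(p * real m + p) - (p * real m + p)\<^sup>2 \<le> (p * real m - (p * real m)\<^sup>2) + p * (1 - p * real m)"
      using assms by (simp add: power2_eq_square algebra_simps)
    also note *
    finally show ?case by (simp add: algebra_simps)
  qed simp
qed

text \<open>For nonnegative \<open>X\<close> the sum of squares is at most the square of the sum, so
  a positive left-hand side can be charged to the negative entries. With a and b the sums of the
  positive and negative parts, a^2 - 2 (a - b)^2 \<le> 2 b^2, which is (a - 2 b)^2 \<ge> 0, and
  Cauchy-Schwarz bounds b^2.\<close>

lemma sum_square_minus_square_sum_le:
  fixes X :: "'a \<Rightarrow> real"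
  assumes "finite f"
  shows "(\<Sum>v\<in>f. (X v)\<^sup>2) - 2 * (\<Sum>v\<in>f. X v)\<^sup>2 \<le> (1 + 2 * real (card f)) * (\<Sum>v\<in>f. if X v < 0 then (X v)\<^sup>2 else 0)"
proof -
  define a where "a = (\<Sum>v\<in>f. max (X v) 0)"
  define b where "b = (\<Sum>v\<in>f. max (- X v) 0)"
  define N where "N = (\<Sum>v\<in>f. if X v < 0 then (X v)\<^sup>2 else 0)"
  have ab: "(\<Sum>v\<in>f. X v) = a - b"
    unfolding a_def b_def sum_subtractf[symmetric] by (intro sum.cong) auto
  have sq: "(\<Sum>v\<in>f. (X v)\<^sup>2) = (\<Sum>v\<in>f. (max (X v) 0)\<^sup>2) + N"
    unfolding N_def sum.distrib[symmetric] by (intro sum.cong) auto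
  have a2: "(\<Sum>v\<in>f. (max (X v) 0)\<^sup>2) \<le> a\<^sup>2"
  proof -
    have "(\<Sum>v\<in>f. (max (X v) 0)\<^sup>2) \<le> (\<Sum>v\<in>f. max (X v) 0 * a)"
      unfolding power2_eq_square a_def
      by (intro sum_mono mult_left_mono member_le_sum) (use assms in auto)
    thus ?thesis by (simp add: a_def power2_eq_square sum_distrib_right)
  qed
  have b2: "b\<^sup>2 \<le> real (card f) * N"
  proof -
    have "b\<^sup>2 = (\<Sum>v\<in>f. \<Sum>w\<in>f. max (- X v) 0 * max (- X w) 0)"
      by (simp add: b_def power2_eq_square sum_product)
    also have "\<dots> \<le> (\<Sum>v\<in>f. \<Sum>w\<in>f. ((max (- X v) 0)\<^sup>2 + (max (- X w) 0)\<^sup>2) / 2)"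
    proof (intro sum_mono)
      fix v w
      show "max (- X v) 0 * max (- X w) 0 \<le> ((max (- X v) 0)\<^sup>2 + (max (- X w) 0)\<^sup>2) / 2"
        using sum_squares_bound[of "max (- X v) 0" "max (- X w) 0"] by simp
    qed
    also have "\<dots> = real (card f) * (\<Sum>v\<in>f. (max (- X v) 0)\<^sup>2)"
      by (simp add: sum.distrib add_divide_distrib sum_distrib_left flip: sum_divide_distrib)
    also have "(\<Sum>v\<in>f. (max (- X v) 0)\<^sup>2) = N"
      unfolding N_def by (intro sum.cong) auto
    finally show ?thesis .
  qed
  have "0 \<le> (a - 2 * b)\<^sup>2" by simp
  hence "a\<^sup>2 - 2 * (a - b)\<^sup>2 \<le> 2 * b\<^sup>2" by (simp add: power2_eq_square algebra_simps)
  thus ?thesis unfolding ab sq N_def[symmetric] using a2 b2 by (simp add: algebra_simps)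
qed

section \<open>Matchings of properly coloured linear hypergraphs\<close>

text \<open>Properness makes each colour class a matching, so any set of available edges of one
  colour may be selected together. Linearity enters in the form that two vertices determine at most
  one edge (\<open>edge_eqI\<close>). The parameter \<open>n\<close> is the scale of the degrees in
  \<open>dens\<close>, and later the number of colours.\<close>

locale coloured_hypergraph =
  fixes V :: "'a set" and E :: "'a set set" and col :: "'a set \<Rightarrow> nat" and k n :: nat
  assumes finite_V: "finite V"
    and edge_subset: "e \<in> E \<Longrightarrow> e \<subseteq> V"
    and uniform: "e \<in> E \<Longrightarrow> card e = k"
    and k_ge_2: "2 \<le> k"
    and linear: "e \<in> E \<Longrightarrow> f \<in> E \<Longrightarrow> e \<noteq> f \<Longrightarrow> card (e \<inter> f) \<le> 1"
    and proper: "e \<in> E \<Longrightarrow> f \<in> E \<Longrightarrow> e \<noteq> f \<Longrightarrow> col e = col f \<Longrightarrow> e \<inter> f = {}"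
begin

lemma finite_E: "finite E"
  using finite_V edge_subset by (meson Pow_iff finite_Pow_iff finite_subset subsetI)

lemma finite_edge: "e \<in> E \<Longrightarrow> finite e"
  using finite_V edge_subset finite_subset by blast

lemma edge_eqI:
  assumes "e \<in> E" "f \<in> E" "x \<in> e" "x \<in> f" "y \<in> e" "y \<in> f" "x \<noteq> y"
  shows "e = f"
proof (rule ccontr)
  assume "e \<noteq> f"
  hence "card (e \<inter> f) \<le> Suc 0" "finite (e \<inter> f)" using linear finite_edge assms by auto
  thus False using card_le_Suc0_iff_eq[of "e \<inter> f"] assms by blast
qed

definition avail :: "'a set \<Rightarrow> nat \<Rightarrow> 'a set set" where
  "avail U c = {e\<in>E. e \<subseteq> U \<and> col e = c}"

definition incident :: "'a set \<Rightarrow> nat set \<Rightarrow> 'a \<Rightarrow> 'a set set" where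
  "incident U C v = {e\<in>E. v \<in> e \<and> e \<subseteq> U \<and> col e \<in> C}"

abbreviation deg :: "'a set \<Rightarrow> nat set \<Rightarrow> 'a \<Rightarrow> nat" where
  "deg U C v \<equiv> card (incident U C v)"

text \<open>At most 1 by properness, hence the indicator that \<open>v\<close> lies on an available
  edge of colour \<open>c\<close>; as a cardinality it sums to the degree over the colours.\<close>

definition cov :: "'a set \<Rightarrow> nat \<Rightarrow> 'a \<Rightarrow> nat" where
  "cov U c v = card {e\<in>avail U c. v \<in> e}"

lemma finite_avail: "finite (avail U c)"
  using finite_E by (simp add: avail_def)

lemma finite_incident: "finite (incident U C v)"
  using finite_E by (simp add: incident_def)

lemma avail_eqI: "e \<in> avail U c \<Longrightarrow> f \<in> avail U c \<Longrightarrow> x \<in> e \<Longrightarrow> x \<in> f \<Longrightarrow> e = f"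
  using proper[of e f] by (auto simp: avail_def)

lemma cov_le_1: "cov U c v \<le> 1"
proof -
  have "card {e\<in>avail U c. v \<in> e} \<le> Suc 0"
  proof (subst card_le_Suc0_iff_eq)
    show "\<forall>e\<in>{e\<in>avail U c. v \<in> e}. \<forall>f\<in>{e\<in>avail U c. v \<in> e}. e = f"
      using avail_eqI[of _ U c _ v] by blast
  qed (simp add: finite_avail)
  thus ?thesis by (simp add: cov_def)
qed

lemma sum_cov:
  assumes "finite C"
  shows "(\<Sum>c\<in>C. cov U c v) = deg U C v"
proof -
  have "(\<Sum>c\<in>C. cov U c v) = card (\<Union>c\<in>C. {e\<in>avail U c. v \<in> e})"
    unfolding cov_def
    by (rule card_UN_disjoint[symmetric]) (use assms finite_E in \<open>auto simp: avail_def\<close>)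
  also have "(\<Union>c\<in>C. {e\<in>avail U c. v \<in> e}) = incident U C v"
    by (auto simp: avail_def incident_def)
  finally show ?thesis .
qed

lemma deg_le_card:
  assumes "finite C"
  shows "deg U C v \<le> card C"
proof -
  have "deg U C v \<le> (\<Sum>c\<in>C. 1)" unfolding sum_cov[OF assms, symmetric]
    by (intro sum_mono cov_le_1)
  thus ?thesis by simp
qed

text \<open>An edge of colour \<open>c\<close> meeting \<open>f\<close> in two vertices would equal
  \<open>f\<close> by linearity, although \<open>f\<close> has another colour; so no edge is counted
  twice.\<close>

lemma card_touching_eq_sum_cov:
  assumes f: "f \<in> E" "col f \<noteq> c"
  shows "card {g\<in>avail U c. g \<inter> (f - {v}) \<noteq> {}} = (\<Sum>w\<in>f - {v}. cov U c w)"
proof -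
  have "{g\<in>avail U c. g \<inter> (f - {v}) \<noteq> {}} = (\<Union>w\<in>f - {v}. {g\<in>avail U c. w \<in> g})" by blast
  also have "card \<dots> = (\<Sum>w\<in>f - {v}. card {g\<in>avail U c. w \<in> g})"
  proof (rule card_UN_disjoint)
    show "\<forall>w\<in>f - {v}. \<forall>w'\<in>f - {v}. w \<noteq> w' \<longrightarrow> {g\<in>avail U c. w \<in> g} \<inter> {g\<in>avail U c. w' \<in> g} = {}"
    proof (intro ballI impI equals0I)
      fix w w' g assume h: "w \<in> f - {v}" "w' \<in> f - {v}" "w \<noteq> w'"
        "g \<in> {g\<in>avail U c. w \<in> g} \<inter> {g\<in>avail U c. w' \<in> g}"
      hence "g \<in> E" "col g = c" by (auto simp: avail_def)
      moreover have "g = f" using edge_eqI[of g f w w'] h f calculation by blast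
      ultimately show False using f by simp
    qed
  qed (use finite_avail finite_edge f in auto)
  finally show ?thesis by (simp add: cov_def)
qed

lemma sum_cov_edge_le:
  assumes "f \<in> E" "v \<in> f"
  shows "(\<Sum>w\<in>f - {v}. cov U c w) \<le> k"
proof -
  have "(\<Sum>w\<in>f - {v}. cov U c w) \<le> (\<Sum>w\<in>f - {v}. 1)" by (intro sum_mono cov_le_1)
  also have "\<dots> \<le> k" using assms uniform[of f] finite_edge by simp
  finally show ?thesis .
qed

text \<open>By linearity each vertex of \<open>g\<close> other than \<open>v\<close> lies on at most
  one edge through \<open>v\<close>. Hence one selected edge destroys at most \<open>k\<close> edges
  at \<open>v\<close>, and the loss of degree has a small second moment.\<close>

lemma card_hit_le:
  assumes g: "g \<in> E" and F: "F \<subseteq> incident U C v"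
  shows "card {f\<in>F. g \<inter> (f - {v}) \<noteq> {}} \<le> k"
proof -
  have finF: "finite F" using F finite_incident finite_subset by blast
  have "card {f\<in>F. g \<inter> (f - {v}) \<noteq> {}} = card (\<Union>w\<in>g. {f\<in>F. w \<in> f - {v}})"
    by (rule arg_cong[of _ _ card]) blast
  also have "\<dots> \<le> (\<Sum>w\<in>g. card {f\<in>F. w \<in> f - {v}})" using finite_edge[OF g] by (rule card_UN_le)
  also have "\<dots> \<le> (\<Sum>w\<in>g. 1)"
  proof (rule sum_mono)
    fix w
    have "f = f'" if "f \<in> F" "f' \<in> F" "w \<in> f - {v}" "w \<in> f' - {v}" for f f'
      using that F edge_eqI[of f f' v w] by (auto simp: incident_def)
    thus "card {f\<in>F. w \<in> f - {v}} \<le> 1" using finF card_le_Suc0_iff_eq[of "{f\<in>F. w \<in> f - {v}}"] by auto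
  qed
  also have "\<dots> = k" using uniform[OF g] by simp
  finally show ?thesis .
qed

text \<open>One step for one vertex and one colour. The degree loses \<open>cov\<close>, because
  colour \<open>c\<close> is used up, and the number of hits, that is of edges at \<open>v\<close>
  that meet a selected edge; the target falls from \<open>d\<close> to \<open>d'\<close>. In the
  expanded square the terms linear in these changes are kept, because they must cancel in the
  average over \<open>c\<close>; the quadratic ones go into the last summand. The negative multiple
  of X^2 accounts for \<open>v\<close> being covered, after which it no longer counts.\<close>

lemma expected_square_deviation_le:
  fixes d d' p :: real
  assumes v: "v \<in> U" and c: "c \<in> C" and C: "finite C" "card C \<le> n"
    and p: "0 < p" "p \<le> 1" "1 \<le> real n * p"
    and X: "\<bar>real (deg U C v) - d\<bar> \<le> real n"
    and b: "d' \<le> d" "d - d' \<le> real k"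
  defines "X \<equiv> real (deg U C v) - d"
  shows "expect_subset p (avail U c)
      (\<lambda>S. if v \<in> \<Union>S then 0 else (real (deg (U - \<Union>S) (C - {c}) v) - d')\<^sup>2)
    \<le> X\<^sup>2 - p * real (cov U c v) * X\<^sup>2
       + 2 * X * (d - d' - real (cov U c v) - p * (\<Sum>f\<in>{f\<in>incident U C v. col f \<noteq> c}. \<Sum>w\<in>f - {v}. real (cov U c w)))
       + 12 * real k ^ 4 * (real n * p)\<^sup>2"
proof -
  define A where "A = avail U c"
  define Gv where "Gv = {g\<in>A. v \<in> g}"
  define F where "F = {f\<in>incident U C v. col f \<noteq> c}"
  define G where "G = (\<lambda>f. {g\<in>A. g \<inter> (f - {v}) \<noteq> {}})"
  define hits where "hits = (\<lambda>S. real (card {f\<in>F. (f - {v}) \<inter> \<Union>S \<noteq> {}}))"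
  define I where "I = (\<lambda>S. if S \<inter> Gv = {} then 1 else 0 :: real)"
  define a where "a = real (cov U c v)"
  define L where "L = real n * p"
  define B where "B = (\<Union>f\<in>F. G f)"
  let ?E = "expect_subset p A"
  have finA: "finite A" by (simp add: A_def finite_avail)
  have finF: "finite F" by (simp add: F_def finite_incident)
  have Fsub: "F \<subseteq> incident U C v" by (auto simp: F_def)
  have FE: "f \<in> E" "v \<in> f" "col f \<noteq> c" if "f \<in> F" for f using that by (auto simp: F_def incident_def)
  have a01: "a = 0 \<or> a = 1" using cov_le_1[of U c v] by (auto simp: a_def le_Suc_eq)
  have cGv: "real (card Gv) = a" by (simp add: Gv_def A_def a_def cov_def)
  have L: "L \<ge> 1" using p by (simp add: L_def)
  have cF: "real (card F) \<le> real n"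
    using card_mono[OF finite_incident Fsub] deg_le_card[OF C(1), of U v] C(2) by simp
  have cG: "card (G f) = (\<Sum>w\<in>f - {v}. cov U c w)" "card (G f) \<le> k" if "f \<in> F" for f
    using card_touching_eq_sum_cov[of f c U v] sum_cov_edge_le[of f v U c] FE[OF that] by (auto simp: G_def A_def)
  have Fdeg: "real (card F) = real (deg U C v) - a"
  proof -
    have "incident U C v = F \<union> Gv" "F \<inter> Gv = {}"
      using c by (auto simp: F_def Gv_def A_def avail_def incident_def)
    moreover have "finite Gv" using finA by (simp add: Gv_def)
    ultimately show ?thesis using card_Un_disjoint[of F Gv] finF cGv by simp
  qed
  \<comment> \<open>Makes the event that \<open>v\<close> stays uncovered independent of
    \<open>f\<close> being hit.\<close>
  have Gdisj: "Gv \<inter> G f = {}" if f: "f \<in> F" for f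
  proof (rule equals0I)
    fix g assume g: "g \<in> Gv \<inter> G f"
    then obtain w where w: "w \<in> g" "w \<in> f - {v}" by (auto simp: G_def)
    have gE: "g \<in> E" "v \<in> g" "col g = c" using g by (auto simp: Gv_def A_def avail_def)
    hence "g = f" using edge_eqI[of g f v w] w FE[OF f] by blast
    thus False using gE FE[OF f] by simp
  qed
  have Iiff: "v \<in> \<Union>S \<longleftrightarrow> S \<inter> Gv \<noteq> {}" if "S \<subseteq> A" for S
    using that by (auto simp: Gv_def)
  have hitiff: "(f - {v}) \<inter> \<Union>S = {} \<longleftrightarrow> S \<inter> G f = {}" if "S \<subseteq> A" for S f
    using that by (fastforce simp: G_def)
  have degS: "real (deg (U - \<Union>S) (C - {c}) v) = real (deg U C v) - a - hits S"
    if S: "S \<subseteq> A" "S \<inter> Gv = {}" for S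
  proof -
    have vS: "v \<notin> \<Union>S" using Iiff[OF S(1)] S(2) by blast
    have "incident (U - \<Union>S) (C - {c}) v = F - {f\<in>F. (f - {v}) \<inter> \<Union>S \<noteq> {}}"
      using vS unfolding incident_def F_def by blast
    hence "real (deg (U - \<Union>S) (C - {c}) v) = real (card F) - hits S"
      unfolding hits_def using finF by (simp add: card_Diff_subset card_mono of_nat_diff)
    thus ?thesis using Fdeg by simp
  qed
  have hits0: "hits S \<ge> 0" for S by (simp add: hits_def)
  \<comment> \<open>The hits are dominated by \<open>k\<close> times the number of selected edges in
    \<open>B\<close>, a binomial variable of mean at most \<open>L * real k\<close>.\<close>
  have hitsB: "hits S \<le> real k * real (card (S \<inter> B))" if S: "S \<subseteq> A" for S
  proof -
    have finSB: "finite (S \<inter> B)" using S finA finite_subset by blast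
    have "{f\<in>F. (f - {v}) \<inter> \<Union>S \<noteq> {}} \<subseteq> (\<Union>g\<in>S \<inter> B. {f\<in>F. g \<inter> (f - {v}) \<noteq> {}})"
    proof
      fix f assume f: "f \<in> {f\<in>F. (f - {v}) \<inter> \<Union>S \<noteq> {}}"
      then obtain g where g: "g \<in> S" "g \<inter> (f - {v}) \<noteq> {}" by blast
      have "g \<in> B" using f g S by (auto simp: B_def G_def)
      thus "f \<in> (\<Union>g\<in>S \<inter> B. {f\<in>F. g \<inter> (f - {v}) \<noteq> {}})" using f g by blast
    qed
    hence "card {f\<in>F. (f - {v}) \<inter> \<Union>S \<noteq> {}} \<le> card (\<Union>g\<in>S \<inter> B. {f\<in>F. g \<inter> (f - {v}) \<noteq> {}})"
      using finSB finF by (intro card_mono) auto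
    also have "\<dots> \<le> (\<Sum>g\<in>S \<inter> B. card {f\<in>F. g \<inter> (f - {v}) \<noteq> {}})" using finSB by (rule card_UN_le)
    also have "\<dots> \<le> (\<Sum>g\<in>S \<inter> B. k)"
    proof (rule sum_mono)
      fix g assume "g \<in> S \<inter> B"
      hence "g \<in> E" using S by (auto simp: A_def avail_def)
      thus "card {f\<in>F. g \<inter> (f - {v}) \<noteq> {}} \<le> k" using Fsub by (rule card_hit_le)
    qed
    also have "\<dots> = card (S \<inter> B) * k" by simp
    finally have "real (card {f\<in>F. (f - {v}) \<inter> \<Union>S \<noteq> {}}) \<le> real (card (S \<inter> B) * k)" by (rule of_nat_mono)
    thus ?thesis by (simp add: hits_def mult.commute)
  qed
  have BA: "B \<subseteq> A" by (auto simp: B_def G_def)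
  have cB: "p * real (card B) \<le> L * real k"
  proof -
    have "card B \<le> (\<Sum>f\<in>F. card (G f))" unfolding B_def using finF by (rule card_UN_le)
    also have "\<dots> \<le> (\<Sum>f\<in>F. k)" by (intro sum_mono cG)
    also have "\<dots> = card F * k" by simp
    finally have "real (card B) \<le> real (card F) * real k" by (metis of_nat_le_iff of_nat_mult)
    also have "\<dots> \<le> real n * real k" using cF by (intro mult_right_mono) auto
    finally have "p * real (card B) \<le> p * (real n * real k)" using p by (intro mult_left_mono) auto
    thus ?thesis by (simp add: L_def mult_ac)
  qed
  have hits2: "?E (\<lambda>S. (hits S)\<^sup>2) \<le> 2 * real k ^ 4 * L\<^sup>2"
  proof -
    have "?E (\<lambda>S. (hits S)\<^sup>2) \<le> ?E (\<lambda>S. (real k)\<^sup>2 * (real (card (S \<inter> B)))\<^sup>2)"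
      using p hitsB hits0 by (intro expect_subset_mono) (auto simp flip: power_mult_distrib intro!: power_mono)
    also have "\<dots> = (real k)\<^sup>2 * ?E (\<lambda>S. (real (card (S \<inter> B)))\<^sup>2)" by (rule expect_subset_cmult)
    also have "\<dots> \<le> (real k)\<^sup>2 * (p * real (card B) + (p * real (card B))\<^sup>2)"
      using finA BA p by (intro mult_left_mono expect_subset_card_Int_square_le) auto
    also have "\<dots> \<le> (real k)\<^sup>2 * (L * real k + (L * real k)\<^sup>2)"
      using cB p by (intro mult_left_mono add_mono power_mono) auto
    also have "\<dots> \<le> (real k)\<^sup>2 * ((L * real k)\<^sup>2 + (L * real k)\<^sup>2)"
    proof -
      have "1 * 1 \<le> L * real k" using L k_ge_2 by (intro mult_mono) auto
      hence "L * real k * 1 \<le> (L * real k) * (L * real k)" by (intro mult_left_mono) auto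
      hence "L * real k \<le> (L * real k)\<^sup>2" by (simp only: power2_eq_square mult_1_right)
      thus ?thesis by (intro mult_left_mono add_right_mono) auto
    qed
    also have "\<dots> = 2 * real k ^ 4 * L\<^sup>2" by (simp add: power2_eq_square power4_eq_xxxx)
    finally show ?thesis .
  qed
  have EI: "?E I = 1 - p * a"
  proof -
    have "?E I = (1 - p) ^ card Gv" unfolding I_def
      using finA by (intro expect_subset_disjoint) (auto simp: Gv_def)
    thus ?thesis using cGv a01 by auto
  qed
  \<comment> \<open>\<open>H\<close> is the union-bound value of \<open>J\<close>, the mean number
    of hits with \<open>v\<close> uncovered; the two differ by second-order terms only.\<close>
  define H where "H = (\<Sum>f\<in>F. p * real (card (G f)))"
  define J where "J = ?E (\<lambda>S. I S * hits S)"
  have Jeq: "J = (1 - p * a) * (\<Sum>f\<in>F. 1 - (1 - p) ^ card (G f))"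
  proof -
    have "J = ?E (\<lambda>S. \<Sum>f\<in>F. (if S \<inter> Gv = {} then 1 else 0) - (if S \<inter> (Gv \<union> G f) = {} then 1 else 0))"
      unfolding J_def
    proof (rule expect_subset_cong)
      fix S assume S: "S \<subseteq> A"
      have "hits S = (\<Sum>f\<in>F. if S \<inter> G f = {} then 0 else 1)"
        unfolding hits_def hitiff[OF S] using finF
        by (subst real_card_filter) (auto intro!: sum.cong)
      hence "I S * hits S = (\<Sum>f\<in>F. I S * (if S \<inter> G f = {} then 0 else 1))" by (simp add: sum_distrib_left)
      also have "\<dots> = (\<Sum>f\<in>F. (if S \<inter> Gv = {} then 1 else 0) - (if S \<inter> (Gv \<union> G f) = {} then 1 else 0))"
        by (intro sum.cong refl) (auto simp: I_def Int_Un_distrib)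
      finally show "I S * hits S = \<dots>" .
    qed
    also have "\<dots> = (\<Sum>f\<in>F. (1 - p) ^ card Gv - (1 - p) ^ card (Gv \<union> G f))"
      unfolding expect_subset_sum expect_subset_diff
      using finA by (intro sum.cong refl arg_cong2[of _ _ _ _ "(-)"] expect_subset_disjoint)
        (auto simp: Gv_def G_def)
    also have "\<dots> = (\<Sum>f\<in>F. (1 - p) ^ card Gv * (1 - (1 - p) ^ card (G f)))"
    proof (rule sum.cong)
      fix f assume "f \<in> F"
      hence "card (Gv \<union> G f) = card Gv + card (G f)"
        using Gdisj finA by (intro card_Un_disjoint) (auto simp: Gv_def G_def)
      thus "(1 - p) ^ card Gv - (1 - p) ^ card (Gv \<union> G f) = (1 - p) ^ card Gv * (1 - (1 - p) ^ card (G f))"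
        by (simp add: power_add algebra_simps)
    qed simp
    also have "\<dots> = (1 - p) ^ card Gv * (\<Sum>f\<in>F. 1 - (1 - p) ^ card (G f))"
      by (rule sum_distrib_left[symmetric])
    also have "(1 - p) ^ card Gv = 1 - p * a" using cGv a01 by auto
    finally show ?thesis .
  qed
  have pa: "0 \<le> p * a" "p * a \<le> p" "p * a \<le> 1" using p a01 by auto
  have J_le: "J \<le> H"
  proof -
    have "(\<Sum>f\<in>F. 1 - (1 - p) ^ card (G f)) \<ge> 0"
      using p by (intro sum_nonneg) (auto intro: power_le_one)
    hence "J \<le> 1 * (\<Sum>f\<in>F. 1 - (1 - p) ^ card (G f))"
      unfolding Jeq using pa by (intro mult_right_mono) auto
    also have "\<dots> \<le> H" unfolding H_def mult_1 using p by (intro sum_mono power_one_minus_bounds) auto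
    finally show ?thesis .
  qed
  have H_le: "H \<le> J + 2 * real n * (p * real k)\<^sup>2"
  proof -
    have "H - J = (\<Sum>f\<in>F. p * real (card (G f)) - (1 - p * a) * (1 - (1 - p) ^ card (G f)))"
      unfolding H_def Jeq sum_distrib_left by (rule sum_subtractf[symmetric])
    also have "\<dots> \<le> (\<Sum>f\<in>F. 2 * (p * real k)\<^sup>2)"
    proof (rule sum_mono)
      fix f assume f: "f \<in> F"
      define q where "q = 1 - (1 - p) ^ card (G f)"
      define y where "y = p * real (card (G f))"
      have q: "y - y\<^sup>2 \<le> q" "q \<le> y" unfolding q_def y_def using p power_one_minus_bounds[of p "card (G f)"] by auto
      have y: "0 \<le> y" "y \<le> p * real k" unfolding y_def using p cG(2)[OF f] by auto
      have "q \<ge> 0" unfolding q_def using p by (auto intro: power_le_one)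
      hence "p * a * q \<le> p * real k * y"
      proof -
        have "a \<le> real k" "0 \<le> a" using a01 k_ge_2 by auto
        thus ?thesis using q(2) \<open>q \<ge> 0\<close> y p by (intro mult_mono) auto
      qed
      also have "\<dots> \<le> p * real k * (p * real k)" using y p by (intro mult_left_mono) auto
      finally have 1: "p * a * q \<le> (p * real k)\<^sup>2" by (simp add: power2_eq_square)
      have 2: "y\<^sup>2 \<le> (p * real k)\<^sup>2" using y by (intro power_mono) auto
      have "y - (1 - p * a) * q = (y - q) + p * a * q" by (simp add: algebra_simps)
      thus "y - (1 - p * a) * q \<le> 2 * (p * real k)\<^sup>2" using 1 2 q by linarith
    qed
    also have "\<dots> = real (card F) * (2 * (p * real k)\<^sup>2)" by simp
    also have "\<dots> \<le> real n * (2 * (p * real k)\<^sup>2)" using cF by (intro mult_right_mono) auto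
    finally show ?thesis by simp
  qed
  \<comment> \<open>Uses (u - h)^2 \<le> 2 u^2 + 2 h^2 for the two changes u = d - d' - a and h =
    \<open>hits S\<close>.\<close>
  have pw: "(if v \<in> \<Union>S then 0 else (real (deg (U - \<Union>S) (C - {c}) v) - d')\<^sup>2)
      \<le> (X\<^sup>2 + 2 * X * (d - d' - a)) * I S - 2 * X * (I S * hits S) + (2 * (d - d' - a)\<^sup>2 + 2 * (hits S)\<^sup>2)"
    if S: "S \<subseteq> A" for S
  proof (cases "S \<inter> Gv = {}")
    case True
    have "0 \<le> (d - d' - a + hits S)\<^sup>2" by simp
    moreover have "(real (deg (U - \<Union>S) (C - {c}) v) - d')\<^sup>2 = (X + (d - d' - a) - hits S)\<^sup>2"
      unfolding degS[OF S True] X_def by (simp add: algebra_simps)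
    ultimately show ?thesis using True Iiff[OF S]
      by (simp add: I_def power2_eq_square algebra_simps)
  next
    case False
    thus ?thesis using Iiff[OF S] by (simp add: I_def)
  qed
  have "?E (\<lambda>S. if v \<in> \<Union>S then 0 else (real (deg (U - \<Union>S) (C - {c}) v) - d')\<^sup>2)
     \<le> ?E (\<lambda>S. (X\<^sup>2 + 2 * X * (d - d' - a)) * I S - 2 * X * (I S * hits S) + (2 * (d - d' - a)\<^sup>2 + 2 * (hits S)\<^sup>2))"
    using p by (intro expect_subset_mono pw) auto
  also have "\<dots> = (X\<^sup>2 + 2 * X * (d - d' - a)) * (1 - p * a) - 2 * X * J + (2 * (d - d' - a)\<^sup>2 + 2 * ?E (\<lambda>S. (hits S)\<^sup>2))"
    using finA by (simp only: expect_subset_add expect_subset_diff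
        expect_subset_cmult EI J_def expect_subset_const)
  also have "\<dots> \<le> (X\<^sup>2 + 2 * X * (d - d' - a)) * (1 - p * a) - 2 * X * J + (2 * (real k)\<^sup>2 + 4 * real k ^ 4 * L\<^sup>2)"
  proof -
    have "\<bar>d - d' - a\<bar> \<le> real k" using b a01 k_ge_2 by auto
    hence "(d - d' - a)\<^sup>2 \<le> (real k)\<^sup>2" by (simp add: abs_le_square_iff[symmetric])
    thus ?thesis using hits2 by simp
  qed
  finally have m1: "?E (\<lambda>S. if v \<in> \<Union>S then 0 else (real (deg (U - \<Union>S) (C - {c}) v) - d')\<^sup>2)
     \<le> (X\<^sup>2 + 2 * X * (d - d' - a)) * (1 - p * a) - 2 * X * J + (2 * (real k)\<^sup>2 + 4 * real k ^ 4 * L\<^sup>2)" .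
  have m2: "(X\<^sup>2 + 2 * X * (d - d' - a)) * (1 - p * a) \<le> X\<^sup>2 - p * a * X\<^sup>2 + 2 * X * (d - d' - a) + 2 * (L * real k)"
  proof -
    have ba: "\<bar>d - d' - a\<bar> \<le> real k" using b a01 k_ge_2 by auto
    have "\<bar>X * (d - d' - a) * (p * a)\<bar> \<le> real n * real k * p"
      unfolding abs_mult using X ba pa unfolding X_def[symmetric] by (intro mult_mono) auto
    hence "- (X * (d - d' - a) * (p * a)) \<le> L * real k" by (simp add: L_def mult_ac abs_le_iff)
    thus ?thesis by (simp add: algebra_simps)
  qed
  have m3: "- 2 * X * J \<le> - 2 * X * H + 4 * (L * real k)\<^sup>2"
  proof -
    have "\<bar>H - J\<bar> \<le> 2 * real n * (p * real k)\<^sup>2" using J_le H_le by auto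
    hence "\<bar>X * (H - J)\<bar> \<le> real n * (2 * real n * (p * real k)\<^sup>2)"
      unfolding abs_mult using X unfolding X_def[symmetric] by (intro mult_mono) auto
    also have "\<dots> = 2 * (L * real k)\<^sup>2" by (simp add: L_def power2_eq_square)
    finally have "X * (H - J) \<le> 2 * (L * real k)\<^sup>2" by (simp add: abs_le_iff)
    thus ?thesis by (simp add: algebra_simps)
  qed
  have main: "?E (\<lambda>S. if v \<in> \<Union>S then 0 else (real (deg (U - \<Union>S) (C - {c}) v) - d')\<^sup>2)
     \<le> X\<^sup>2 - p * a * X\<^sup>2 + 2 * X * (d - d' - a) + 2 * (L * real k) + (- 2 * X * H + 4 * (L * real k)\<^sup>2)
        + (2 * (real k)\<^sup>2 + 4 * real k ^ 4 * L\<^sup>2)" using m1 m2 m3 by simp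
  \<comment> \<open>12 = 2 + 4 + 2 + 4: apart from its coefficient every summand is at most k^4 L^2,
    as \<open>k\<close> and \<open>L\<close> are at least 1.\<close>
  have noise: "2 * (L * real k) + 4 * (L * real k)\<^sup>2 + (2 * (real k)\<^sup>2 + 4 * real k ^ 4 * L\<^sup>2) \<le> 12 * real k ^ 4 * L\<^sup>2"
  proof -
    have k1: "1 \<le> real k" using k_ge_2 by simp
    have k24: "(real k)\<^sup>2 \<le> real k ^ 4" "real k \<le> real k ^ 4"
      using k1 power_increasing[of 2 4 "real k"] power_increasing[of 1 4 "real k"] by auto
    have L2: "1 \<le> L\<^sup>2" "L \<le> L\<^sup>2" using L power_increasing[of 1 2 L] by (auto simp: one_le_power)
    have "L * real k \<le> L\<^sup>2 * real k ^ 4" "L\<^sup>2 * (real k)\<^sup>2 \<le> L\<^sup>2 * real k ^ 4" "1 * (real k)\<^sup>2 \<le> L\<^sup>2 * real k ^ 4"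
      by (intro mult_mono; use k24 L2 k1 L in simp)+
    thus ?thesis by (simp add: power_mult_distrib mult.commute)
  qed
  have Hsum: "H = p * (\<Sum>f\<in>F. \<Sum>w\<in>f - {v}. real (cov U c w))"
    unfolding H_def sum_distrib_left using cG(1) by (intro sum.cong refl) (simp add: sum_distrib_left)
  show ?thesis
    using main noise unfolding A_def[symmetric] F_def[symmetric] a_def[symmetric] L_def[symmetric] Hsum
    by (simp add: algebra_simps)
qed


section \<open>Drift of the potential, averaged over the next colour\<close>

lemma sum_incident_swap:
  fixes g :: "'a \<Rightarrow> 'a set \<Rightarrow> real"
  assumes "finite U"
  shows "(\<Sum>v\<in>U. \<Sum>f\<in>incident U C v. g v f) = (\<Sum>f\<in>{f\<in>E. f \<subseteq> U \<and> col f \<in> C}. \<Sum>v\<in>f. g v f)"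
proof -
  let ?F = "{f\<in>E. f \<subseteq> U \<and> col f \<in> C}"
  have "(\<Sum>v\<in>U. \<Sum>f\<in>incident U C v. g v f) = (\<Sum>v\<in>U. \<Sum>f\<in>{f\<in>?F. v \<in> f}. g v f)"
    by (intro sum.cong refl) (auto simp: incident_def)
  also have "\<dots> = (\<Sum>f\<in>?F. \<Sum>v\<in>{v\<in>U. v \<in> f}. g v f)"
    using assms finite_E by (intro sum.swap_restrict) auto
  also have "\<dots> = (\<Sum>f\<in>?F. \<Sum>v\<in>f. g v f)"
    by (rule sum.cong[OF refl], rule sum.cong) auto
  finally show ?thesis .
qed

lemma sum_deg:
  assumes "finite U" "finite C"
  shows "(\<Sum>v\<in>U. real (deg U C v)) = real k * (\<Sum>c\<in>C. real (card (avail U c)))"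
proof -
  let ?F = "{f\<in>E. f \<subseteq> U \<and> col f \<in> C}"
  have "(\<Sum>v\<in>U. real (deg U C v)) = (\<Sum>v\<in>U. \<Sum>f\<in>incident U C v. 1)" by simp
  also have "\<dots> = (\<Sum>f\<in>?F. \<Sum>v\<in>f. 1)" by (rule sum_incident_swap[OF assms(1)])
  also have "\<dots> = (\<Sum>f\<in>?F. real k)" using uniform by (intro sum.cong) auto
  also have "\<dots> = real k * real (card ?F)" by simp
  also have "card ?F = card (\<Union>c\<in>C. avail U c)"
    by (rule arg_cong[of _ _ card]) (auto simp: avail_def)
  also have "\<dots> = (\<Sum>c\<in>C. card (avail U c))"
    by (rule card_UN_disjoint) (use assms finite_E in \<open>auto simp: avail_def\<close>)
  finally show ?thesis by simp
qed

text \<open>Summed over all colours, \<open>cov\<close> gives the degree; the excluded colour of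
  \<open>f\<close> accounts for the -1, since there \<open>f\<close> itself covers each of its
  vertices.\<close>

lemma sum_cov_other_colours:
  assumes C: "finite C"
  shows "(\<Sum>c\<in>C. \<Sum>f\<in>{f\<in>incident U C v. col f \<noteq> c}. \<Sum>w\<in>f - {v}. real (cov U c w))
     = (\<Sum>f\<in>incident U C v. \<Sum>w\<in>f - {v}. real (deg U C w) - 1)"
proof -
  have "(\<Sum>c\<in>C. \<Sum>f\<in>{f\<in>incident U C v. col f \<noteq> c}. \<Sum>w\<in>f - {v}. real (cov U c w))
      = (\<Sum>c\<in>C. \<Sum>f\<in>incident U C v. if col f \<noteq> c then \<Sum>w\<in>f - {v}. real (cov U c w) else 0)"
    using finite_incident by (intro sum.cong refl sum.inter_filter) auto
  also have "\<dots> = (\<Sum>f\<in>incident U C v. \<Sum>c\<in>C. if col f \<noteq> c then \<Sum>w\<in>f - {v}. real (cov U c w) else 0)"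
    by (rule sum.swap)
  also have "\<dots> = (\<Sum>f\<in>incident U C v. \<Sum>w\<in>f - {v}. real (deg U C w) - 1)"
  proof (rule sum.cong)
    fix f assume f: "f \<in> incident U C v"
    hence fC: "col f \<in> C" "f \<in> avail U (col f)" by (auto simp: incident_def avail_def)
    have cov1: "real (cov U (col f) w) = 1" if "w \<in> f" for w
    proof -
      have "f \<in> {e\<in>avail U (col f). w \<in> e}" using fC that by blast
      hence "cov U (col f) w \<noteq> 0" unfolding cov_def using finite_avail[of U "col f"] by auto
      thus ?thesis using cov_le_1[of U "col f" w] by simp
    qed
    have "(\<Sum>c\<in>C. if col f \<noteq> c then \<Sum>w\<in>f - {v}. real (cov U c w) else 0)
        = (\<Sum>c\<in>C. (\<Sum>w\<in>f - {v}. real (cov U c w)) - (if col f = c then \<Sum>w\<in>f - {v}. real (cov U c w) else 0))"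
      by (intro sum.cong) auto
    also have "\<dots> = (\<Sum>c\<in>C. \<Sum>w\<in>f - {v}. real (cov U c w)) - (\<Sum>w\<in>f - {v}. real (cov U (col f) w))"
      using C fC(1) by (simp add: sum_subtractf)
    also have "(\<Sum>c\<in>C. \<Sum>w\<in>f - {v}. real (cov U c w)) = (\<Sum>w\<in>f - {v}. \<Sum>c\<in>C. real (cov U c w))"
      by (rule sum.swap)
    also have "\<dots> = (\<Sum>w\<in>f - {v}. real (deg U C w))"
      using sum_cov[OF C, of U] by (intro sum.cong refl) (metis of_nat_sum)
    also have "(\<Sum>w\<in>f - {v}. real (cov U (col f) w)) = (\<Sum>w\<in>f - {v}. 1)"
      using cov1 by (intro sum.cong) auto
    finally show "(\<Sum>c\<in>C. if col f \<noteq> c then \<Sum>w\<in>f - {v}. real (cov U c w) else 0) = (\<Sum>w\<in>f - {v}. real (deg U C w) - 1)"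
      by (simp add: sum_subtractf)
  qed simp
  finally show ?thesis .
qed

text \<open>A vertex of large degree is covered quickly and lowers the degree of its neighbours; a vertex of
  small degree has few neighbours. Hence the interaction term is at most a multiple of the potential,
  without any bound on the maximum degree.\<close>

lemma interaction_le:
  fixes d :: real and C :: "nat set"
  assumes "finite U" and d: "d > 0"
  defines "X \<equiv> \<lambda>v. real (deg U C v) - d"
  shows "(\<Sum>v\<in>U. - real (deg U C v) * (X v)\<^sup>2 - 2 * X v * (\<Sum>f\<in>incident U C v. \<Sum>w\<in>f - {v}. X w))
     \<le> d * (1 + 2 * real k) * (\<Sum>v\<in>U. (X v)\<^sup>2)"
proof -
  let ?F = "{f\<in>E. f \<subseteq> U \<and> col f \<in> C}"
  define Y where "Y = (\<lambda>v. if X v < 0 then (X v)\<^sup>2 else 0)"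
  have "(\<Sum>v\<in>U. - real (deg U C v) * (X v)\<^sup>2 - 2 * X v * (\<Sum>f\<in>incident U C v. \<Sum>w\<in>f - {v}. X w))
     = (\<Sum>v\<in>U. \<Sum>f\<in>incident U C v. - (X v)\<^sup>2 - 2 * X v * (\<Sum>w\<in>f - {v}. X w))"
    by (simp add: sum_subtractf sum_distrib_left sum_negf)
  also have "\<dots> = (\<Sum>f\<in>?F. \<Sum>v\<in>f. - (X v)\<^sup>2 - 2 * X v * (\<Sum>w\<in>f - {v}. X w))"
    by (rule sum_incident_swap[OF assms(1)])
  also have "\<dots> \<le> (\<Sum>f\<in>?F. (1 + 2 * real k) * (\<Sum>v\<in>f. Y v))"
  proof (rule sum_mono)
    fix f assume f: "f \<in> ?F"
    have ff: "finite f" "card f = k" using f finite_edge uniform by auto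
    have "(\<Sum>v\<in>f. - (X v)\<^sup>2 - 2 * X v * (\<Sum>w\<in>f - {v}. X w)) = (\<Sum>v\<in>f. (X v)\<^sup>2 - 2 * X v * (\<Sum>w\<in>f. X w))"
      using ff by (intro sum.cong refl) (simp add: sum_diff1 power2_eq_square algebra_simps)
    also have "\<dots> = (\<Sum>v\<in>f. (X v)\<^sup>2) - 2 * (\<Sum>v\<in>f. X v)\<^sup>2"
      by (simp add: sum_subtractf power2_eq_square mult.assoc flip: sum_distrib_left sum_distrib_right)
    also have "\<dots> \<le> (1 + 2 * real k) * (\<Sum>v\<in>f. Y v)"
      using sum_square_minus_square_sum_le[OF ff(1), of X] unfolding Y_def ff(2) .
    finally show "(\<Sum>v\<in>f. - (X v)\<^sup>2 - 2 * X v * (\<Sum>w\<in>f - {v}. X w)) \<le> (1 + 2 * real k) * (\<Sum>v\<in>f. Y v)" .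
  qed
  also have "\<dots> = (1 + 2 * real k) * (\<Sum>v\<in>U. \<Sum>f\<in>incident U C v. Y v)"
    by (subst sum_incident_swap[OF assms(1)]) (simp add: sum_distrib_left)
  also have "\<dots> \<le> (1 + 2 * real k) * (\<Sum>v\<in>U. d * (X v)\<^sup>2)"
  proof (intro mult_left_mono sum_mono)
    fix v
    \<comment> \<open>\<open>Y v\<close> vanishes unless the degree is below \<open>d\<close>, so
      fewer than \<open>d\<close> edges count.\<close>
    show "(\<Sum>f\<in>incident U C v. Y v) \<le> d * (X v)\<^sup>2"
      using d by (auto simp: Y_def X_def intro!: mult_right_mono)
  qed auto
  finally show ?thesis by (simp add: sum_distrib_left mult_ac)
qed

definition potential :: "real \<Rightarrow> 'a set \<Rightarrow> nat set \<Rightarrow> real" where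
  "potential d U C = (\<Sum>v\<in>U. (real (deg U C v) - d)\<^sup>2)"

text \<open>Ideal degree when \<open>m\<close> of \<open>n\<close> colours are left, with q = m / n:
  of about n edges at a vertex a fraction q has a colour left, and each of the k - 1 other vertices
  is uncovered with probability q. At this degree, selection with probability 1 /
  \<open>dens m\<close> covers an uncovered vertex in the next step with probability 1 / m, which
  reproduces q.\<close>

definition dens :: "nat \<Rightarrow> real" where
  "dens m = real n * (real m / real n) ^ k"

text \<open>The sum over \<open>c\<close> is \<open>m\<close> times the average over the next
  colour, so the potential grows by (m + 1) / m per step, and the product of these factors
  telescopes. The factor is the sum of m - 2 k, from the self-correcting drift of a single degree,
  and at most 1 + 2 k from \<open>interaction_le\<close>: the dependence on \<open>k\<close> cancels
  exactly.\<close>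

lemma expected_potential_le:
  assumes U: "finite U" and C: "finite C" "card C = m" and m: "0 < m" "m \<le> n" and d1: "1 \<le> dens m"
  shows "(\<Sum>c\<in>C. expect_subset (1 / dens m) (avail U c) (\<lambda>S. potential (dens (m - 1)) (U - \<Union>S) (C - {c})))
     \<le> (real m + 1) * potential (dens m) U C + 16 * real m * real k ^ 4 * (real n / dens m)\<^sup>2 * real (card U)"
proof -
  define d where "d = dens m"
  define d' where "d' = dens (m - 1)"
  define p where "p = 1 / d"
  define L where "L = real n * p"
  define q where "q = real m / real n"
  define q' where "q' = real (m - 1) / real n"
  define X where "X = (\<lambda>v. real (deg U C v) - d)"
  define D where "D = (\<lambda>v. real (deg U C v))"
  define T where "T = (\<lambda>v. \<Sum>f\<in>incident U C v. \<Sum>w\<in>f - {v}. X w)"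
  have n: "real n > 0" using m by simp
  have d: "d \<ge> 1" using d1 by (simp add: d_def)
  have q: "0 < q" "q \<le> 1" "0 \<le> q'" "q' \<le> q" "q - q' = 1 / real n"
    using m by (auto simp: q_def q'_def divide_simps of_nat_diff)
  have dq: "d = real n * q ^ k" "d' = real n * q' ^ k" by (simp_all add: d_def d'_def dens_def q_def q'_def)
  have dn: "d \<le> real n" unfolding dq using q n by (simp add: power_le_one)
  have p: "0 < p" "p \<le> 1" "1 \<le> real n * p" "p * d = 1" using d dn by (auto simp: p_def divide_simps)
  have L: "L \<ge> 1" using p by (simp add: L_def)
  have nmL: "real n \<le> real m * L"
  proof -
    have "q ^ k \<le> q ^ 1" using q k_ge_2 by (intro power_decreasing) auto
    hence "real n * q ^ k \<le> real m" using n by (simp add: q_def field_simps)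
    hence "real n * (real n * q ^ k) \<le> real n * real m" using n by (intro mult_left_mono) auto
    thus ?thesis using d n by (simp add: L_def p_def divide_simps dq[symmetric] mult.commute)
  qed
  \<comment> \<open>Discrete derivative of \<open>dens\<close>: the target falls by about k d / m,
    which is the mean loss of an ideal degree in one step.\<close>
  have dd: "d' \<le> d" "d - d' \<le> real k" "\<bar>real m * (d - d') - real k * d\<bar> \<le> (real k)\<^sup>2"
  proof -
    have up: "q ^ k - q' ^ k \<le> real k / real n * q ^ (k - 1)" using power_diff_le_mult[of q' q k] q by simp
    have lo: "real k / real n * q' ^ (k - 1) \<le> q ^ k - q' ^ k" using power_diff_ge_mult[of q' q k] q by simp
    have up2: "q ^ (k - 1) - q' ^ (k - 1) \<le> real (k - 1) / real n * q ^ (k - 1 - 1)"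
      using power_diff_le_mult[of q' q "k - 1"] q by simp
    have b: "d - d' = real n * (q ^ k - q' ^ k)" unfolding dq by (simp add: algebra_simps)
    show "d' \<le> d" unfolding dq using q n by (intro mult_left_mono power_mono) auto
    have up': "d - d' \<le> real k * q ^ (k - 1)"
      unfolding b using mult_left_mono[OF up, of "real n"] n by simp
    also have "\<dots> \<le> real k" using q by (simp add: power_le_one mult_left_le)
    finally show "d - d' \<le> real k" .
    have mq: "real m = real n * q" using n by (simp add: q_def)
    have qk: "q * q ^ (k - 1) = q ^ k" using k_ge_2 by (cases k) auto
    have 1: "real m * (d - d') \<le> real k * d"
    proof -
      have "real m * (d - d') \<le> real m * (real k * q ^ (k - 1))" using up' by (intro mult_left_mono) auto
      also have "\<dots> = real k * d" unfolding mq dq qk[symmetric] by simp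
      finally show ?thesis .
    qed
    have 2: "real k * d - real m * (d - d') \<le> (real k)\<^sup>2"
    proof -
      have "real k * q' ^ (k - 1) \<le> d - d'"
        unfolding b using mult_left_mono[OF lo, of "real n"] n by simp
      hence "real m * (real k * q' ^ (k - 1)) \<le> real m * (d - d')" by (intro mult_left_mono) auto
      hence "real k * d - real m * (d - d') \<le> real m * real k * (q ^ (k - 1) - q' ^ (k - 1))"
        unfolding dq(1) qk[symmetric] using mq by (simp add: algebra_simps)
      also have "\<dots> \<le> real m * real k * (real (k - 1) / real n * q ^ (k - 1 - 1))"
        using up2 by (intro mult_left_mono) auto
      also have "\<dots> = real k * real (k - 1) * (q * q ^ (k - 1 - 1))"
        using n unfolding mq by simp
      also have "\<dots> \<le> real k * real k * 1"
        using q by (intro mult_mono mult_le_one) (auto intro: power_le_one)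
      finally show ?thesis by (simp add: power2_eq_square)
    qed
    show "\<bar>real m * (d - d') - real k * d\<bar> \<le> (real k)\<^sup>2" using 1 2 by simp
  qed
  have Dn: "0 \<le> D v" "D v \<le> real n" "\<bar>X v\<bar> \<le> real n" for v
    using deg_le_card[OF C(1), of U v] C(2) m(2) d dn by (auto simp: D_def X_def)
  have one: "(\<Sum>c\<in>C. expect_subset p (avail U c)
      (\<lambda>S. if v \<in> \<Union>S then 0 else (real (deg (U - \<Union>S) (C - {c}) v) - d')\<^sup>2))
     \<le> (real m - 2 * real k) * (X v)\<^sup>2 + p * (- D v * (X v)\<^sup>2 - 2 * X v * T v) + 16 * real m * real k ^ 4 * L\<^sup>2"
    if v: "v \<in> U" for v
  proof -
    define H where "H = (\<lambda>c. \<Sum>f\<in>{f\<in>incident U C v. col f \<noteq> c}. \<Sum>w\<in>f - {v}. real (cov U c w))"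
    have Hs: "(\<Sum>c\<in>C. H c) = D v * ((real k - 1) * (d - 1)) + T v"
    proof -
      have "(\<Sum>c\<in>C. H c) = (\<Sum>f\<in>incident U C v. \<Sum>w\<in>f - {v}. real (deg U C w) - 1)"
        unfolding H_def by (rule sum_cov_other_colours[OF C(1)])
      also have "\<dots> = (\<Sum>f\<in>incident U C v. (real k - 1) * (d - 1) + (\<Sum>w\<in>f - {v}. X w))"
      proof (rule sum.cong)
        fix f assume f: "f \<in> incident U C v"
        have "real (card (f - {v})) = real k - 1"
          using f uniform[of f] finite_edge[of f] k_ge_2 by (auto simp: incident_def of_nat_diff)
        moreover have "(\<Sum>w\<in>f - {v}. real (deg U C w) - 1) = (\<Sum>w\<in>f - {v}. (d - 1) + X w)"
          by (simp add: X_def)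
        ultimately show "(\<Sum>w\<in>f - {v}. real (deg U C w) - 1) = (real k - 1) * (d - 1) + (\<Sum>w\<in>f - {v}. X w)"
          by (simp add: sum.distrib)
      qed simp
      also have "\<dots> = D v * ((real k - 1) * (d - 1)) + T v"
        by (simp add: sum.distrib T_def D_def)
      finally show ?thesis .
    qed
    have cs: "(\<Sum>c\<in>C. real (cov U c v)) = D v" unfolding D_def using sum_cov[OF C(1), of U v] by (metis of_nat_sum)
    have "(\<Sum>c\<in>C. expect_subset p (avail U c)
        (\<lambda>S. if v \<in> \<Union>S then 0 else (real (deg (U - \<Union>S) (C - {c}) v) - d')\<^sup>2))
      \<le> (\<Sum>c\<in>C. (X v)\<^sup>2 - p * real (cov U c v) * (X v)\<^sup>2 + 2 * X v * (d - d' - real (cov U c v) - p * H c) + 12 * real k ^ 4 * L\<^sup>2)"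
      unfolding X_def H_def L_def
      by (intro sum_mono expected_square_deviation_le) (use v C m p Dn(3)[of v] dd in \<open>auto simp: X_def\<close>)
    also have "\<dots> = (\<Sum>c\<in>C. (X v)\<^sup>2 + 2 * X v * (d - d') + 12 * real k ^ 4 * L\<^sup>2
        - (p * (X v)\<^sup>2 + 2 * X v) * real (cov U c v) - 2 * X v * p * H c)"
      by (intro sum.cong refl) (simp add: algebra_simps)
    also have "\<dots> = real m * ((X v)\<^sup>2 + 2 * X v * (d - d') + 12 * real k ^ 4 * L\<^sup>2)
        - (p * (X v)\<^sup>2 + 2 * X v) * (\<Sum>c\<in>C. real (cov U c v)) - 2 * X v * p * (\<Sum>c\<in>C. H c)"
      using C(2) by (simp add: sum_subtractf sum_distrib_left)
    also have "\<dots> = real m * ((X v)\<^sup>2 + 2 * X v * (d - d') + 12 * real k ^ 4 * L\<^sup>2)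
        - (p * (X v)\<^sup>2 + 2 * X v) * D v - 2 * X v * p * (D v * ((real k - 1) * (d - 1)) + T v)"
      unfolding Hs cs ..
    also have "\<dots> = (real m - 2 * real k) * (X v)\<^sup>2 + p * (- D v * (X v)\<^sup>2 - 2 * X v * T v) + 12 * real m * real k ^ 4 * L\<^sup>2
        + 2 * (X v * (real m * (d - d') - real k * d)) + 2 * (X v * (p * D v * (real k - 1)))"
    proof -
      have "D v = d + X v" by (simp add: D_def X_def)
      have "p * (D v * ((real k - 1) * (d - 1))) = (real k - 1) * (p * d) * D v - p * D v * (real k - 1)"
        by (simp add: algebra_simps)
      hence e1: "p * (D v * ((real k - 1) * (d - 1))) = (real k - 1) * (d + X v) - p * D v * (real k - 1)"
        unfolding p(4) using \<open>D v = d + X v\<close> by simp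
      have "2 * X v * p * (D v * ((real k - 1) * (d - 1)) + T v) = 2 * X v * (p * (D v * ((real k - 1) * (d - 1)))) + 2 * X v * p * T v"
        by (simp add: algebra_simps)
      also have "\<dots> = 2 * X v * ((real k - 1) * (d + X v) - p * D v * (real k - 1)) + 2 * X v * p * T v" unfolding e1 ..
      finally have e2: "2 * X v * p * (D v * ((real k - 1) * (d - 1)) + T v) = 2 * X v * ((real k - 1) * (d + X v) - p * D v * (real k - 1)) + 2 * X v * p * T v" .
      have e3: "(p * (X v)\<^sup>2 + 2 * X v) * D v = p * (X v)\<^sup>2 * D v + 2 * X v * (d + X v)"
        using \<open>D v = d + X v\<close> by (simp add: algebra_simps)
      show ?thesis unfolding e2 e3 by (simp add: algebra_simps power2_eq_square)
    qed
    \<comment> \<open>The two remaining products are noise, as |X v| \<le> n \<le> m L; they raise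
      the constant from 12 to 16.\<close>
    also have "\<dots> \<le> (real m - 2 * real k) * (X v)\<^sup>2 + p * (- D v * (X v)\<^sup>2 - 2 * X v * T v) + 12 * real m * real k ^ 4 * L\<^sup>2
        + 2 * (real m * L\<^sup>2 * real k ^ 4) + 2 * (real m * L\<^sup>2 * real k ^ 4)"
    proof -
      have k1: "1 \<le> real k" using k_ge_2 by simp
      have "(real k)\<^sup>2 \<le> real k ^ 4" "real k ^ 1 \<le> real k ^ 4"
        using k1 by (intro power_increasing; simp)+
      hence k24: "(real k)\<^sup>2 \<le> real k ^ 4" "real k - 1 \<le> real k ^ 4"
        unfolding power_one_right by linarith+
      have L2: "L \<le> L\<^sup>2" using L power_increasing[of 1 2 L] by auto
      have nL: "real n \<le> real m * L\<^sup>2" using nmL L2 by (meson mult_left_mono of_nat_0_le_iff order_trans)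
      have "\<bar>X v * (real m * (d - d') - real k * d)\<bar> \<le> real m * L\<^sup>2 * real k ^ 4"
        unfolding abs_mult using Dn(3)[of v] nL dd(3) k24 by (intro mult_mono) auto
      moreover have "\<bar>X v * (p * D v * (real k - 1))\<bar> \<le> real m * L\<^sup>2 * real k ^ 4"
      proof -
        have "p * D v \<le> L" unfolding L_def using Dn(2)[of v] p by (simp add: mult.commute)
        hence pd: "\<bar>p * D v * (real k - 1)\<bar> \<le> L * real k ^ 4"
          unfolding abs_mult using k24 k1 p L Dn(1)[of v] by (intro mult_mono) auto
        have "\<bar>X v * (p * D v * (real k - 1))\<bar> \<le> (real m * L) * (L * real k ^ 4)"
          unfolding abs_mult[of "X v"] using pd Dn(3)[of v] nmL L by (intro mult_mono) auto
        thus ?thesis by (simp add: power2_eq_square mult_ac)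
      qed
      ultimately show ?thesis by linarith
    qed
    finally show ?thesis by (simp add: algebra_simps)
  qed
  have "(\<Sum>c\<in>C. expect_subset p (avail U c) (\<lambda>S. potential d' (U - \<Union>S) (C - {c})))
     = (\<Sum>c\<in>C. expect_subset p (avail U c)
      (\<lambda>S. \<Sum>v\<in>U. if v \<in> \<Union>S then 0 else (real (deg (U - \<Union>S) (C - {c}) v) - d')\<^sup>2))"
  proof (intro sum.cong refl expect_subset_cong)
    fix c S
    have "(\<Sum>v\<in>U. if v \<in> \<Union>S then 0 else (real (deg (U - \<Union>S) (C - {c}) v) - d')\<^sup>2)
        = (\<Sum>v\<in>U. if v \<notin> \<Union>S then (real (deg (U - \<Union>S) (C - {c}) v) - d')\<^sup>2 else 0)"
      by (rule sum.cong) auto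
    also have "\<dots> = (\<Sum>v\<in>{v\<in>U. v \<notin> \<Union>S}. (real (deg (U - \<Union>S) (C - {c}) v) - d')\<^sup>2)"
      using U by (rule sum.inter_filter[symmetric])
    also have "{v\<in>U. v \<notin> \<Union>S} = U - \<Union>S" by auto
    finally show "potential d' (U - \<Union>S) (C - {c}) = (\<Sum>v\<in>U. if v \<in> \<Union>S then 0 else (real (deg (U - \<Union>S) (C - {c}) v) - d')\<^sup>2)"
      unfolding potential_def by simp
  qed
  also have "\<dots> = (\<Sum>v\<in>U. \<Sum>c\<in>C. expect_subset p (avail U c)
      (\<lambda>S. if v \<in> \<Union>S then 0 else (real (deg (U - \<Union>S) (C - {c}) v) - d')\<^sup>2))"
    unfolding expect_subset_sum by (rule sum.swap)
  also have "\<dots> \<le> (\<Sum>v\<in>U. (real m - 2 * real k) * (X v)\<^sup>2 + p * (- D v * (X v)\<^sup>2 - 2 * X v * T v) + 16 * real m * real k ^ 4 * L\<^sup>2)"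
    by (intro sum_mono one)
  also have "\<dots> = (real m - 2 * real k) * (\<Sum>v\<in>U. (X v)\<^sup>2) + p * (\<Sum>v\<in>U. - D v * (X v)\<^sup>2 - 2 * X v * T v) + 16 * real m * real k ^ 4 * L\<^sup>2 * real (card U)"
    by (simp add: sum.distrib sum_distrib_left)
  also have "\<dots> \<le> (real m - 2 * real k) * (\<Sum>v\<in>U. (X v)\<^sup>2) + p * (d * (1 + 2 * real k) * (\<Sum>v\<in>U. (X v)\<^sup>2)) + 16 * real m * real k ^ 4 * L\<^sup>2 * real (card U)"
    using interaction_le[OF U, of d C] d p unfolding X_def D_def T_def
    by (intro add_mono mult_left_mono order_refl) auto
  also have "p * (d * (1 + 2 * real k) * (\<Sum>v\<in>U. (X v)\<^sup>2)) = (1 + 2 * real k) * (\<Sum>v\<in>U. (X v)\<^sup>2)"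
    using p(4) by (simp add: mult.assoc[symmetric])
  finally show ?thesis
    unfolding potential_def X_def L_def p_def d_def[symmetric] d'_def[symmetric] by (simp add: algebra_simps)
qed


section \<open>Counting matchings one colour at a time\<close>

definition matchings :: "'a set \<Rightarrow> nat set \<Rightarrow> 'a set set set" where
  "matchings U C = {M. M \<subseteq> {e\<in>E. e \<subseteq> U \<and> col e \<in> C} \<and> disjoint M}"

lemma finite_matchings: "finite (matchings U C)"
  by (rule finite_subset[of _ "Pow E"]) (auto simp: matchings_def finite_E)

lemma card_matchings_pos: "0 < card (matchings U C)"
proof -
  have "{} \<in> matchings U C" by (simp add: matchings_def)
  thus ?thesis using finite_matchings card_gt_0_iff by blast
qed

text \<open>The set \<open>S\<close> is recovered as the part of colour \<open>c\<close>, so no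
  matching arises twice. Edges of one colour never conflict, and restricting to
  \<open>U - \<Union>S\<close> excludes conflicts with the others.\<close>

lemma sum_card_matchings_le:
  assumes c: "c \<in> C"
  shows "(\<Sum>S\<in>Pow (avail U c). real (card (matchings (U - \<Union>S) (C - {c})))) \<le> real (card (matchings U C))"
proof -
  let ?X = "SIGMA S:Pow (avail U c). matchings (U - \<Union>S) (C - {c})"
  have split: "{e\<in>S \<union> M. col e = c} = S" "{e\<in>S \<union> M. col e \<noteq> c} = M"
    if "S \<subseteq> avail U c" "M \<in> matchings (U - \<Union>S) (C - {c})" for S M
    using that by (auto simp: avail_def matchings_def)
  have inj: "inj_on (\<lambda>(S, M). S \<union> M) ?X"
  proof (rule inj_onI)
    fix x y assume xy: "x \<in> ?X" "y \<in> ?X" "(\<lambda>(S, M). S \<union> M) x = (\<lambda>(S, M). S \<union> M) y"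
    obtain S M S' M' where e: "x = (S, M)" "y = (S', M')" by (cases x, cases y) auto
    have "S \<union> M = S' \<union> M'" using xy e by simp
    moreover have "S \<subseteq> avail U c" "M \<in> matchings (U - \<Union>S) (C - {c})"
       "S' \<subseteq> avail U c" "M' \<in> matchings (U - \<Union>S') (C - {c})" using xy e by auto
    ultimately show "x = y" using split[of S M] split[of S' M'] e by simp
  qed
  have img: "(\<lambda>(S, M). S \<union> M) ` ?X \<subseteq> matchings U C"
  proof
    fix Y assume "Y \<in> (\<lambda>(S, M). S \<union> M) ` ?X"
    then obtain S M where Y: "Y = S \<union> M" "S \<subseteq> avail U c" "M \<in> matchings (U - \<Union>S) (C - {c})" by auto
    have M: "M \<subseteq> {e\<in>E. e \<subseteq> U - \<Union>S \<and> col e \<in> C - {c}}" "disjoint M" using Y(3) by (auto simp: matchings_def)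
    have "S \<union> M \<subseteq> {e\<in>E. e \<subseteq> U \<and> col e \<in> C}" using Y(2) M(1) c by (auto simp: avail_def)
    moreover have "disjoint (S \<union> M)"
    proof (rule disjointI)
      fix a b assume ab: "a \<in> S \<union> M" "b \<in> S \<union> M" "a \<noteq> b"
      have SS: "a \<inter> b = {}" if "a \<in> S" "b \<in> S"
        using avail_eqI[of a U c b] that Y(2) ab(3) by blast
      have MM: "a \<inter> b = {}" if "a \<in> M" "b \<in> M"
        using M(2) that ab(3) by (rule disjointD)
      have SM: "x \<inter> y = {}" if "x \<in> S" "y \<in> M" for x y using that M(1) by blast
      show "a \<inter> b = {}" using SS MM SM[of a b] SM[of b a] ab by blast
    qed
    ultimately show "Y \<in> matchings U C" using Y(1) by (simp add: matchings_def)
  qed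
  have "card ?X \<le> card (matchings U C)" by (rule card_inj_on_le[OF inj img finite_matchings])
  moreover have "card ?X = (\<Sum>S\<in>Pow (avail U c). card (matchings (U - \<Union>S) (C - {c})))"
    by (rule card_SigmaI) (auto simp: finite_avail finite_matchings)
  ultimately have "(\<Sum>S\<in>Pow (avail U c). card (matchings (U - \<Union>S) (C - {c}))) \<le> card (matchings U C)" by simp
  thus ?thesis unfolding of_nat_sum[symmetric] by (rule of_nat_mono)
qed

lemma card_Diff_Union_avail:
  assumes U: "finite U" and S: "S \<subseteq> avail U c"
  shows "real (card (U - \<Union>S)) = real (card U) - real k * real (card S)"
proof -
  have "finite S" using S finite_avail finite_subset by blast
  have "card (\<Union>S) = (\<Sum>e\<in>S. card e)"
  proof (rule card_Union_disjoint)
    show "pairwise disjnt S" using avail_eqI[of _ U c] S by (fastforce simp: pairwise_def disjnt_def)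
    show "\<And>A. A \<in> S \<Longrightarrow> finite A" using S finite_edge by (auto simp: avail_def)
  qed
  also have "\<dots> = (\<Sum>e\<in>S. k)" using S uniform by (intro sum.cong) (auto simp: avail_def)
  finally have c: "card (\<Union>S) = card S * k" by simp
  have sub: "\<Union>S \<subseteq> U" using S by (auto simp: avail_def)
  have "card (U - \<Union>S) + card (\<Union>S) = card U"
    using U sub by (metis card_Diff_subset card_mono finite_subset le_add_diff_inverse2)
  thus ?thesis using c by (simp add: algebra_simps flip: of_nat_mult of_nat_add)
qed

text \<open>As the assumed bound is linear in the number of vertices and in the potential, its
  expectation needs only the mean number of selected edges, each of which removes \<open>k\<close>
  vertices worth \<open>a\<close> each. The entropy comes from \<open>ln_sum_Pow_ge\<close>.\<close>

lemma ln_card_matchings_step: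
  assumes U: "finite U" and c: "c \<in> C" and p: "0 < p" "p < 1"
    and IH: "\<And>S. S \<subseteq> avail U c \<Longrightarrow>
      a * real (card (U - \<Union>S)) - g * potential d' (U - \<Union>S) (C - {c}) - \<delta> \<le> ln (real (card (matchings (U - \<Union>S) (C - {c}))))"
  shows "real (card (avail U c)) * (binary_entropy p - real k * p * a) + a * real (card U)
     - g * expect_subset p (avail U c) (\<lambda>S. potential d' (U - \<Union>S) (C - {c})) - \<delta> \<le> ln (real (card (matchings U C)))"
proof -
  let ?A = "avail U c"
  let ?E = "expect_subset p ?A"
  note fin = finite_avail[of U c]
  have "?E (\<lambda>S. a * real (card (U - \<Union>S)) - g * potential d' (U - \<Union>S) (C - {c}) - \<delta>)
     \<le> ?E (\<lambda>S. ln (real (card (matchings (U - \<Union>S) (C - {c})))))"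
    using p IH by (intro expect_subset_mono) auto
  moreover have "?E (\<lambda>S. a * real (card (U - \<Union>S)) - g * potential d' (U - \<Union>S) (C - {c}) - \<delta>)
     = a * (real (card U) - real k * (p * real (card ?A))) - g * ?E (\<lambda>S. potential d' (U - \<Union>S) (C - {c})) - \<delta>"
  proof -
    have "?E (\<lambda>S. real (card (U - \<Union>S))) = ?E (\<lambda>S. real (card U) - real k * real (card (S \<inter> ?A)))"
      using card_Diff_Union_avail[OF U, of _ c] by (intro expect_subset_cong) (simp add: Int_absorb2)
    also have "\<dots> = real (card U) - real k * (p * real (card ?A))"
      using fin by (simp add: expect_subset_diff expect_subset_cmult expect_subset_card_Int)
    finally show ?thesis
      using fin by (simp add: expect_subset_diff expect_subset_cmult)
  qed
  moreover have "?E (\<lambda>S. ln (real (card (matchings (U - \<Union>S) (C - {c}))))) + real (card ?A) * binary_entropy p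
      \<le> ln (\<Sum>S\<in>Pow ?A. real (card (matchings (U - \<Union>S) (C - {c}))))"
    using fin p card_matchings_pos by (intro ln_sum_Pow_ge) auto
  moreover have "ln (\<Sum>S\<in>Pow ?A. real (card (matchings (U - \<Union>S) (C - {c})))) \<le> ln (real (card (matchings U C)))"
  proof (subst ln_le_cancel_iff)
    show "0 < (\<Sum>S\<in>Pow ?A. real (card (matchings (U - \<Union>S) (C - {c}))))"
      using fin card_matchings_pos by (intro sum_pos) auto
    show "0 < real (card (matchings U C))" using card_matchings_pos by simp
  qed (rule sum_card_matchings_le[OF c])
  ultimately show ?thesis by (simp add: algebra_simps)
qed

lemma dens_bounds:
  assumes m1: "0 < m1" and d1: "1 \<le> dens m1" and j: "m1 < j" "j \<le> n"
  shows "1 < dens j" "dens j \<le> real n" "real n / dens j \<le> (real n / real m1) ^ k"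
proof -
  have n: "0 < n" using j by simp
  have "(real m1 / real n) ^ k < (real j / real n) ^ k"
    using j n k_ge_2 by (intro power_strict_mono divide_strict_right_mono) auto
  hence lt: "dens m1 < dens j" unfolding dens_def using n by simp
  thus "1 < dens j" using d1 by simp
  show "dens j \<le> real n" unfolding dens_def using j by (simp add: power_le_one mult_left_le)
  have "real n / dens j \<le> real n / dens m1" using lt d1 by (intro divide_left_mono) auto
  also have "\<dots> = (real n / real m1) ^ k" unfolding dens_def using n by (simp add: power_divide field_simps)
  finally show "real n / dens j \<le> (real n / real m1) ^ k" .
qed

text \<open>The expected entropy gained by the random process from the state \<open>(U, C)\<close> on is bounded by backward
  induction on the number \<open>m\<close> of remaining colours, by a function that is linear in \<open>card U\<close> and in the
  potential. The parameter \<open>s\<close> linearises the Cauchy--Schwarz bound on the sum of the degree deviations.\<close>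

lemma ln_card_matchings_induct:
  fixes s :: real
  assumes n: "0 < n" and m1: "0 < m1" and d1: "1 \<le> dens m1" and s: "s > 0"
  defines "B \<equiv> ln (real n) + 1"
  defines "R \<equiv> real n / real m1"
  defines "\<kappa> \<equiv> R ^ k / real n * B"
  defines "\<alpha> \<equiv> \<lambda>m. (\<Sum>j=m1+1..m. binary_entropy (1 / dens j) * dens j / real k) / real m"
  defines "\<gamma> \<equiv> \<lambda>m. \<kappa> / (2 * s) * (real m - real m1) / (real m1 + 1)"
  defines "\<Delta> \<equiv> real (card V) * (\<kappa> / (2 * s) * R * (16 * real k ^ 4 * (R ^ k)\<^sup>2) + \<kappa> * s / (2 * real m1))"
  assumes "m1 \<le> m" "m \<le> n"
  shows "\<And>U C. U \<subseteq> V \<Longrightarrow> C \<subseteq> {..<n} \<Longrightarrow> card C = m \<Longrightarrow>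
    \<alpha> m * real (card U) - \<gamma> m * potential (dens m) U C - (real m - real m1) * \<Delta> \<le> ln (real (card (matchings U C)))"
  using \<open>m1 \<le> m\<close> \<open>m \<le> n\<close>
proof (induction m rule: dec_induct)
  \<comment> \<open>With \<open>m1\<close> colours left the process stops; all terms on the left
    vanish and the empty matching suffices. Stopping there keeps all selection probabilities below
    1.\<close>
  case base
  have "1 \<le> card (matchings U C)" using card_matchings_pos[of U C] by simp
  thus ?case by (simp add: \<alpha>_def \<gamma>_def)
next
  case (step m)
  define M where "M = Suc m"
  define d where "d = dens M"
  define p where "p = 1 / d"
  define h where "h = binary_entropy p"
  define X where "X = (\<lambda>v. real (deg U C v) - d)"
  define \<Psi> where "\<Psi> = potential d U C"
  have finU: "finite U" using step.prems finite_V finite_subset by blast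
  have finC: "finite C" using step.prems finite_subset by blast
  have Mn: "M \<le> n" using step.prems by (simp add: M_def)
  have mM: "real M = real m + 1" by (simp add: M_def)
  have B: "B \<ge> 1" using n by (simp add: B_def)
  have R: "R > 0" using n m1 by (simp add: R_def)
  have kap: "\<kappa> > 0" unfolding \<kappa>_def using R n B by simp
  have dens_gt: "1 < dens j" "dens j \<le> real n" "real n / dens j \<le> R ^ k" if "m1 < j" "j \<le> n" for j
    unfolding R_def by (rule dens_bounds[OF m1 d1 that])+
  have hb: "0 \<le> binary_entropy (1 / dens j) * dens j" "binary_entropy (1 / dens j) * dens j \<le> B" if "m1 < j" "j \<le> n" for j
  proof -
    note D = dens_gt[OF that]
    have r: "0 < 1 / dens j" "1 / dens j < 1" using D by auto
    have "1 / dens j * (ln (dens j) + 1 - 1 / dens j) \<ge> 0"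
    proof (intro mult_nonneg_nonneg)
      have "0 \<le> ln (dens j)" using D by simp
      thus "0 \<le> ln (dens j) + 1 - 1 / dens j" using r(2) by linarith
    qed (use r in simp)
    hence "0 \<le> binary_entropy (1 / dens j)" using binary_entropy_ge[OF r] by simp
    thus "0 \<le> binary_entropy (1 / dens j) * dens j" using D by simp
    have "binary_entropy (1 / dens j) * dens j \<le> (1 / dens j * (ln (dens j) + 1)) * dens j"
      using binary_entropy_le[OF r] D by (intro mult_right_mono) auto
    also have "\<dots> = ln (dens j) + 1" using D by simp
    also have "\<dots> \<le> B" unfolding B_def using D by simp
    finally show "binary_entropy (1 / dens j) * dens j \<le> B" .
  qed
  note DM = dens_gt[of M, folded d_def]
  have m1M: "m1 < M" using step.hyps by (simp add: M_def)
  have p: "0 < p" "p < 1" "p * d = 1" using DM m1M Mn by (auto simp: p_def)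
  have pk: "p * B \<le> \<kappa>"
  proof -
    have "real n * p \<le> R ^ k" using DM(3) m1M Mn by (simp add: p_def)
    hence "p \<le> R ^ k / real n" using n by (simp add: field_simps)
    thus ?thesis unfolding \<kappa>_def using B by (intro mult_right_mono) auto
  qed
  have \<alpha>m: "0 \<le> \<alpha> m" "\<alpha> m \<le> B"
  proof -
    have k1: "1 \<le> real k" using k_ge_2 by simp
    have t: "0 \<le> binary_entropy (1 / dens j) * dens j / real k" "binary_entropy (1 / dens j) * dens j / real k \<le> B"
      if "j \<in> {m1+1..m}" for j
    proof -
      have j: "m1 < j" "j \<le> n" using that Mn by (auto simp: M_def)
      show "0 \<le> binary_entropy (1 / dens j) * dens j / real k" using hb(1)[OF j] k1 by simp
      have "binary_entropy (1 / dens j) * dens j / real k \<le> B / real k"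
        using hb(2)[OF j] k1 by (intro divide_right_mono) auto
      also have "\<dots> \<le> B" using B k1 by (simp add: divide_le_eq mult_right_le_one_le mult_le_cancel_left1)
      finally show "binary_entropy (1 / dens j) * dens j / real k \<le> B" .
    qed
    show "0 \<le> \<alpha> m" unfolding \<alpha>_def by (intro divide_nonneg_nonneg sum_nonneg t(1)) auto
    have "(\<Sum>j=m1+1..m. binary_entropy (1 / dens j) * dens j / real k) \<le> (\<Sum>j=m1+1..m. B)"
      by (intro sum_mono t)
    also have "\<dots> \<le> real m * B" using B by (simp add: mult_right_mono)
    finally show "\<alpha> m \<le> B" unfolding \<alpha>_def using step.hyps m1 by (simp add: divide_le_eq mult.commute)
  qed
  \<comment> \<open>\<open>\<alpha>\<close> is the ideal future gain per uncovered vertex;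
    multiplied by the number of colours left it becomes a plain sum.\<close>
  have \<alpha>M: "real M * \<alpha> M = real m * \<alpha> m + h * d / real k"
  proof -
    have "real M * \<alpha> M = (\<Sum>j=m1+1..M. binary_entropy (1 / dens j) * dens j / real k)"
      using mM by (simp add: \<alpha>_def)
    also have "\<dots> = (\<Sum>j=m1+1..m. binary_entropy (1 / dens j) * dens j / real k) + h * d / real k"
      using step.hyps unfolding M_def h_def p_def d_def by simp
    also have "(\<Sum>j=m1+1..m. binary_entropy (1 / dens j) * dens j / real k) = real m * \<alpha> m"
      using step.hyps m1 by (simp add: \<alpha>_def)
    finally show ?thesis .
  qed
  have \<gamma>m: "0 \<le> \<gamma> m" "\<gamma> m \<le> \<kappa> / (2 * s) * R"
  proof -
    show "0 \<le> \<gamma> m" unfolding \<gamma>_def using kap s step.hyps by simp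
    have "(real m - real m1) / (real m1 + 1) \<le> real n / real m1"
      using Mn m1 by (intro frac_le) (auto simp: M_def)
    hence "\<kappa> / (2 * s) * ((real m - real m1) / (real m1 + 1)) \<le> \<kappa> / (2 * s) * R"
      unfolding R_def using kap s by (intro mult_left_mono) auto
    thus "\<gamma> m \<le> \<kappa> / (2 * s) * R" by (simp add: \<gamma>_def)
  qed
  \<comment> \<open>\<open>\<gamma>\<close> is the solution of this recursion: the factor of
    \<open>\<gamma> m\<close> comes from the growth of the potential, the inhomogeneous term from
    the degree deviations of the current step.\<close>
  have \<gamma>M: "real M * \<gamma> M = \<gamma> m * (real M + 1) + \<kappa> / (2 * s)"
  proof -
    define y where "y = \<kappa> / (2 * s)"
    have e: "\<gamma> j * (real m1 + 1) = y * (real j - real m1)" for j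
      by (simp add: \<gamma>_def y_def)
    have "(real M * \<gamma> M) * (real m1 + 1) = real M * (y * (real M - real m1))"
      using e[of M] by (simp add: mult.assoc)
    also have "\<dots> = (y * (real m - real m1)) * (real M + 1) + y * (real m1 + 1)"
      unfolding mM by (simp add: algebra_simps)
    also have "\<dots> = (\<gamma> m * (real M + 1) + y) * (real m1 + 1)"
      unfolding e[symmetric] by (simp add: algebra_simps)
    finally show ?thesis unfolding y_def by (simp add: add_eq_0_iff)
  qed
  have cU: "real (card U) \<le> real (card V)" using step.prems finite_V by (simp add: card_mono)
  have W: "(\<Sum>v\<in>U. real (deg U C v)) = d * real (card U) + (\<Sum>v\<in>U. X v)"
    by (simp add: X_def sum_subtractf)
  have sumX: "\<bar>\<Sum>v\<in>U. X v\<bar> \<le> \<Psi> / (2 * s) + s * real (card U) / 2"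
  proof -
    have "\<bar>X v\<bar> \<le> (X v)\<^sup>2 / (2 * s) + s / 2" for v
    proof -
      have "0 \<le> (\<bar>X v\<bar> - s)\<^sup>2" by simp
      hence "2 * s * \<bar>X v\<bar> \<le> (X v)\<^sup>2 + s * s" by (simp add: power2_eq_square algebra_simps)
      thus ?thesis using s by (simp add: field_simps)
    qed
    hence "(\<Sum>v\<in>U. \<bar>X v\<bar>) \<le> (\<Sum>v\<in>U. (X v)\<^sup>2 / (2 * s) + s / 2)" by (intro sum_mono)
    also have "\<dots> = \<Psi> / (2 * s) + s * real (card U) / 2"
      by (simp add: sum.distrib \<Psi>_def potential_def X_def sum_divide_distrib)
    finally show ?thesis using sum_abs[of X U] by linarith
  qed
  let ?\<Phi> = "\<lambda>c. expect_subset p (avail U c) (\<lambda>S. potential (dens m) (U - \<Union>S) (C - {c}))"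
  have IH: "real (card (avail U c)) * (h - real k * p * \<alpha> m) + \<alpha> m * real (card U)
     - \<gamma> m * ?\<Phi> c - (real m - real m1) * \<Delta>
     \<le> ln (real (card (matchings U C)))" if c: "c \<in> C" for c
    unfolding h_def
  proof (rule ln_card_matchings_step[OF finU c p(1,2)])
    fix S assume S: "S \<subseteq> avail U c"
    have "card (C - {c}) = m" using step.prems(3) c finC by (simp add: M_def)
    moreover have "U - \<Union>S \<subseteq> V" "C - {c} \<subseteq> {..<n}" "m \<le> n" using step.prems by auto
    ultimately show "\<alpha> m * real (card (U - \<Union>S)) - \<gamma> m * potential (dens m) (U - \<Union>S) (C - {c}) - (real m - real m1) * \<Delta>
       \<le> ln (real (card (matchings (U - \<Union>S) (C - {c}))))"
      by (intro step.IH)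
  qed
  have PS: "(\<Sum>c\<in>C. ?\<Phi> c)
     \<le> (real M + 1) * \<Psi> + 16 * real M * real k ^ 4 * (R ^ k)\<^sup>2 * real (card V)"
  proof -
    have "(\<Sum>c\<in>C. expect_subset (1 / dens M) (avail U c) (\<lambda>S. potential (dens (M - 1)) (U - \<Union>S) (C - {c})))
     \<le> (real M + 1) * potential (dens M) U C + 16 * real M * real k ^ 4 * (real n / dens M)\<^sup>2 * real (card U)"
      using step.prems(3) DM(1) m1M Mn
      by (intro expected_potential_le finU finC) (auto simp: M_def d_def)
    also have "\<dots> \<le> (real M + 1) * potential (dens M) U C + 16 * real M * real k ^ 4 * (R ^ k)\<^sup>2 * real (card V)"
      using DM(1,3) m1M Mn cU unfolding d_def by (intro add_left_mono mult_mono power_mono mult_left_mono) auto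
    finally show ?thesis by (simp add: \<Psi>_def d_def p_def M_def)
  qed
  have "real M * ln (real (card (matchings U C))) = (\<Sum>c\<in>C. ln (real (card (matchings U C))))"
    using step.prems(3) by (simp add: M_def)
  also have "\<dots> \<ge> (\<Sum>c\<in>C. real (card (avail U c)) * (h - real k * p * \<alpha> m) + \<alpha> m * real (card U)
     - \<gamma> m * ?\<Phi> c - (real m - real m1) * \<Delta>)"
    by (intro sum_mono IH)
  also have "(\<Sum>c\<in>C. real (card (avail U c)) * (h - real k * p * \<alpha> m) + \<alpha> m * real (card U)
     - \<gamma> m * ?\<Phi> c - (real m - real m1) * \<Delta>)
    = (\<Sum>c\<in>C. real (card (avail U c))) * (h - real k * p * \<alpha> m) + real M * (\<alpha> m * real (card U))
     - \<gamma> m * (\<Sum>c\<in>C. ?\<Phi> c) - real M * ((real m - real m1) * \<Delta>)"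
    using step.prems(3) by (simp add: sum_subtractf sum.distrib sum_distrib_left sum_distrib_right M_def)
  finally have low: "(\<Sum>c\<in>C. real (card (avail U c))) * (h - real k * p * \<alpha> m) + real M * (\<alpha> m * real (card U))
     - \<gamma> m * (\<Sum>c\<in>C. ?\<Phi> c) - real M * ((real m - real m1) * \<Delta>)
     \<le> real M * ln (real (card (matchings U C)))" .
  have t1: "(\<Sum>c\<in>C. real (card (avail U c))) * (h - real k * p * \<alpha> m) = (h / real k - p * \<alpha> m) * (d * real (card U)) + (h / real k - p * \<alpha> m) * (\<Sum>v\<in>U. X v)"
  proof -
    have "(\<Sum>c\<in>C. real (card (avail U c))) = (d * real (card U) + (\<Sum>v\<in>U. X v)) / real k"
      using sum_deg[OF finU finC] W k_ge_2 by (simp add: field_simps)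
    thus ?thesis using k_ge_2 by (simp add: field_simps)
  qed
  \<comment> \<open>The choice of the selection probability, \<open>p * d = 1\<close>, makes the
    main terms recombine without error.\<close>
  have t2: "(h / real k - p * \<alpha> m) * (d * real (card U)) + real M * (\<alpha> m * real (card U)) = real M * \<alpha> M * real (card U)"
  proof -
    have "(h / real k - p * \<alpha> m) * d = h * d / real k - (p * d) * \<alpha> m" by (simp add: algebra_simps)
    hence "(h / real k - p * \<alpha> m) * d = h * d / real k - \<alpha> m" unfolding p(3) by simp
    moreover have "real M * \<alpha> m = real m * \<alpha> m + \<alpha> m" unfolding mM by (simp add: algebra_simps)
    ultimately have "(h / real k - p * \<alpha> m) * d + real M * \<alpha> m = real M * \<alpha> M"
      using \<alpha>M by linarith
    hence "((h / real k - p * \<alpha> m) * d + real M * \<alpha> m) * real (card U) = real M * \<alpha> M * real (card U)" by simp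
    thus ?thesis by (simp add: algebra_simps)
  qed
  \<comment> \<open>\<open>\<kappa>\<close> bounds the coefficient of the degree deviations, that is
    both the gain and the cost of an extra edge, since the density is at least n / R^k.\<close>
  have t3: "- (\<kappa> * (\<Psi> / (2 * s) + s * real (card V) / 2)) \<le> (h / real k - p * \<alpha> m) * (\<Sum>v\<in>U. X v)"
  proof -
    have h: "0 \<le> h * d" "h * d \<le> B" using hb[OF m1M Mn] by (simp_all add: h_def p_def d_def)
    have d0: "d > 0" using DM(1) m1M Mn by simp
    have "p * (h * d) = (p * d) * h" by simp
    hence hp: "p * (h * d) = h" unfolding p(3) by simp
    have hB: "0 \<le> h" "h \<le> p * B"
      using mult_left_mono[OF h(1), of p] mult_left_mono[OF h(2), of p] p(1) unfolding hp by auto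
    have "h / real k \<le> h" using hB(1) k_ge_2 by (simp add: divide_le_eq mult_le_cancel_left1)
    hence 1: "0 \<le> h / real k" "h / real k \<le> \<kappa>" using hB pk by auto
    have "p * \<alpha> m \<le> p * B" using \<alpha>m p by (intro mult_left_mono) auto
    hence 2: "p * \<alpha> m \<le> \<kappa>" using pk by (rule order_trans)
    have 3: "0 \<le> p * \<alpha> m" using \<alpha>m p by simp
    have "\<bar>h / real k - p * \<alpha> m\<bar> \<le> \<kappa>" using 1 2 3 by linarith
    moreover have "\<bar>\<Sum>v\<in>U. X v\<bar> \<le> \<Psi> / (2 * s) + s * real (card V) / 2"
    proof -
      have "s * real (card U) \<le> s * real (card V)" using cU s by (intro mult_left_mono) auto
      thus ?thesis using sumX by linarith
    qed
    ultimately have "\<bar>(h / real k - p * \<alpha> m) * (\<Sum>v\<in>U. X v)\<bar> \<le> \<kappa> * (\<Psi> / (2 * s) + s * real (card V) / 2)"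
      unfolding abs_mult by (intro mult_mono) auto
    thus ?thesis by (simp add: abs_le_iff)
  qed
  have t4: "\<gamma> m * (\<Sum>c\<in>C. ?\<Phi> c)
     \<le> \<gamma> m * (real M + 1) * \<Psi> + real M * (real (card V) * (\<kappa> / (2 * s) * R * (16 * real k ^ 4 * (R ^ k)\<^sup>2)))"
  proof -
    have "\<gamma> m * (\<Sum>c\<in>C. ?\<Phi> c)
      \<le> \<gamma> m * ((real M + 1) * \<Psi> + 16 * real M * real k ^ 4 * (R ^ k)\<^sup>2 * real (card V))"
      using PS \<gamma>m(1) by (rule mult_left_mono)
    also have "\<dots> = \<gamma> m * (real M + 1) * \<Psi> + \<gamma> m * (16 * real M * real k ^ 4 * (R ^ k)\<^sup>2 * real (card V))"
      by (simp add: algebra_simps)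
    also have "\<gamma> m * (16 * real M * real k ^ 4 * (R ^ k)\<^sup>2 * real (card V)) \<le> \<kappa> / (2 * s) * R * (16 * real M * real k ^ 4 * (R ^ k)\<^sup>2 * real (card V))"
      using \<gamma>m(2) by (intro mult_right_mono) auto
    finally show ?thesis by (simp add: mult_ac)
  qed
  \<comment> \<open>This error occurs once but \<open>\<Delta>\<close> is available \<open>M\<close>
    times, so the factor M / m1 \<ge> 1 is inserted to match.\<close>
  have t5: "\<kappa> * (\<Psi> / (2 * s) + s * real (card V) / 2) \<le> \<kappa> / (2 * s) * \<Psi> + real M * (real (card V) * (\<kappa> * s / (2 * real m1)))"
  proof -
    have "1 \<le> real M / real m1" using m1M m1 by simp
    hence "\<kappa> * s / 2 * real (card V) * 1 \<le> \<kappa> * s / 2 * real (card V) * (real M / real m1)"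
      using kap s by (intro mult_left_mono) auto
    thus ?thesis by (simp add: algebra_simps)
  qed
  have t6: "real M * \<Delta> = real M * (real (card V) * (\<kappa> / (2 * s) * R * (16 * real k ^ 4 * (R ^ k)\<^sup>2))) + real M * (real (card V) * (\<kappa> * s / (2 * real m1)))"
    unfolding \<Delta>_def by (simp add: algebra_simps)
  have t7: "real M * \<gamma> M * \<Psi> = \<gamma> m * (real M + 1) * \<Psi> + \<kappa> / (2 * s) * \<Psi>"
    unfolding \<gamma>M by (simp add: algebra_simps)
  have "real M * (\<alpha> M * real (card U) - \<gamma> M * \<Psi> - (real M - real m1) * \<Delta>)
     = real M * \<alpha> M * real (card U) - real M * \<gamma> M * \<Psi> - real M * ((real m - real m1) * \<Delta>) - real M * \<Delta>"
    unfolding mM by (simp add: algebra_simps)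
  also have "\<dots> \<le> real M * ln (real (card (matchings U C)))"
    using low t1 t2 t3 t4 t5 t6 t7 by linarith
  finally have "\<alpha> M * real (card U) - \<gamma> M * \<Psi> - (real M - real m1) * \<Delta> \<le> ln (real (card (matchings U C)))"
    by (rule mult_left_le_imp_le) (simp add: M_def)
  thus ?case by (simp add: M_def \<Psi>_def d_def)
qed

text \<open>Of the errors, B / R is the entropy forgone by stopping at \<open>m1\<close> colours,
  R^k / n is the second-order term of the binary entropy, and the last one collects initial
  deviation, noise and degree deviations. The choice s = sqrt n balances the two halves of
  \<open>\<Delta>\<close>, which add up over n steps to order 1 / s and s / n.\<close>

theorem ln_card_matchings_ge:
  assumes n: "0 < n" and m1: "0 < m1" "m1 \<le> n" and d1: "1 \<le> dens m1"
    and mindeg: "\<And>v. v \<in> V \<Longrightarrow> n \<le> deg V {..<n} v + k"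
  defines "B \<equiv> ln (real n) + 1"
  defines "R \<equiv> real n / real m1"
  shows "real (card V) / real k * (B - real k - B / R - R ^ k / real n - 10 * real k ^ 5 * B * R ^ (3 * k + 1) / sqrt (real n))
    \<le> ln (real (card (matchings V {..<n})))"
proof -
  define s where "s = sqrt (real n)"
  define N where "N = real (card V)"
  define \<kappa> where "\<kappa> = R ^ k / real n * B"
  define \<alpha> where "\<alpha> = (\<Sum>j=m1+1..n. binary_entropy (1 / dens j) * dens j / real k) / real n"
  define \<gamma> where "\<gamma> = \<kappa> / (2 * s) * (real n - real m1) / (real m1 + 1)"
  define \<Delta> where "\<Delta> = N * (\<kappa> / (2 * s) * R * (16 * real k ^ 4 * (R ^ k)\<^sup>2) + \<kappa> * s / (2 * real m1))"
  define \<Psi> where "\<Psi> = potential (dens n) V {..<n}"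
  have s: "s > 0" "s * s = real n" using n by (auto simp: s_def)
  have k1: "real k \<ge> 1" using k_ge_2 by simp
  have R: "R \<ge> 1" using m1 by (simp add: R_def)
  have B: "B \<ge> 1" using n by (simp add: B_def)
  have N: "N \<ge> 0" by (simp add: N_def)
  have kap: "\<kappa> > 0" unfolding \<kappa>_def using R n B by simp
  have main: "\<alpha> * N - \<gamma> * \<Psi> - (real n - real m1) * \<Delta> \<le> ln (real (card (matchings V {..<n})))"
    unfolding \<alpha>_def \<gamma>_def \<Delta>_def \<Psi>_def N_def \<kappa>_def R_def B_def
    by (rule ln_card_matchings_induct[OF n m1(1) d1 s(1) m1(2) order_refl]) auto
  \<comment> \<open>Common unit of the errors: 1 from the initial potential and 8 + 1 from
    \<open>\<Delta>\<close> make up the factor 10.\<close>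
  define Q where "Q = N * B * R ^ (3 * k + 1) * real k ^ 4 / s"
  have Q0: "Q \<ge> 0" unfolding Q_def using N B R s by simp
  have Rk: "R ^ j \<le> R ^ (3 * k + 1)" if "j \<le> 3 * k + 1" for j using that R by (intro power_increasing) auto
  have k24: "(real k)\<^sup>2 \<le> real k ^ 4" "1 \<le> real k ^ 4" using k1 by (auto intro: power_increasing one_le_power)
  have e1: "\<gamma> * \<Psi> \<le> Q"
  proof -
    have "\<Psi> \<le> (\<Sum>v\<in>V. (real k)\<^sup>2)" unfolding \<Psi>_def potential_def
    proof (rule sum_mono)
      fix v assume v: "v \<in> V"
      have "dens n = real n" using n by (simp add: dens_def)
      moreover have "deg V {..<n} v \<le> n" using deg_le_card[of "{..<n}" V v] by simp
      ultimately have "\<bar>real (deg V {..<n} v) - dens n\<bar> \<le> \<bar>real k\<bar>" using mindeg[OF v] by simp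
      thus "(real (deg V {..<n} v) - dens n)\<^sup>2 \<le> (real k)\<^sup>2" by (rule abs_le_square_iff[THEN iffD1])
    qed
    hence \<Psi>: "\<Psi> \<le> N * (real k)\<^sup>2" by (simp add: N_def)
    have "(real n - real m1) / (real m1 + 1) \<le> real n / real m1" using m1 by (intro frac_le) auto
    hence "\<kappa> / (2 * s) * ((real n - real m1) / (real m1 + 1)) \<le> \<kappa> / (2 * s) * R"
      unfolding R_def using kap s by (intro mult_left_mono) auto
    hence "\<gamma> \<le> \<kappa> / (2 * s) * R" by (simp add: \<gamma>_def)
    moreover have "\<gamma> \<ge> 0" unfolding \<gamma>_def using kap s m1 by simp
    moreover have "\<Psi> \<ge> 0" unfolding \<Psi>_def potential_def by (intro sum_nonneg) auto
    ultimately have "\<gamma> * \<Psi> \<le> \<kappa> / (2 * s) * R * (N * (real k)\<^sup>2)"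
      using \<Psi> kap s R by (intro mult_mono) auto
    also have "\<dots> = N * B * R ^ (k + 1) * (real k)\<^sup>2 / s * (1 / (2 * real n))"
      using n s by (simp add: \<kappa>_def field_simps)
    also have "\<dots> \<le> N * B * R ^ (k + 1) * (real k)\<^sup>2 / s * 1"
      using n N B R s by (intro mult_left_mono) auto
    also have "\<dots> \<le> Q" unfolding Q_def mult_1_right using N B R s Rk[of "k + 1"] k24
      by (intro divide_right_mono mult_mono mult_left_mono) auto
    finally show ?thesis .
  qed
  have e2: "(real n - real m1) * \<Delta> \<le> 9 * Q"
  proof -
    have "\<Delta> \<ge> 0" unfolding \<Delta>_def using N kap s R m1 by (intro mult_nonneg_nonneg add_nonneg_nonneg) auto
    hence "(real n - real m1) * \<Delta> \<le> real n * \<Delta>" by (intro mult_right_mono) auto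
    also have "\<dots> = 8 * (N * B * (R ^ k * R * (R ^ k)\<^sup>2) * real k ^ 4 / s) + N * B * (R ^ k * R) * (s * s) / (2 * real n * s)"
    proof -
      have f1: "real n * (\<kappa> * s / (2 * real m1)) = B * (R ^ k * R) * (s * s) / (2 * real n * s)"
        using n m1 s by (simp add: \<kappa>_def R_def field_simps)
      have f2: "real n * (\<kappa> / (2 * s) * R * (16 * real k ^ 4 * (R ^ k)\<^sup>2)) = 8 * (B * (R ^ k * R * (R ^ k)\<^sup>2) * real k ^ 4 / s)"
        using n s by (simp add: \<kappa>_def field_simps)
      have f3: "real n * \<Delta> = N * (real n * (\<kappa> / (2 * s) * R * (16 * real k ^ 4 * (R ^ k)\<^sup>2))) + N * (real n * (\<kappa> * s / (2 * real m1)))"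
        by (simp add: \<Delta>_def algebra_simps)
      show ?thesis unfolding f3 f1 f2 by (simp add: mult.assoc mult.left_commute)
    qed
    also have "R ^ k * R * (R ^ k)\<^sup>2 = R ^ (3 * k + 1)"
    proof -
      have "R ^ (3 * k + 1) = R ^ (k + 1 + k * 2)" by (rule arg_cong) simp
      also have "\<dots> = R ^ k * R * (R ^ k)\<^sup>2" by (simp only: power_add power_mult power_one_right)
      finally show ?thesis by (rule sym)
    qed
    also have "8 * (N * B * R ^ (3 * k + 1) * real k ^ 4 / s) = 8 * Q" by (simp add: Q_def)
    also have "N * B * (R ^ k * R) * (s * s) / (2 * real n * s) \<le> Q"
    proof -
      have "N * B * (R ^ k * R) * (s * s) / (2 * real n * s) = N * B * R ^ (k + 1) * 1 / s * (1 / 2)"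
        unfolding s(2) using n by (simp add: mult_ac)
      also have "\<dots> \<le> N * B * R ^ (k + 1) * 1 / s * 1" using N B R s by (intro mult_left_mono) auto
      also have "\<dots> \<le> Q" unfolding Q_def mult_1_right[of "_ / s"] using N B R s Rk[of "k + 1"] k24
        by (intro divide_right_mono mult_mono mult_left_mono) auto
      finally show ?thesis .
    qed
    finally show ?thesis by simp
  qed
  have e3: "B - real k - B / R - R ^ k / real n \<le> real k * \<alpha>"
  proof -
    have dens: "1 < dens j" "real n / dens j \<le> R ^ k" if "m1 < j" "j \<le> n" for j
      unfolding R_def by (rule dens_bounds[OF m1(1) d1 that])+
    have "(\<Sum>j=m1+1..n. B + real k * ln (real j / real n) - R ^ k / real n) \<le> (\<Sum>j=m1+1..n. binary_entropy (1 / dens j) * dens j)"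
    proof (rule sum_mono)
      fix j assume "j \<in> {m1+1..n}"
      hence j: "m1 < j" "j \<le> n" by auto
      note D = dens[OF j]
      have "1 / dens j * (ln (dens j) + 1 - 1 / dens j) \<le> binary_entropy (1 / dens j)"
        using binary_entropy_ge[of "1 / dens j"] D by simp
      hence "(1 / dens j * (ln (dens j) + 1 - 1 / dens j)) * dens j \<le> binary_entropy (1 / dens j) * dens j"
        using D by (intro mult_right_mono) auto
      moreover have "(1 / dens j * (ln (dens j) + 1 - 1 / dens j)) * dens j = ln (dens j) + 1 - 1 / dens j" using D by simp
      moreover have "ln (dens j) = ln (real n) + real k * ln (real j / real n)"
        using n j by (simp add: dens_def ln_mult ln_realpow)
      moreover have "1 / dens j \<le> R ^ k / real n" using D n by (simp add: field_simps)
      ultimately show "B + real k * ln (real j / real n) - R ^ k / real n \<le> binary_entropy (1 / dens j) * dens j"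
        unfolding B_def by linarith
    qed
    also have "\<dots> = real n * (real k * \<alpha>)"
      using n k1 by (simp add: \<alpha>_def flip: sum_divide_distrib)
    finally have a: "(\<Sum>j=m1+1..n. B + real k * ln (real j / real n) - R ^ k / real n) \<le> real n * (real k * \<alpha>)" .
    \<comment> \<open>The omitted logarithms are nonpositive, so the truncated sum inherits the
      lower bound -n.\<close>
    have "(\<Sum>j=1..n. ln (real j / real n)) \<le> (\<Sum>j=m1+1..n. ln (real j / real n))"
    proof -
      have "(\<Sum>j=1..n. ln (real j / real n)) = (\<Sum>j\<in>{1..m1}. ln (real j / real n)) + (\<Sum>j=m1+1..n. ln (real j / real n))"
        using m1 by (subst sum.union_disjoint[symmetric]) (auto intro!: sum.cong)
      moreover have "(\<Sum>j\<in>{1..m1}. ln (real j / real n)) \<le> 0"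
        using m1 n by (intro sum_nonpos) auto
      ultimately show ?thesis by simp
    qed
    hence "- real n \<le> (\<Sum>j=m1+1..n. ln (real j / real n))" using sum_ln_ratio_ge[OF n] by linarith
    hence "real k * (- real n) \<le> real k * (\<Sum>j=m1+1..n. ln (real j / real n))" by (intro mult_left_mono) auto
    moreover have "(\<Sum>j=m1+1..n. B + real k * ln (real j / real n) - R ^ k / real n)
       = (real n - real m1) * (B - R ^ k / real n) + real k * (\<Sum>j=m1+1..n. ln (real j / real n))"
      using m1 by (simp add: sum_subtractf sum.distrib sum_distrib_left of_nat_diff algebra_simps)
    ultimately have b: "(real n - real m1) * (B - R ^ k / real n) - real n * real k \<le> real n * (real k * \<alpha>)" using a by (simp add: mult.commute)
    have "real n * (B - real k - B / R - R ^ k / real n) = (real n - real m1) * B - real n * (R ^ k / real n) - real n * real k"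
      using n m1 by (simp add: R_def field_simps)
    also have "\<dots> \<le> (real n - real m1) * (B - R ^ k / real n) - real n * real k"
    proof -
      have "(real n - real m1) * (R ^ k / real n) \<le> real n * (R ^ k / real n)"
        using R n by (intro mult_right_mono) auto
      thus ?thesis by (simp add: right_diff_distrib)
    qed
    also note b
    finally show ?thesis by (rule mult_left_le_imp_le) (use n in simp)
  qed
  have "N / real k * (B - real k - B / R - R ^ k / real n) \<le> N / real k * (real k * \<alpha>)"
    using e3 N k1 by (intro mult_left_mono) auto
  hence e4: "N / real k * (B - real k - B / R - R ^ k / real n) \<le> \<alpha> * N" using k1 by (simp add: mult.commute)
  have "N / real k * (10 * real k ^ 5 * B * R ^ (3 * k + 1) / s) = 10 * Q"
  proof -
    have "real k ^ 5 = real k * real k ^ 4" by (simp add: eval_nat_numeral)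
    thus ?thesis using k1 s unfolding Q_def by (simp add: field_simps)
  qed
  hence "N / real k * (B - real k - B / R - R ^ k / real n - 10 * real k ^ 5 * B * R ^ (3 * k + 1) / s)
     = N / real k * (B - real k - B / R - R ^ k / real n) - 10 * Q"
    by (simp only: right_diff_distrib)
  also have "\<dots> \<le> \<alpha> * N - \<gamma> * \<Psi> - (real n - real m1) * \<Delta>" using e1 e2 e4 by linarith
  also note main
  finally show ?thesis by (simp add: N_def s_def)
qed

end

section \<open>Sparse paving matroids\<close>

definition subsets_of_card :: "nat \<Rightarrow> 'a set \<Rightarrow> 'a set set" where
  "subsets_of_card r A = {X. X \<subseteq> A \<and> card X = r}"

definition shadow :: "nat \<Rightarrow> 'a set \<Rightarrow> 'a set set" where
  "shadow r Y = subsets_of_card (r - 1) Y"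

text \<open>Two different r-sets share r - 1 elements exactly when their shadows meet, so the
  matchings of this hypergraph are the stable sets of the Johnson graph J(n, r).\<close>

definition johnson_edges :: "nat \<Rightarrow> nat \<Rightarrow> nat set set set" where
  "johnson_edges n r = shadow r ` subsets_of_card r {1..n}"

lemma finite_subsets_of_card: "finite A \<Longrightarrow> finite (subsets_of_card r A)"
  by (rule finite_subset[of _ "Pow A"]) (auto simp: subsets_of_card_def)

lemma card_subsets_of_card: "finite A \<Longrightarrow> card (subsets_of_card r A) = card A choose r"
  unfolding subsets_of_card_def by (rule n_subsets)

text \<open>Makes \<open>shadow r\<close> invertible on r-sets. For r = 1 the shadow consists of the
  empty set alone and forgets \<open>Y\<close>.\<close>

lemma Union_shadow:
  assumes "card Y = r" "r \<ge> 2"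
  shows "\<Union>(shadow r Y) = Y"
proof (rule set_eqI, rule iffI)
  fix x assume x: "x \<in> Y"
  have fin: "finite Y" using assms by (intro card_ge_0_finite) simp
  have "card (Y - {x}) \<ge> 1" using x fin assms by simp
  then obtain y where y: "y \<in> Y" "y \<noteq> x" by (metis Diff_iff card.empty ex_in_conv insertI1 not_one_le_zero)
  have "Y - {y} \<in> shadow r Y" using y fin assms by (auto simp: shadow_def subsets_of_card_def)
  moreover have "x \<in> Y - {y}" using x y by simp
  ultimately show "x \<in> \<Union>(shadow r Y)" by blast
qed (auto simp: shadow_def subsets_of_card_def)

lemma card_shadow:
  assumes "card Y = r" "r \<ge> 1"
  shows "card (shadow r Y) = r"
proof -
  have "finite Y" using assms by (intro card_ge_0_finite) simp
  hence "card (shadow r Y) = r choose (r - 1)" using assms by (simp add: shadow_def card_subsets_of_card)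
  also have "\<dots> = r" using assms binomial_symmetric[of "r - 1" r] by simp
  finally show ?thesis .
qed

lemma shadow_insertE:
  assumes "X \<in> shadow r Y" "card Y = r" "r \<ge> 1"
  obtains y where "y \<notin> X" "Y = insert y X"
proof -
  have fin: "finite Y" using assms by (intro card_ge_0_finite) simp
  have X: "X \<subseteq> Y" "card X = r - 1" using assms by (auto simp: shadow_def subsets_of_card_def)
  have "card (Y - X) = 1" using X fin assms by (simp add: card_Diff_subset finite_subset)
  then obtain y where "Y - X = {y}" by (auto simp: card_1_singleton_iff)
  thus ?thesis using that[of y] X by blast
qed

lemma johnson_edgesE:
  assumes "e \<in> johnson_edges n r" "r \<ge> 2"
  obtains Y where "Y \<subseteq> {1..n}" "card Y = r" "e = shadow r Y" "\<Union>e = Y"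
  using assms Union_shadow by (auto simp: johnson_edges_def subsets_of_card_def)

text \<open>Different r-sets meet in at most r - 1 elements, so the only possible common member of
  their shadows is the intersection itself.\<close>

lemma johnson_linear:
  assumes r: "r \<ge> 2" and e: "e \<in> johnson_edges n r" "f \<in> johnson_edges n r" "e \<noteq> f"
  shows "card (e \<inter> f) \<le> 1"
proof -
  obtain Y where Y: "card Y = r" "e = shadow r Y" using e(1) r by (rule johnson_edgesE)
  obtain Z where Z: "card Z = r" "f = shadow r Z" using e(2) r by (rule johnson_edgesE)
  have fin: "finite Y" "finite Z" using Y Z r by (auto intro!: card_ge_0_finite)
  have "Y \<noteq> Z" using e Y Z by auto
  hence "\<not> Y \<subseteq> Z" using Y Z fin card_subset_eq by metis
  hence "Y \<inter> Z \<subset> Y" by blast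
  hence "card (Y \<inter> Z) < r" using fin(1) Y(1) psubset_card_mono by metis
  hence lt: "card (Y \<inter> Z) \<le> r - 1" by simp
  have "X = Y \<inter> Z" if X: "X \<in> e \<inter> f" for X
  proof -
    have "X \<subseteq> Y \<inter> Z" "card X = r - 1" using X Y Z by (auto simp: shadow_def subsets_of_card_def)
    thus ?thesis using lt fin by (intro card_seteq) auto
  qed
  hence "e \<inter> f \<subseteq> {Y \<inter> Z}" by blast
  thus ?thesis using card_mono[of "{Y \<inter> Z}" "e \<inter> f"] by simp
qed

lemma johnson_degree:
  assumes r: "r \<ge> 2" and X: "X \<in> subsets_of_card (r - 1) {1..n}" and n: "r \<le> n"
  shows "card {f \<in> johnson_edges n r. X \<in> f} = n - (r - 1)"
proof -
  have X': "X \<subseteq> {1..n}" "card X = r - 1" "finite X"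
    using X by (auto simp: subsets_of_card_def intro: finite_subset)
  have "bij_betw (\<lambda>y. shadow r (insert y X)) ({1..n} - X) {f \<in> johnson_edges n r. X \<in> f}"
  proof (rule bij_betw_imageI)
    have c: "card (insert y X) = r" if "y \<in> {1..n} - X" for y using that X' r by auto
    show "inj_on (\<lambda>y. shadow r (insert y X)) ({1..n} - X)"
    proof (rule inj_onI)
      fix y z assume yz: "y \<in> {1..n} - X" "z \<in> {1..n} - X" "shadow r (insert y X) = shadow r (insert z X)"
      hence "insert y X = insert z X" using Union_shadow[OF c r] by metis
      thus "y = z" using yz by blast
    qed
    show "(\<lambda>y. shadow r (insert y X)) ` ({1..n} - X) = {f \<in> johnson_edges n r. X \<in> f}"
    proof (rule set_eqI, rule iffI)
      fix f assume "f \<in> (\<lambda>y. shadow r (insert y X)) ` ({1..n} - X)"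
      then obtain y where y: "y \<in> {1..n} - X" "f = shadow r (insert y X)" by blast
      have "insert y X \<in> subsets_of_card r {1..n}" using y X' c[OF y(1)] by (simp add: subsets_of_card_def)
      moreover have "X \<in> shadow r (insert y X)" using X' by (auto simp: shadow_def subsets_of_card_def)
      ultimately show "f \<in> {f \<in> johnson_edges n r. X \<in> f}" using y by (auto simp: johnson_edges_def)
    next
      fix f assume "f \<in> {f \<in> johnson_edges n r. X \<in> f}"
      hence f: "f \<in> johnson_edges n r" "X \<in> f" by auto
      obtain Y where Y: "Y \<subseteq> {1..n}" "card Y = r" "f = shadow r Y" using f(1) r by (rule johnson_edgesE)
      obtain y where "y \<notin> X" "Y = insert y X"
        using f(2) Y r by (metis shadow_insertE order_trans one_le_numeral)
      thus "f \<in> (\<lambda>y. shadow r (insert y X)) ` ({1..n} - X)" using Y by blast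
    qed
  qed
  hence "card {f \<in> johnson_edges n r. X \<in> f} = card ({1..n} - X)" by (metis bij_betw_same_card)
  also have "\<dots> = n - (r - 1)" using X' by (simp add: card_Diff_subset)
  finally show ?thesis .
qed

definition sum_colour :: "nat \<Rightarrow> nat set set \<Rightarrow> nat" where
  "sum_colour n e = \<Sum>(\<Union>e) mod n"

lemma johnson_coloured_hypergraph:
  assumes r: "r \<ge> 2"
  shows "coloured_hypergraph (subsets_of_card (r - 1) {1..n}) (johnson_edges n r) (sum_colour n) r"
proof
  show "finite (subsets_of_card (r - 1) {1..n})" by (simp add: finite_subsets_of_card)
  show "e \<subseteq> subsets_of_card (r - 1) {1..n}" if "e \<in> johnson_edges n r" for e
    using that r by (rule johnson_edgesE) (auto simp: shadow_def subsets_of_card_def)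
  show "card e = r" if "e \<in> johnson_edges n r" for e
    using that r by (rule johnson_edgesE) (use r in \<open>simp add: card_shadow\<close>)
  show "card (e \<inter> f) \<le> 1" if "e \<in> johnson_edges n r" "f \<in> johnson_edges n r" "e \<noteq> f" for e f
    using johnson_linear[OF r that] .
  show "e \<inter> f = {}" if e: "e \<in> johnson_edges n r" "f \<in> johnson_edges n r" "e \<noteq> f" "sum_colour n e = sum_colour n f" for e f
  proof (rule equals0I)
    fix X assume X: "X \<in> e \<inter> f"
    obtain Y where Y: "Y \<subseteq> {1..n}" "card Y = r" "e = shadow r Y" "\<Union>e = Y" using e(1) r by (rule johnson_edgesE)
    obtain Z where Z: "Z \<subseteq> {1..n}" "card Z = r" "f = shadow r Z" "\<Union>f = Z" using e(2) r by (rule johnson_edgesE)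
    obtain y where y: "y \<notin> X" "Y = insert y X" using X Y r by (metis IntD1 shadow_insertE order_trans one_le_numeral)
    obtain z where z: "z \<notin> X" "Z = insert z X" using X Z r by (metis IntD2 shadow_insertE order_trans one_le_numeral)
    have fin: "finite X" using y Y(1) by (metis finite_atLeastAtMost finite_insert finite_subset)
    \<comment> \<open>The two r-sets extend X by single elements y and z, which agree modulo n and
      lie in {1..n}, hence coincide.\<close>
    have "(y + \<Sum>X) mod n = (z + \<Sum>X) mod n"
      using e(4) fin y z unfolding sum_colour_def Y(4) Z(4) by simp
    hence "int (y + \<Sum>X) mod int n = int (z + \<Sum>X) mod int n" by (metis of_nat_mod)
    hence "int n dvd int (y + \<Sum>X) - int (z + \<Sum>X)" by (simp only: mod_eq_dvd_iff)
    hence dvd: "int n dvd int y - int z" by simp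
    have "y \<in> {1..n}" "z \<in> {1..n}" using y z Y Z by auto
    hence "\<bar>int y - int z\<bar> < int n" by auto
    hence "int y - int z = 0" using dvd zdvd_not_zless[of "\<bar>int y - int z\<bar>" "int n"] by auto
    hence "y = z" by simp
    thus False using e(3) y z Y Z by simp
  qed
qed (use r in auto)

section \<open>From matchings to sparse paving matroids\<close>

definition sparse_paving :: "nat \<Rightarrow> nat \<Rightarrow> nat set set set \<Rightarrow> nat set set" where
  "sparse_paving n r M = {X. X \<subseteq> {1..n} \<and> card X \<le> r \<and> \<not> (card X = r \<and> shadow r X \<in> M)}"

text \<open>Exchange is critical only from size r - 1 to size r. If two elements of
  \<open>Y - X\<close> are available, the two extensions have X in both shadows, so a matching
  forbids at most one of them; if only one is available, the extension is Y itself. In the same way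
  some r-set is independent, since r < n leaves two ways to extend {1..r - 1}.\<close>

lemma sparse_paving_matroid:
  assumes r: "r \<ge> 2" and n: "r < n" and M: "M \<subseteq> johnson_edges n r" "disjoint M"
  shows "sparse_paving n r M \<in> paving_matroids n r"
proof -
  let ?I = "sparse_paving n r M"
  have two: "insert y X \<in> ?I \<or> insert z X \<in> ?I"
    if X: "X \<subseteq> {1..n}" "card X = r - 1" and yz: "y \<in> {1..n} - X" "z \<in> {1..n} - X" "y \<noteq> z" for X y z
  proof -
    have fin: "finite X" using X finite_subset by blast
    have c: "card (insert y X) = r" "card (insert z X) = r" using yz fin X r by auto
    have "X \<in> shadow r (insert y X) \<inter> shadow r (insert z X)" using X by (auto simp: shadow_def subsets_of_card_def)
    moreover have "shadow r (insert y X) \<noteq> shadow r (insert z X)"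
      using Union_shadow[OF c(1) r] Union_shadow[OF c(2) r] yz by (metis Diff_iff insertI1 insertE)
    ultimately have "\<not> (shadow r (insert y X) \<in> M \<and> shadow r (insert z X) \<in> M)"
      using M(2) by (metis disjointD empty_iff)
    thus ?thesis using c X yz by (auto simp: sparse_paving_def)
  qed
  have small: "X \<in> ?I" if "X \<subseteq> {1..n}" "card X < r" for X using that by (auto simp: sparse_paving_def)
  have mat: "matroid {1..n} ?I"
    unfolding matroid_def
  proof (intro conjI ballI allI impI)
    show "?I \<subseteq> Pow {1..n}" by (auto simp: sparse_paving_def)
    show "{} \<in> ?I" using r by (intro small) auto
    fix X Y assume X: "X \<in> ?I" and Y: "Y \<subseteq> X"
    have fin: "finite X" "X \<subseteq> {1..n}" "card X \<le> r" using X finite_subset by (auto simp: sparse_paving_def)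
    show "Y \<in> ?I"
    proof (cases "Y = X")
      case False
      hence "card Y < card X" using Y fin by (intro psubset_card_mono) auto
      thus ?thesis using fin Y by (intro small) auto
    qed (use X in simp)
  next
    fix X Y assume X: "X \<in> ?I" and Y: "Y \<in> ?I" and lt: "card X < card Y"
    have XY: "X \<subseteq> {1..n}" "Y \<subseteq> {1..n}" "finite X" "finite Y" "card Y \<le> r"
      using X Y finite_subset by (auto simp: sparse_paving_def)
    have ne: "card (Y - X) > 0"
      using lt XY by (metis card_gt_0_iff card_mono diff_is_0_eq' Diff_eq_empty_iff finite_Diff not_le)
    then obtain y where y: "y \<in> Y - X" by (metis card_gt_0_iff ex_in_conv)
    show "\<exists>y\<in>Y - X. insert y X \<in> ?I"
    proof (cases "card X < r - 1")
      case True
      hence "insert y X \<in> ?I" using y XY by (intro small) (auto simp: card_insert_if)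
      thus ?thesis using y by blast
    next
      case False
      hence c: "card X = r - 1" "card Y = r" using lt XY by auto
      show ?thesis
      proof (cases "\<exists>z\<in>Y - X. z \<noteq> y")
        case True
        then obtain z where z: "z \<in> Y - X" "z \<noteq> y" by blast
        have "insert y X \<in> ?I \<or> insert z X \<in> ?I" using y z XY c by (intro two) auto
        thus ?thesis using y z by blast
      next
        case False
        hence sub: "Y \<subseteq> insert y X" by blast
        have "card (insert y X) = card Y" using y c XY r by auto
        hence "insert y X = Y" using sub XY by (metis card_subset_eq finite_insert)
        thus ?thesis using y Y by auto
      qed
    qed
  qed simp
  have "\<exists>X\<in>?I. card X = r"
  proof -
    define X where "X = {1..r - 1}"
    have X: "X \<subseteq> {1..n}" "card X = r - 1" using n by (auto simp: X_def)
    have "insert r X \<in> ?I \<or> insert (r + 1) X \<in> ?I" using n r by (intro two X) (auto simp: X_def)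
    moreover have "card (insert r X) = r" "card (insert (r + 1) X) = r" using r by (auto simp: X_def)
    ultimately show ?thesis by blast
  qed
  moreover have "finite ?I" using finite_subset[of ?I "Pow {1..n}"] by (auto simp: sparse_paving_def)
  ultimately have rank: "matroid_rank ?I = r"
    unfolding matroid_rank_def by (intro Max_eqI) (auto simp: sparse_paving_def)
  show ?thesis using mat rank small by (simp add: paving_matroids_def paving_def)
qed

text \<open>The forbidden r-sets are those missing from the family, and their shadows form
  \<open>M\<close>.\<close>

lemma inj_on_sparse_paving:
  assumes r: "r \<ge> 2"
  shows "inj_on (sparse_paving n r) (Pow (johnson_edges n r))"
proof (rule inj_on_inverseI)
  fix M assume M: "M \<in> Pow (johnson_edges n r)"
  show "shadow r ` {Y. Y \<subseteq> {1..n} \<and> card Y = r \<and> Y \<notin> sparse_paving n r M} = M"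
  proof (rule set_eqI, rule iffI)
    fix e assume e: "e \<in> M"
    hence "e \<in> johnson_edges n r" using M by auto
    then obtain Y where Y: "Y \<subseteq> {1..n}" "card Y = r" "e = shadow r Y" using r by (rule johnson_edgesE)
    thus "e \<in> shadow r ` {Y. Y \<subseteq> {1..n} \<and> card Y = r \<and> Y \<notin> sparse_paving n r M}"
      using e by (auto simp: sparse_paving_def)
  qed (auto simp: sparse_paving_def)
qed

theorem ln_num_paving_ge:
  assumes r: "r \<ge> 2" and n: "r < n" and m1: "0 < m1" "m1 \<le> n" and d1: "1 \<le> real n * (real m1 / real n) ^ r"
  defines "B \<equiv> ln (real n) + 1"
  defines "R \<equiv> real n / real m1"
  shows "real (n choose (r - 1)) / real r * (B - real r - B / R - R ^ r / real n - 10 * real r ^ 5 * B * R ^ (3 * r + 1) / sqrt (real n))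
    \<le> ln (real (num_paving n r))"
proof -
  let ?V = "subsets_of_card (r - 1) {1..n}"
  let ?E = "johnson_edges n r"
  interpret coloured_hypergraph ?V ?E "sum_colour n" r n by (rule johnson_coloured_hypergraph[OF r])
  have n0: "0 < n" using n by simp
  have inc: "incident ?V {..<n} X = {f \<in> ?E. X \<in> f}" for X
    using edge_subset n0 by (auto simp: incident_def sum_colour_def)
  have "real (card ?V) / real r * (B - real r - B / R - R ^ r / real n - 10 * real r ^ 5 * B * R ^ (3 * r + 1) / sqrt (real n))
      \<le> ln (real (card (matchings ?V {..<n})))"
    unfolding B_def R_def
  proof (rule ln_card_matchings_ge[OF n0 m1])
    show "1 \<le> dens m1" using d1 by (simp add: dens_def)
    show "n \<le> card (incident ?V {..<n} v) + r" if "v \<in> ?V" for v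
      unfolding inc using johnson_degree[OF r that] n by simp
  qed
  also have "\<dots> \<le> ln (real (num_paving n r))"
  proof -
    have "card (matchings ?V {..<n}) \<le> card (paving_matroids n r)"
    proof (rule card_inj_on_le)
      show "inj_on (sparse_paving n r) (matchings ?V {..<n})"
        by (rule inj_on_subset[OF inj_on_sparse_paving[OF r, of n]]) (auto simp: matchings_def)
      show "sparse_paving n r ` matchings ?V {..<n} \<subseteq> paving_matroids n r"
        by (rule image_subsetI, rule sparse_paving_matroid[OF r n]) (auto simp: matchings_def)
    qed (rule finite_paving_matroids)
    thus ?thesis unfolding num_paving_def using card_matchings_pos[of ?V "{..<n}"] by (subst ln_le_cancel_iff) auto
  qed
  also have "card ?V = n choose (r - 1)" by (simp add: card_subsets_of_card)
  finally show ?thesis .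
qed

section \<open>The blocks of a paving matroid\<close>

text \<open>Equality holds for r = 4 and s = 5. For s = r + 1 the binomial coefficient is (r + 1) /
  4 times r (s - r + 1); every further element adds 5 r on the left and 4 (s choose (r - 2)) on the
  right, which is at least as much.\<close>

lemma four_times_choose_ge:
  assumes r: "r \<ge> 4" and s: "r + 1 \<le> s"
  shows "5 * r * (s - (r - 1)) \<le> 4 * (s choose (r - 1))"
  using s
proof (induction s rule: dec_induct)
  case base
  have "(r + 1) choose (r - 1) = (r + 1) choose 2"
    using r binomial_symmetric[of "r - 1" "r + 1"] by simp
  also have "\<dots> = (r + 1) * r div 2" by (simp add: choose_two)
  finally have c: "2 * ((r + 1) choose (r - 1)) = (r + 1) * r" by simp
  have "5 * r * 2 \<le> 2 * ((r + 1) * r)" using r by simp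
  thus ?case using r c by simp
next
  case (step s)
  have "5 * r \<le> 4 * (s choose (r - 2))"
  proof -
    have "(r + 1) choose (r - 2) = (r + 1) choose 3"
      using r binomial_symmetric[of "r - 2" "r + 1"] by simp
    moreover have "3 * ((r + 1) choose 3) = (r + 1) * (r choose 2)"
      using Suc_times_binomial_eq[of r 2] by (simp add: numeral_3_eq_3 numeral_2_eq_2 mult.commute)
    moreover have "2 * (r choose 2) = r * (r - 1)"
    proof -
      have "even (r * (r - 1))" by (cases "even r") auto
      thus ?thesis by (simp add: choose_two)
    qed
    moreover have "6 * ((r + 1) choose 3) = 2 * (3 * ((r + 1) choose 3))" by simp
    ultimately have "6 * ((r + 1) choose (r - 2)) = (r + 1) * (r * (r - 1))" by (metis mult.left_commute)
    moreover have "5 * 3 * r \<le> (r + 1) * (r * (r - 1))"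
    proof -
      have "5 * 3 \<le> (r + 1) * (r - 1)" using r by (intro mult_le_mono) auto
      hence "(5 * 3) * r \<le> ((r + 1) * (r - 1)) * r" by (rule mult_le_mono1)
      thus ?thesis by (simp add: mult_ac)
    qed
    ultimately have "5 * 3 * r \<le> 6 * ((r + 1) choose (r - 2))" by simp
    moreover have "(r + 1) choose (r - 2) \<le> s choose (r - 2)" using step.hyps by (intro binomial_right_mono)
    ultimately show ?thesis by linarith
  qed
  moreover have "Suc s choose (r - 1) = (s choose (r - 2)) + (s choose (r - 1))"
    using r binomial_Suc_Suc[of s "r - 2"] by (simp add: Suc_diff_le numeral_2_eq_2 Suc_diff_Suc)
  moreover have "Suc s - (r - 1) = Suc (s - (r - 1))" using step.hyps by simp
  ultimately show ?case using step.IH by simp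
qed

text \<open>The recorded \<open>r\<close>-subsets of one block share \<open>r - 1\<close> elements, whereas distinct blocks meet in at most
  \<open>r - 2\<close> elements; so the large blocks can be read off from the union of their recorded sets.\<close>

definition decode_blocks :: "nat \<Rightarrow> 'a set set \<Rightarrow> 'a set set" where
  "decode_blocks r G = (\<lambda>g. \<Union>{g'\<in>G. r - 1 \<le> card (g \<inter> g')}) ` G"

text \<open>Defined from the code alone, with \<open>T\<close> for the trivial blocks and
  \<open>G\<close> for the recorded sets: matchings are counted for each code, and the counts are
  summed over all codes.\<close>

definition uncovered :: "nat \<Rightarrow> nat \<Rightarrow> nat set set \<Rightarrow> nat set set \<Rightarrow> nat set set" where
  "uncovered n r T G = {X \<in> subsets_of_card (r - 1) {1..n}. X \<notin> T \<and> \<not> (\<exists>H\<in>decode_blocks r G. X \<subseteq> H)}"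

definition rebuild :: "nat \<Rightarrow> nat \<Rightarrow> nat set set \<Rightarrow> nat set set set \<Rightarrow> nat set set" where
  "rebuild n r G F = {X. X \<subseteq> {1..n} \<and> (card X < r \<or>
     card X = r \<and> shadow r X \<notin> F \<and> \<not> (\<exists>H\<in>decode_blocks r G. X \<subseteq> H))}"

locale paving_matroid =
  fixes n r :: nat and I :: "nat set set"
  assumes paving_I: "I \<in> paving_matroids n r" and r_ge_2: "2 \<le> r"
begin

abbreviation "V \<equiv> subsets_of_card (r - 1) {1..n}"

lemma indep_facts:
  shows indep_subset: "X \<in> I \<Longrightarrow> X \<subseteq> {1..n}"
    and indep_small: "X \<subseteq> {1..n} \<Longrightarrow> card X < r \<Longrightarrow> X \<in> I"
    and exchange: "X \<in> I \<Longrightarrow> Y \<in> I \<Longrightarrow> card X < card Y \<Longrightarrow> \<exists>y\<in>Y - X. insert y X \<in> I"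
    and indep_card_le: "X \<in> I \<Longrightarrow> card X \<le> r"
proof -
  have P: "matroid {1..n} I" "matroid_rank I = r" "\<And>F. F \<subseteq> {1..n} \<Longrightarrow> card F < r \<Longrightarrow> F \<in> I"
    using paving_I unfolding paving_matroids_def paving_def by auto
  show "X \<in> I \<Longrightarrow> X \<subseteq> {1..n}"
    and "X \<in> I \<Longrightarrow> Y \<in> I \<Longrightarrow> card X < card Y \<Longrightarrow> \<exists>y\<in>Y - X. insert y X \<in> I"
    using P(1) unfolding matroid_def by blast+
  show "X \<subseteq> {1..n} \<Longrightarrow> card X < r \<Longrightarrow> X \<in> I" by (rule P(3))
  have "finite I" using P(1) unfolding matroid_def by (meson finite_Pow_iff finite_subset)
  thus "card X \<le> r" if "X \<in> I" using that P(2) unfolding matroid_rank_def by (metis Max_ge finite_imageI imageI)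
qed

lemma V_facts:
  assumes "X \<in> V"
  shows "X \<subseteq> {1..n}" "card X = r - 1" "finite X" "X \<in> I"
  using assms indep_small[of X] r_ge_2 by (auto simp: subsets_of_card_def intro: finite_subset)

text \<open>For X in \<open>V\<close> this is the closure of X, the hyperplane that it
  spans.\<close>

definition span :: "nat set \<Rightarrow> nat set" where
  "span X = {y \<in> {1..n}. y \<in> X \<or> insert y X \<notin> I}"

lemma subset_span: "X \<in> V \<Longrightarrow> X \<subseteq> span X"
  using V_facts(1)[of X] unfolding span_def by blast

lemma dependent_in_span:
  assumes "X \<in> V" "J \<subseteq> span X" "card J = r"
  shows "J \<notin> I"
proof
  assume "J \<in> I"
  then obtain w where "w \<in> J - X" "insert w X \<in> I"
    using exchange[of X J] V_facts[OF assms(1)] assms(3) r_ge_2 by auto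
  thus False using assms(2) by (auto simp: span_def)
qed

text \<open>If y were in \<open>span X'\<close> but not in \<open>span X\<close>, then
  \<open>insert y X\<close> would be an independent r-set from which exchange extends
  \<open>X'\<close>; not by y, hence by an element of X, which gives an independent r-set inside
  \<open>span X\<close>.\<close>

lemma span_subset:
  assumes X: "X \<in> V" and X': "X' \<in> V" and sub: "X' \<subseteq> span X"
  shows "span X' \<subseteq> span X"
proof
  fix y assume y: "y \<in> span X'"
  show "y \<in> span X"
  proof (rule ccontr)
    assume ny: "y \<notin> span X"
    hence "y \<notin> X'" using sub by blast
    hence yX': "insert y X' \<notin> I" "y \<in> {1..n}" using y by (auto simp: span_def)
    have yX: "insert y X \<in> I" "y \<notin> X" using ny yX'(2) by (auto simp: span_def)
    have "card X' < card (insert y X)" using V_facts[OF X] V_facts[OF X'] yX(2) by simp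
    then obtain z where z: "z \<in> insert y X - X'" "insert z X' \<in> I"
      using exchange[of X' "insert y X"] V_facts(4)[OF X'] yX(1) by blast
    have "z \<noteq> y" using z(2) yX'(1) by blast
    hence "insert z X' \<subseteq> span X" using z(1) subset_span[OF X] sub by blast
    moreover have "card (insert z X') = r" using z(1) V_facts[OF X'] r_ge_2 by simp
    ultimately show False using dependent_in_span[OF X] z(2) by blast
  qed
qed

text \<open>A hyperplane of a paving matroid is determined by any r - 1 of its elements; this is why
  the blocks partition the vertices of the hypergraph.\<close>

lemma span_eq:
  assumes X: "X \<in> V" and X': "X' \<in> V" and sub: "X' \<subseteq> span X"
  shows "span X' = span X"
proof -
  have "X \<subseteq> span X'"
  proof
    fix z assume z: "z \<in> X"
    show "z \<in> span X'"
    proof (cases "z \<in> X'")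
      case True
      thus ?thesis using subset_span[OF X'] by blast
    next
      case False
      have "insert z X' \<subseteq> span X" using z subset_span[OF X] sub by blast
      moreover have "card (insert z X') = r" using False V_facts[OF X'] r_ge_2 by simp
      ultimately have "insert z X' \<notin> I" by (rule dependent_in_span[OF X])
      thus ?thesis using z V_facts(1)[OF X] by (auto simp: span_def)
    qed
  qed
  thus ?thesis using span_subset[OF X X' sub] span_subset[OF X' X] by blast
qed

definition blocks :: "nat set set" where "blocks = span ` V"

lemma block_facts:
  assumes "H \<in> blocks"
  shows "H \<subseteq> {1..n}" "finite H" "r - 1 \<le> card H" "X \<in> V \<Longrightarrow> X \<subseteq> H \<Longrightarrow> H = span X"
proof -
  obtain X0 where X0: "X0 \<in> V" "H = span X0" using assms by (auto simp: blocks_def)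
  show sub: "H \<subseteq> {1..n}" using X0(2) by (auto simp: span_def)
  show fin: "finite H" using sub finite_subset by blast
  show "r - 1 \<le> card H" using card_mono[OF fin, of X0] subset_span[OF X0(1)] V_facts(2)[OF X0(1)] X0(2) by simp
  show "H = span X" if "X \<in> V" "X \<subseteq> H" using span_eq[of X0 X] X0 that by simp
qed

lemma block_unique: "H \<in> blocks \<Longrightarrow> H' \<in> blocks \<Longrightarrow> X \<in> V \<Longrightarrow> X \<subseteq> H \<Longrightarrow> X \<subseteq> H' \<Longrightarrow> H = H'"
  using block_facts(4) by blast

text \<open>Any r - 1 elements of a dependent r-set are independent and span a block that contains
  the remaining one.\<close>

lemma dependent_iff:
  assumes "Y \<subseteq> {1..n}" "card Y = r"
  shows "Y \<notin> I \<longleftrightarrow> (\<exists>H\<in>blocks. Y \<subseteq> H)"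
proof
  have fin: "finite Y" using assms finite_subset by blast
  have "Y \<noteq> {}" using assms r_ge_2 by auto
  then obtain y where y: "y \<in> Y" by blast
  define X where "X = Y - {y}"
  have X: "X \<in> V" "insert y X = Y" using y fin assms by (auto simp: X_def subsets_of_card_def)
  {
    assume "Y \<notin> I"
    hence "Y \<subseteq> span X" using X assms(1) subset_span[OF X(1)] y by (auto simp: span_def)
    thus "\<exists>H\<in>blocks. Y \<subseteq> H" using X(1) by (auto simp: blocks_def)
  }
  {
    assume "\<exists>H\<in>blocks. Y \<subseteq> H"
    then obtain X0 where "X0 \<in> V" "Y \<subseteq> span X0" by (auto simp: blocks_def)
    thus "Y \<notin> I" using dependent_in_span assms(2) by blast
  }
qed

section \<open>Blocks by size, and their encoding\<close>

definition big :: "nat set set" where "big = {H \<in> blocks. r < card H}"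
definition mid :: "nat set set" where "mid = {H \<in> blocks. card H = r}"
definition triv :: "nat set set" where "triv = {X \<in> V. span X = X}"

text \<open>An arbitrary choice suffices: decoding reconstructs the block from the recorded sets
  themselves.\<close>

definition base :: "nat set \<Rightarrow> nat set" where
  "base H = (SOME X. X \<subseteq> H \<and> card X = r - 1)"

definition star :: "nat set \<Rightarrow> nat set set" where
  "star H = (\<lambda>h. insert h (base H)) ` (H - base H)"

definition gens :: "nat set set" where "gens = \<Union>(star ` big)"

lemma base_facts:
  assumes "H \<in> blocks"
  shows "base H \<subseteq> H" "card (base H) = r - 1" "finite (base H)" "base H \<in> V"
proof -
  have "\<exists>X. X \<subseteq> H \<and> card X = r - 1"
    using block_facts(3)[OF assms] obtain_subset_with_card_n by metis
  hence *: "base H \<subseteq> H \<and> card (base H) = r - 1" unfolding base_def by (rule someI_ex)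
  thus "base H \<subseteq> H" "card (base H) = r - 1" by auto
  show "finite (base H)" using * block_facts(2)[OF assms] finite_subset by blast
  show "base H \<in> V" using * block_facts(1)[OF assms] by (auto simp: subsets_of_card_def)
qed

lemma star_facts:
  assumes H: "H \<in> big" and g: "g \<in> star H"
  shows "g \<subseteq> H" "card g = r" "base H \<subseteq> g"
proof -
  have Hb: "H \<in> blocks" using H by (simp add: big_def)
  note b = base_facts[OF Hb]
  show "g \<subseteq> H" "base H \<subseteq> g" using g b(1) by (auto simp: star_def)
  show "card g = r" using g b(2,3) r_ge_2 by (auto simp: star_def)
qed

lemma Union_star:
  assumes "H \<in> big"
  shows "\<Union>(star H) = H"
proof -
  have Hb: "H \<in> blocks" "r < card H" using assms by (auto simp: big_def)
  note b = base_facts[OF Hb(1)]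
  have "H \<noteq> base H" using b(2) Hb(2) by auto
  hence "H - base H \<noteq> {}" using b(1) by blast
  thus ?thesis using b(1) by (auto simp: star_def)
qed

lemma card_star:
  assumes "H \<in> big"
  shows "card (star H) = card H - (r - 1)"
proof -
  have Hb: "H \<in> blocks" using assms by (auto simp: big_def)
  note b = base_facts[OF Hb]
  have "inj_on (\<lambda>h. insert h (base H)) (H - base H)" by (rule inj_onI) blast
  hence "card (star H) = card (H - base H)" unfolding star_def by (rule card_image)
  thus ?thesis using b by (simp add: card_Diff_subset)
qed

lemma star_inter_card:
  assumes H: "H \<in> big" "g \<in> star H" and H': "H' \<in> big" "g' \<in> star H'"
  shows "r - 1 \<le> card (g \<inter> g') \<longleftrightarrow> H = H'"
proof
  assume "r - 1 \<le> card (g \<inter> g')"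
  then obtain X where X: "X \<subseteq> g \<inter> g'" "card X = r - 1" using obtain_subset_with_card_n by metis
  have sub: "X \<subseteq> H" "X \<subseteq> H'" using X star_facts(1)[OF H] star_facts(1)[OF H'] by blast+
  have Hb: "H \<in> blocks" "H' \<in> blocks" using H H' by (auto simp: big_def)
  have "X \<in> V" using X(2) sub(1) block_facts(1)[OF Hb(1)] by (auto simp: subsets_of_card_def)
  thus "H = H'" using block_unique[OF Hb] sub by blast
next
  assume "H = H'"
  hence "base H \<subseteq> g \<inter> g'" using star_facts(3)[OF H] star_facts(3)[OF H'] by blast
  moreover have Hb: "H \<in> blocks" using H by (auto simp: big_def)
  moreover have "finite (g \<inter> g')" using star_facts(1)[OF H] block_facts(2)[OF Hb] finite_subset by blast
  ultimately show "r - 1 \<le> card (g \<inter> g')" using base_facts(2)[OF Hb] card_mono by metis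
qed

lemma decode_gens: "decode_blocks r gens = big"
proof -
  have dec: "\<Union>{g'\<in>gens. r - 1 \<le> card (g \<inter> g')} = H" if H: "H \<in> big" "g \<in> star H" for H g
  proof -
    have "{g'\<in>gens. r - 1 \<le> card (g \<inter> g')} = star H"
      using star_inter_card[OF H] H unfolding gens_def by blast
    thus ?thesis using Union_star[OF H(1)] by simp
  qed
  show ?thesis
  proof (rule set_eqI, rule iffI)
    fix H assume "H \<in> decode_blocks r gens"
    then obtain g where g: "g \<in> gens" "H = \<Union>{g'\<in>gens. r - 1 \<le> card (g \<inter> g')}" unfolding decode_blocks_def by blast
    then obtain H' where "H' \<in> big" "g \<in> star H'" unfolding gens_def by blast
    thus "H \<in> big" using dec g(2) by simp
  next
    fix H assume H: "H \<in> big"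
    have "H \<noteq> {}" using H r_ge_2 by (auto simp: big_def)
    hence "star H \<noteq> {}" using Union_star[OF H] by auto
    then obtain g where g: "g \<in> star H" by blast
    hence "g \<in> gens" using H unfolding gens_def by blast
    thus "H \<in> decode_blocks r gens" using dec[OF H g] unfolding decode_blocks_def by blast
  qed
qed

lemma blocks_containing:
  assumes X: "X \<in> V"
  shows "span X \<in> blocks" "X \<in> triv \<or> span X \<in> mid \<or> span X \<in> big"
proof -
  show b: "span X \<in> blocks" using X by (simp add: blocks_def)
  have "span X = X" if "card (span X) = r - 1"
    using card_subset_eq[OF block_facts(2)[OF b] subset_span[OF X]] V_facts(2)[OF X] that by simp
  moreover have "card (span X) = r - 1 \<or> card (span X) = r \<or> r < card (span X)"
    using block_facts(3)[OF b] by linarith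
  ultimately show "X \<in> triv \<or> span X \<in> mid \<or> span X \<in> big"
    using b X unfolding triv_def mid_def big_def by blast
qed

text \<open>Every vertex lies in exactly one block, of size r - 1, r or more; removing the first and
  the last kind leaves the shadows of the middle one.\<close>

lemma uncovered_eq: "uncovered n r triv gens = \<Union>(shadow r ` mid)"
proof (rule set_eqI, rule iffI)
  fix X assume "X \<in> uncovered n r triv gens"
  hence X: "X \<in> V" "X \<notin> triv" "\<not> (\<exists>H\<in>big. X \<subseteq> H)" by (auto simp: uncovered_def decode_gens)
  hence "span X \<in> mid" using blocks_containing(2)[OF X(1)] subset_span[OF X(1)] by blast
  moreover have "X \<in> shadow r (span X)" using subset_span[OF X(1)] V_facts(2)[OF X(1)] by (simp add: shadow_def subsets_of_card_def)
  ultimately show "X \<in> \<Union>(shadow r ` mid)" by blast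
next
  fix X assume "X \<in> \<Union>(shadow r ` mid)"
  then obtain H where H: "H \<in> mid" "X \<subseteq> H" "card X = r - 1" by (auto simp: shadow_def subsets_of_card_def)
  have Hb: "H \<in> blocks" "card H = r" using H(1) by (auto simp: mid_def)
  have X: "X \<in> V" using H block_facts(1)[OF Hb(1)] by (auto simp: subsets_of_card_def)
  have HX: "H = span X" using block_facts(4)[OF Hb(1) X H(2)] .
  have "X \<notin> triv" using HX Hb(2) V_facts(2)[OF X] r_ge_2 by (auto simp: triv_def)
  moreover have "\<not> X \<subseteq> H'" if "H' \<in> big" for H'
    using block_unique[OF Hb(1) _ X H(2), of H'] that Hb(2) by (auto simp: big_def)
  ultimately show "X \<in> uncovered n r triv gens" using X by (auto simp: uncovered_def decode_gens)
qed

lemma mid_perfect_matching: "shadow r ` mid \<in> perfect_matchings (johnson_edges n r) (uncovered n r triv gens)"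
proof (rule perfect_matchingsI)
  show "shadow r ` mid \<subseteq> johnson_edges n r"
    using block_facts(1) by (auto simp: mid_def johnson_edges_def subsets_of_card_def)
  show "\<Union>(shadow r ` mid) = uncovered n r triv gens" by (simp add: uncovered_eq)
  fix a b X assume a: "a \<in> shadow r ` mid" "b \<in> shadow r ` mid" "X \<in> a" "X \<in> b"
  obtain H where H: "H \<in> mid" "a = shadow r H" using a(1) by blast
  obtain H' where H': "H' \<in> mid" "b = shadow r H'" using a(2) by blast
  have X: "X \<subseteq> H" "X \<subseteq> H'" "card X = r - 1" using a H H' by (auto simp: shadow_def subsets_of_card_def)
  have b: "H \<in> blocks" "H' \<in> blocks" using H H' by (auto simp: mid_def)
  have "X \<in> V" using X block_facts(1)[OF b(1)] by (auto simp: subsets_of_card_def)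
  hence "H = H'" using block_unique[OF b] X by blast
  thus "a = b" using H H' by simp
qed

text \<open>A dependent r-set lies in a block of at least r elements: it is a member of
  \<open>mid\<close> or is contained in a member of \<open>big\<close>.\<close>

lemma rebuild_eq: "rebuild n r gens (shadow r ` mid) = I"
proof (rule set_eqI)
  fix Y
  have sh: "shadow r Y \<in> shadow r ` mid \<longleftrightarrow> Y \<in> mid" if "card Y = r"
  proof
    assume "shadow r Y \<in> shadow r ` mid"
    then obtain H where H: "H \<in> mid" "shadow r Y = shadow r H" by blast
    have "card H = r" using H by (simp add: mid_def)
    hence "Y = H" using Union_shadow[OF that r_ge_2] Union_shadow[of H r] r_ge_2 H(2) by metis
    thus "Y \<in> mid" using H by simp
  qed blast
  have dep: "Y \<notin> I \<longleftrightarrow> Y \<in> mid \<or> (\<exists>H\<in>big. Y \<subseteq> H)" if Y: "Y \<subseteq> {1..n}" "card Y = r"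
  proof -
    have "(\<exists>H\<in>blocks. Y \<subseteq> H) \<longleftrightarrow> Y \<in> mid \<or> (\<exists>H\<in>big. Y \<subseteq> H)"
    proof
      assume "\<exists>H\<in>blocks. Y \<subseteq> H"
      then obtain H where H: "H \<in> blocks" "Y \<subseteq> H" by blast
      have "r \<le> card H" using card_mono[OF block_facts(2)[OF H(1)] H(2)] Y by simp
      moreover have "Y = H" if "card H = r" using card_subset_eq[OF block_facts(2)[OF H(1)] H(2)] that Y by simp
      ultimately show "Y \<in> mid \<or> (\<exists>H\<in>big. Y \<subseteq> H)" using H Y
        by (cases "card H = r") (auto simp: mid_def big_def)
    qed (auto simp: mid_def big_def)
    thus ?thesis using dependent_iff[OF Y] by simp
  qed
  show "Y \<in> rebuild n r gens (shadow r ` mid) \<longleftrightarrow> Y \<in> I"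
    using sh dep indep_small[of Y] indep_subset[of Y] indep_card_le[of Y]
    unfolding rebuild_def decode_gens mem_Collect_eq by (metis le_neq_implies_less)
qed

lemma gens_subset: "gens \<subseteq> subsets_of_card r {1..n}"
proof
  fix g assume "g \<in> gens"
  then obtain H where H: "H \<in> big" "g \<in> star H" unfolding gens_def by blast
  have "H \<subseteq> {1..n}" using H block_facts(1) by (auto simp: big_def)
  thus "g \<in> subsets_of_card r {1..n}" using star_facts(1,2)[OF H] by (auto simp: subsets_of_card_def)
qed

text \<open>Different large blocks have no (r - 1)-subset in common, so
  \<open>four_times_choose_ge\<close> can be added up over them. Each recorded set thus shrinks the
  part to be matched by 5 r / 4 vertices.\<close>

lemma card_uncovered_le:
  assumes r: "r \<ge> 4"
  shows "real (card (uncovered n r triv gens)) \<le> real (card V) - real (card triv) - 5 / 4 * real r * real (card gens)"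
proof -
  define cov where "cov = (\<Union>H\<in>big. subsets_of_card (r - 1) H)"
  have finV: "finite V" by (simp add: finite_subsets_of_card)
  have finblocks: "finite blocks" unfolding blocks_def using finV by simp
  hence finbig: "finite big" by (simp add: big_def)
  have covV: "cov \<subseteq> V" unfolding cov_def using block_facts(1) by (fastforce simp: big_def subsets_of_card_def)
  have un: "uncovered n r triv gens = V - (triv \<union> cov)"
    unfolding uncovered_def decode_gens cov_def by (auto simp: subsets_of_card_def)
  have trivV: "triv \<subseteq> V" by (auto simp: triv_def)
  have disj: "triv \<inter> cov = {}"
  proof (rule equals0I)
    fix X assume "X \<in> triv \<inter> cov"
    then obtain H where X: "X \<in> V" "span X = X" "H \<in> big" "X \<subseteq> H" by (auto simp: triv_def cov_def subsets_of_card_def)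
    have "H = span X" using block_facts(4)[of H X] X by (auto simp: big_def)
    hence "card H = r - 1" using X V_facts(2)[OF X(1)] by simp
    thus False using X(3) by (auto simp: big_def)
  qed
  have fin2: "finite triv" "finite cov" using trivV covV finV by (auto intro: finite_subset)
  have cU: "card (triv \<union> cov) = card triv + card cov" using fin2 disj by (rule card_Un_disjoint)
  have sub: "triv \<union> cov \<subseteq> V" using trivV covV by blast
  have "card (uncovered n r triv gens) = card V - (card triv + card cov)"
    unfolding un using fin2 sub by (simp add: card_Diff_subset cU)
  moreover have "card triv + card cov \<le> card V"
    using card_mono[OF finV sub] cU by simp
  ultimately have eq: "real (card (uncovered n r triv gens)) = real (card V) - real (card triv) - real (card cov)"
    by simp
  have ccov: "card cov = (\<Sum>H\<in>big. card H choose (r - 1))"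
  proof -
    have "card cov = (\<Sum>H\<in>big. card (subsets_of_card (r - 1) H))"
      unfolding cov_def
    proof (rule card_UN_disjoint[OF finbig])
      show "\<forall>H\<in>big. finite (subsets_of_card (r - 1) H)"
        using block_facts(2) finite_subsets_of_card by (auto simp: big_def)
      show "\<forall>i\<in>big. \<forall>j\<in>big. i \<noteq> j \<longrightarrow> subsets_of_card (r - 1) i \<inter> subsets_of_card (r - 1) j = {}"
      proof (intro ballI impI equals0I)
        fix i j X assume ij: "i \<in> big" "j \<in> big" "i \<noteq> j" "X \<in> subsets_of_card (r - 1) i \<inter> subsets_of_card (r - 1) j"
        have b: "i \<in> blocks" "j \<in> blocks" using ij by (auto simp: big_def)
        have "X \<in> V" "X \<subseteq> i" "X \<subseteq> j" using ij(4) block_facts(1)[OF b(1)] by (auto simp: subsets_of_card_def)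
        thus False using block_unique[OF b] ij(3) by blast
      qed
    qed
    thus ?thesis using block_facts(2) by (simp add: card_subsets_of_card big_def)
  qed
  have "card gens \<le> (\<Sum>H\<in>big. card (star H))" unfolding gens_def using finbig by (rule card_UN_le)
  also have "\<dots> = (\<Sum>H\<in>big. card H - (r - 1))" by (rule sum.cong) (auto simp: card_star)
  finally have "5 * r * card gens \<le> 5 * r * (\<Sum>H\<in>big. card H - (r - 1))" by (rule mult_le_mono2)
  also have "\<dots> \<le> (\<Sum>H\<in>big. 4 * (card H choose (r - 1)))"
    unfolding sum_distrib_left by (intro sum_mono four_times_choose_ge[OF r]) (auto simp: big_def)
  also have "\<dots> = 4 * card cov" unfolding ccov by (simp add: sum_distrib_left)
  finally have "real (5 * r * card gens) \<le> real (4 * card cov)" by (rule of_nat_mono)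
  thus ?thesis unfolding eq by simp
qed

end

section \<open>Asymptotics\<close>

lemma sum_Pow_power_card:
  fixes u :: real
  assumes "finite A"
  shows "(\<Sum>S\<in>Pow A. u ^ card S) = (1 + u) ^ card A"
proof -
  have "(\<Prod>x\<in>A. u + 1) = (\<Sum>S\<in>Pow A. (\<Prod>x\<in>S. u) * (\<Prod>x\<in>A - S. 1))" by (rule prod_add[OF assms])
  thus ?thesis by (simp add: add.commute)
qed

text \<open>Relative to exp (N Y / r), a trivial block contributes a factor exp (-Y / r) and a
  recorded set a factor exp (-5 Y / 4) to the bound on the number of matchings. Summed over all
  codes these factors give two powers, of 1 + exp (-Y / r) and of 1 + exp (-5 Y / 4), and 1 + x
  \<le> exp x turns them into the two error terms.\<close>

theorem ln_num_paving_le: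
  assumes r: "r \<ge> 4" and n: "r \<le> n"
  defines "Y \<equiv> ln (real (n - r + 1)) + 1 - real r + (real r)\<^sup>2 * real (n - r + 1) powr (-1 / real r)"
  assumes Y: "Y \<ge> 0"
  shows "ln (real (num_paving n r)) \<le> real (n choose (r - 1)) / real r * Y
     + real (n choose (r - 1)) * exp (- Y / real r) + real (n choose r) * exp (- 5 / 4 * Y)"
proof -
  let ?V = "subsets_of_card (r - 1) {1..n}" and ?R = "subsets_of_card r {1..n}" and ?E = "johnson_edges n r"
  let ?pm = "\<lambda>T G. perfect_matchings ?E (uncovered n r T G)"
  define N where "N = real (card ?V)"
  define P where "P = {(T, G) \<in> Pow ?V \<times> Pow ?R. real (card (uncovered n r T G)) \<le> N - real (card T) - 5 / 4 * real r * real (card G)}"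
  define S where "S = (SIGMA p:P. ?pm (fst p) (snd p))"
  have r2: "2 \<le> r" using r by simp
  interpret J: coloured_hypergraph ?V ?E "sum_colour n" r n by (rule johnson_coloured_hypergraph[OF r2])
  have fin: "finite ?V" "finite ?R" by (simp_all add: finite_subsets_of_card)
  have finP: "finite P" unfolding P_def by (rule finite_subset[of _ "Pow ?V \<times> Pow ?R"]) (use fin in auto)
  \<comment> \<open>Injective because \<open>rebuild\<close> recovers the matroid from the recorded
    sets and the matching.\<close>
  define enc where "enc = (\<lambda>I. ((paving_matroid.triv n r I, paving_matroid.gens n r I), shadow r ` paving_matroid.mid n r I))"
  have "card (paving_matroids n r) \<le> card S"
  proof (rule card_inj_on_le)
    show "inj_on enc (paving_matroids n r)"
    proof (rule inj_on_inverseI)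
      fix I assume "I \<in> paving_matroids n r"
      then interpret paving_matroid n r I using r2 by unfold_locales
      show "(\<lambda>p. rebuild n r (snd (fst p)) (snd p)) (enc I) = I" by (simp add: enc_def rebuild_eq)
    qed
    show "enc ` paving_matroids n r \<subseteq> S"
    proof (rule image_subsetI)
      fix I assume "I \<in> paving_matroids n r"
      then interpret paving_matroid n r I using r2 by unfold_locales
      have "triv \<subseteq> ?V" by (auto simp: triv_def)
      thus "enc I \<in> S"
        using gens_subset card_uncovered_le[OF r] mid_perfect_matching
        by (simp add: enc_def S_def P_def N_def)
    qed
    show "finite S" unfolding S_def using finP finite_perfect_matchings[OF J.finite_E] by (intro finite_SigmaI) auto
  qed
  also have "card S = (\<Sum>p\<in>P. card (?pm (fst p) (snd p)))"
    unfolding S_def using finP finite_perfect_matchings[OF J.finite_E] by (intro card_SigmaI) auto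
  finally have "real (num_paving n r) \<le> (\<Sum>p\<in>P. real (card (?pm (fst p) (snd p))))"
    unfolding num_paving_def of_nat_sum[symmetric] by (rule of_nat_mono)
  also have "\<dots> \<le> (\<Sum>p\<in>P. exp (N / real r * Y) * (exp (- Y / real r) ^ card (fst p) * exp (- 5 / 4 * Y) ^ card (snd p)))"
  proof (rule sum_mono)
    fix p assume p: "p \<in> P"
    obtain T G where TG: "p = (T, G)" by (cases p)
    let ?W = "uncovered n r T G"
    have cW: "real (card ?W) \<le> N - real (card T) - 5 / 4 * real r * real (card G)" using p TG by (auto simp: P_def)
    have WV: "?W \<subseteq> ?V" by (auto simp: uncovered_def)
    show "real (card (?pm (fst p) (snd p))) \<le> exp (N / real r * Y) * (exp (- Y / real r) ^ card (fst p) * exp (- 5 / 4 * Y) ^ card (snd p))"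
    proof (cases "?pm T G = {}")
      case False
      have pos: "real (card (?pm T G)) > 0"
        using False finite_perfect_matchings[OF J.finite_E] by (simp add: card_gt_0_iff)
      have "ln (real (card (?pm T G))) \<le> real (card ?W) / real r * Y"
        unfolding Y_def
      proof (rule ln_card_perfect_matchings_linear_le[OF J.finite_E _ J.uniform r2 J.linear _ _ False])
        show "finite ?W" using WV fin(1) by (rule finite_subset)
        show "card {f \<in> ?E. v \<in> f \<and> f \<subseteq> ?W} \<le> n - r + 1" if "v \<in> ?W" for v
        proof -
          have "card {f \<in> ?E. v \<in> f \<and> f \<subseteq> ?W} \<le> card {f \<in> ?E. v \<in> f}"
            using J.finite_E by (intro card_mono) auto
          also have "\<dots> = n - (r - 1)" using that WV by (intro johnson_degree[OF r2 _ n]) blast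
          finally show ?thesis using n r by simp
        qed
      qed auto
      also have "\<dots> \<le> (N - real (card T) - 5 / 4 * real r * real (card G)) / real r * Y"
        using cW Y by (intro mult_right_mono divide_right_mono) auto
      also have "\<dots> = N / real r * Y + (real (card T) * (- Y / real r) + real (card G) * (- 5 / 4 * Y))"
        using r by (simp add: field_simps)
      finally have "exp (ln (real (card (?pm T G)))) \<le> exp (N / real r * Y + (real (card T) * (- Y / real r) + real (card G) * (- 5 / 4 * Y)))"
        by simp
      also have "\<dots> = exp (N / real r * Y) * (exp (- Y / real r) ^ card T * exp (- 5 / 4 * Y) ^ card G)"
        by (simp only: exp_add exp_of_nat_mult)
      finally show ?thesis using pos TG by simp
    qed (simp add: TG)
  qed
  \<comment> \<open>Without the size constraint in \<open>P\<close> the sum factorises.\<close>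
  also have "\<dots> \<le> (\<Sum>p\<in>Pow ?V \<times> Pow ?R. exp (N / real r * Y) * (exp (- Y / real r) ^ card (fst p) * exp (- 5 / 4 * Y) ^ card (snd p)))"
    using fin by (intro sum_mono2) (auto simp: P_def)
  also have "\<dots> = exp (N / real r * Y) * ((\<Sum>T\<in>Pow ?V. exp (- Y / real r) ^ card T) * (\<Sum>G\<in>Pow ?R. exp (- 5 / 4 * Y) ^ card G))"
    unfolding sum_distrib_left[symmetric]
    by (rule arg_cong[of _ _ "(*) _"]) (simp only: sum_product sum.cartesian_product case_prod_unfold)
  also have "\<dots> = exp (N / real r * Y) * ((1 + exp (- Y / real r)) ^ card ?V * (1 + exp (- 5 / 4 * Y)) ^ card ?R)"
    using fin by (simp only: sum_Pow_power_card)
  also have "\<dots> \<le> exp (N / real r * Y) * (exp (exp (- Y / real r)) ^ card ?V * exp (exp (- 5 / 4 * Y)) ^ card ?R)"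
    by (intro mult_left_mono mult_mono power_mono exp_ge_add_one_self) (auto intro: add_nonneg_nonneg)
  also have "\<dots> = exp (N / real r * Y + N * exp (- Y / real r) + real (card ?R) * exp (- 5 / 4 * Y))"
    by (simp only: exp_add exp_of_nat_mult N_def mult.assoc)
  finally have le: "real (num_paving n r) \<le> exp (N / real r * Y + N * exp (- Y / real r) + real (card ?R) * exp (- 5 / 4 * Y))" .
  have "ln (real (num_paving n r)) \<le> N / real r * Y + N * exp (- Y / real r) + real (card ?R) * exp (- 5 / 4 * Y)"
  proof (cases "num_paving n r = 0")
    \<comment> \<open>Here \<open>ln 0 = 0\<close>, so a nonnegative right-hand side is
      enough.\<close>
    case True
    have "0 \<le> N / real r * Y + N * exp (- Y / real r) + real (card ?R) * exp (- 5 / 4 * Y)"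
      using Y by (intro add_nonneg_nonneg mult_nonneg_nonneg) (auto simp: N_def)
    thus ?thesis using True by simp
  next
    case False
    hence "ln (real (num_paving n r)) \<le> ln (exp (N / real r * Y + N * exp (- Y / real r) + real (card ?R) * exp (- 5 / 4 * Y)))"
      using le by (subst ln_le_cancel_iff) auto
    thus ?thesis by simp
  qed
  thus ?thesis by (simp add: N_def card_subsets_of_card)
qed

section \<open>Size of the error terms, and the limit\<close>

lemma choose_ratio:
  assumes "1 \<le> r" "r \<le> n"
  shows "real (n choose r) = real (n - r + 1) * (real (n choose (r - 1)) / real r)"
proof -
  obtain j where j: "r = Suc j" using assms(1) by (cases r) auto
  have "Suc j * (n choose Suc j) = n * ((n - 1) choose j)" by (rule binomial_absorption)
  also have "\<dots> = (n - j) * (n choose j)" by (rule binomial_absorb_comp[symmetric])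
  finally have "r * (n choose r) = (n - j) * (n choose (r - 1))" using j by simp
  moreover have "n - j = n - r + 1" using j assms by simp
  ultimately have "r * (n choose r) = (n - r + 1) * (n choose (r - 1))" by simp
  hence "real r * real (n choose r) = real (n - r + 1) * real (n choose (r - 1))" by (metis of_nat_mult)
  thus ?thesis using assms by (simp add: field_simps)
qed

text \<open>The lower bound on n - r + 1 makes \<open>Y\<close> nonnegative. Recorded sets are
  chosen from D N / r candidates, so their error relative to N / r is D exp (-5 Y / 4), of order
  D^(-1/4); this is where the ratio 5/4 must exceed 1. Trivial blocks give order D^(-1/r).\<close>

lemma num_paving_upper:
  assumes r: "r \<ge> 4" and n: "r \<le> n" and D: "exp (real r - 1) \<le> real (n - r + 1)"
  defines "D \<equiv> real (n - r + 1)"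
  shows "ln (real (num_paving n r)) \<le> real (n choose (r - 1)) / real r *
     (ln D + 1 - real r + ((real r)\<^sup>2 * D powr (-1 / real r) + real r * exp ((real r - 1) / real r) * D powr (-1 / real r)
        + exp (5 / 4 * (real r - 1)) * D powr (-1 / 4)))"
proof -
  define Z where "Z = ln D + 1 - real r"
  define Y where "Y = Z + (real r)\<^sup>2 * D powr (-1 / real r)"
  define M where "M = real (n choose (r - 1)) / real r"
  have D0: "D > 0" by (simp add: D_def)
  have "ln (exp (real r - 1)) \<le> ln D" using D D0 unfolding D_def by (subst ln_le_cancel_iff) auto
  hence Z: "Z \<ge> 0" by (simp add: Z_def)
  hence YZ: "Y \<ge> Z" by (simp add: Y_def)
  have M: "M \<ge> 0" by (simp add: M_def)
  have a: "exp (- Y / real r) \<le> exp ((real r - 1) / real r) * D powr (-1 / real r)"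
  proof -
    have "exp (- Y / real r) \<le> exp (- Z / real r)" using YZ by (simp add: divide_right_mono)
    also have "- Z / real r = (real r - 1) / real r + (-1 / real r) * ln D"
      using r by (simp add: Z_def field_simps)
    also have "exp \<dots> = exp ((real r - 1) / real r) * D powr (-1 / real r)"
      by (subst exp_add) (use D0 in \<open>simp add: powr_def\<close>)
    finally show ?thesis .
  qed
  have b: "D * exp (- 5 / 4 * Y) \<le> exp (5 / 4 * (real r - 1)) * D powr (-1 / 4)"
  proof -
    have "exp (- 5 / 4 * Y) \<le> exp (- 5 / 4 * Z)" using YZ by simp
    also have "- 5 / 4 * Z = 5 / 4 * (real r - 1) + (- 5 / 4) * ln D" by (simp add: Z_def field_simps)
    also have "exp \<dots> = exp (5 / 4 * (real r - 1)) * D powr (- 5 / 4)"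
      by (subst exp_add) (use D0 in \<open>simp add: powr_def\<close>)
    finally have "D * exp (- 5 / 4 * Y) \<le> D * (exp (5 / 4 * (real r - 1)) * D powr (- 5 / 4))"
      using D0 by (intro mult_left_mono) auto
    also have "\<dots> = exp (5 / 4 * (real r - 1)) * (D powr 1 * D powr (- 5 / 4))" using D0 by simp
    also have "D powr 1 * D powr (- 5 / 4) = D powr (1 + - 5 / 4)" by (rule powr_add[symmetric])
    also have "1 + - 5 / 4 = (-1 / 4 :: real)" by simp
    finally show ?thesis .
  qed
  have "ln (real (num_paving n r)) \<le> M * Y + real (n choose (r - 1)) * exp (- Y / real r) + real (n choose r) * exp (- 5 / 4 * Y)"
    using ln_num_paving_le[OF r n] YZ Z unfolding Y_def Z_def D_def M_def by simp
  also have "real (n choose (r - 1)) = M * real r" using r by (simp add: M_def)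
  also have "real (n choose r) = D * M" unfolding D_def M_def using r n by (intro choose_ratio) auto
  also have "M * Y + M * real r * exp (- Y / real r) + D * M * exp (- 5 / 4 * Y) =
      M * (Y + real r * exp (- Y / real r) + D * exp (- 5 / 4 * Y))" by (simp add: algebra_simps)
  also have "\<dots> \<le> M * (Y + real r * (exp ((real r - 1) / real r) * D powr (-1 / real r)) + exp (5 / 4 * (real r - 1)) * D powr (-1 / 4))"
    using a b M by (intro mult_left_mono add_mono) auto
  finally show ?thesis by (simp add: Y_def Z_def M_def algebra_simps)
qed

text \<open>\<open>\<eta>\<close> is chosen so that R is about n^\<eta> and R^(3 r + 1) at most
  n^(1/4), leaving n^(-1/4) after division by sqrt n. Still R grows like a power of n, which makes B
  / R vanish.\<close>

lemma num_paving_lower: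
  assumes r: "r \<ge> 2" and n: "r < n"
  defines "\<eta> \<equiv> 1 / (4 * (3 * real r + 1))"
  defines "B \<equiv> ln (real n) + 1"
  shows "real (n choose (r - 1)) / real r * (B - real r - (2 * B * real n powr (- \<eta>) + real n powr (- 1 / 2)
       + 10 * real r ^ 5 * B * real n powr (- 1 / 4))) \<le> ln (real (num_paving n r))"
proof -
  \<comment> \<open>The process stops at about n^(1 - \<eta>) colours; rounding up changes R by at
    most a factor 2.\<close>
  define x where "x = real n powr (1 - \<eta>)"
  define m1 where "m1 = nat \<lceil>x\<rceil>"
  define R where "R = real n / real m1"
  have n1: "real n \<ge> 1" using n by simp
  have eta: "0 < \<eta>" "\<eta> \<le> 1" by (auto simp: \<eta>_def divide_simps)
  have B: "B \<ge> 1" using n1 by (simp add: B_def)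
  have x: "1 \<le> x" "x \<le> real n"
    using n1 eta powr_mono[of "1 - \<eta>" 1 "real n"] by (auto simp: x_def ge_one_powr_ge_zero)
  have m1: "x \<le> real m1" "real m1 \<le> 2 * x" "m1 \<le> n" "0 < m1"
  proof -
    have m1r: "real m1 = of_int \<lceil>x\<rceil>" using x by (simp add: m1_def)
    show "x \<le> real m1" unfolding m1r by simp
    show "real m1 \<le> 2 * x" unfolding m1r using x by linarith
    have "\<lceil>x\<rceil> \<le> int n" using x by (simp add: ceiling_le_iff)
    thus "m1 \<le> n" unfolding m1_def by linarith
    show "0 < m1" using x by (simp add: m1_def)
  qed
  have nx: "real n / x = real n powr \<eta>"
  proof -
    have "real n powr 1 / real n powr (1 - \<eta>) = real n powr (1 - (1 - \<eta>))" by (rule powr_diff[symmetric])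
    thus ?thesis using n1 by (simp add: x_def)
  qed
  have R: "1 \<le> R" "R \<le> real n powr \<eta>" "real n powr \<eta> / 2 \<le> R"
  proof -
    show "1 \<le> R" using m1 by (simp add: R_def)
    have "R \<le> real n / x" unfolding R_def using m1 x by (intro divide_left_mono) auto
    thus "R \<le> real n powr \<eta>" by (simp add: nx)
    have "real n / (2 * x) \<le> R" unfolding R_def using m1 x by (intro divide_left_mono) auto
    moreover have "real n / (2 * x) = real n / x / 2" by simp
    ultimately show "real n powr \<eta> / 2 \<le> R" by (simp add: nx)
  qed
  have Rpow: "R ^ j \<le> real n powr (\<eta> * real j)" for j
  proof -
    have "R ^ j \<le> (real n powr \<eta>) ^ j" using R by (intro power_mono) auto
    also have "\<dots> = real n powr (\<eta> * real j)" using n1 by (simp add: powr_powr flip: powr_realpow)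
    finally show ?thesis .
  qed
  have Rr: "R ^ r \<le> real n powr (1 / 2)"
  proof -
    have "\<eta> * real r \<le> 1 / 2" by (simp add: \<eta>_def divide_simps)
    hence "real n powr (\<eta> * real r) \<le> real n powr (1 / 2)" using n1 by (intro powr_mono) auto
    thus ?thesis using Rpow[of r] by linarith
  qed
  have e2: "R ^ r / real n \<le> real n powr (- 1 / 2)"
  proof -
    have "R ^ r / real n \<le> real n powr (1 / 2) / real n powr 1" using Rr n1 by (simp add: divide_right_mono)
    also have "\<dots> = real n powr (1 / 2 - 1)" by (rule powr_diff[symmetric])
    finally show ?thesis by simp
  qed
  have e3: "R ^ (3 * r + 1) / sqrt (real n) \<le> real n powr (- 1 / 4)"
  proof -
    have "\<eta> * real (3 * r + 1) = 1 / 4" by (simp add: \<eta>_def field_simps)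
    hence "R ^ (3 * r + 1) \<le> real n powr (1 / 4)" using Rpow[of "3 * r + 1"] by (simp only:)
    hence "R ^ (3 * r + 1) / sqrt (real n) \<le> real n powr (1 / 4) / real n powr (1 / 2)"
      using n1 by (simp add: powr_half_sqrt divide_right_mono)
    also have "\<dots> = real n powr (1 / 4 - 1 / 2)" by (rule powr_diff[symmetric])
    finally show ?thesis by simp
  qed
  have e1: "B / R \<le> 2 * B * real n powr (- \<eta>)"
  proof -
    have "B / R \<le> B / (real n powr \<eta> / 2)" using R B n1 by (intro divide_left_mono) auto
    thus ?thesis by (simp add: powr_minus field_simps)
  qed
  \<comment> \<open>The ideal degree at the stopping time is n / R^r.\<close>
  have d1: "1 \<le> real n * (real m1 / real n) ^ r"
  proof -
    have "real n powr (1 / 2) \<le> real n powr 1" using n1 by (intro powr_mono) auto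
    hence "R ^ r \<le> real n" using Rr n1 by simp
    moreover have "real n * (real m1 / real n) ^ r = real n / R ^ r" by (simp add: R_def power_divide)
    moreover have "R ^ r > 0" using R(1) by simp
    ultimately show ?thesis by (simp only: le_divide_eq_1_pos)
  qed
  have "real (n choose (r - 1)) / real r * (B - real r - (2 * B * real n powr (- \<eta>) + real n powr (- 1 / 2) + 10 * real r ^ 5 * B * real n powr (- 1 / 4)))
     \<le> real (n choose (r - 1)) / real r * (B - real r - B / R - R ^ r / real n - 10 * real r ^ 5 * B * R ^ (3 * r + 1) / sqrt (real n))"
  proof (rule mult_left_mono)
    have "10 * real r ^ 5 * B * (R ^ (3 * r + 1) / sqrt (real n)) \<le> 10 * real r ^ 5 * B * real n powr (- 1 / 4)"
      using e3 B by (intro mult_left_mono) auto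
    thus "B - real r - (2 * B * real n powr (- \<eta>) + real n powr (- 1 / 2) + 10 * real r ^ 5 * B * real n powr (- 1 / 4))
       \<le> B - real r - B / R - R ^ r / real n - 10 * real r ^ 5 * B * R ^ (3 * r + 1) / sqrt (real n)"
      using e1 e2 by simp
  qed simp
  also have "\<dots> \<le> ln (real (num_paving n r))"
    unfolding B_def R_def by (rule ln_num_paving_ge[OF r n m1(4,3) d1])
  finally show ?thesis .
qed

theorem theorem5:
  fixes r :: nat
  assumes "r \<ge> 4"
  shows "\<exists>\<epsilon> :: nat \<Rightarrow> real. \<epsilon> \<longlonglongrightarrow> 0 \<and>
    (\<forall>\<^sub>F n in sequentially.
       ln (real (num_paving n r)) =
         1 / (real n - real r + 1) * real (n choose r) *
           (ln (real n - real r + 1) + 1 - real r + \<epsilon> n))"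
proof -
  define M where "M = (\<lambda>n. real (n choose (r - 1)) / real r)"
  define D where "D = (\<lambda>n. real n - real r + 1)"
  \<comment> \<open>The exact error: the equation is immediate once \<open>M n > 0\<close>, and only
    the limit has content.\<close>
  define \<epsilon> where "\<epsilon> = (\<lambda>n. ln (real (num_paving n r)) / M n - (ln (D n) + 1 - real r))"
  define \<eta> where "\<eta> = 1 / (4 * (3 * real r + 1))"
  define up where "up = (\<lambda>n. (real r)\<^sup>2 * D n powr (-1 / real r) + real r * exp ((real r - 1) / real r) * D n powr (-1 / real r)
        + exp (5 / 4 * (real r - 1)) * D n powr (-1 / 4))"
  define lo where "lo = (\<lambda>n. 2 * (ln (real n) + 1) * real n powr (- \<eta>) + real n powr (- 1 / 2)
       + 10 * real r ^ 5 * (ln (real n) + 1) * real n powr (- 1 / 4))"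
  have r0: "real r > 0" and eta: "\<eta> > 0" using assms by (auto simp: \<eta>_def)
  have Dtop: "filterlim D at_top sequentially" unfolding D_def by real_asymp
  have pw: "((\<lambda>n. D n powr (- a)) \<longlonglongrightarrow> 0)" if "a > 0" for a
    by (rule tendsto_neg_powr) (use that Dtop in auto)
  have up0: "up \<longlonglongrightarrow> 0"
  proof -
    have "up \<longlonglongrightarrow> (real r)\<^sup>2 * 0 + real r * exp ((real r - 1) / real r) * 0 + exp (5 / 4 * (real r - 1)) * 0"
      unfolding up_def using pw[of "1 / real r"] pw[of "1 / 4"] r0 by (intro tendsto_intros) auto
    thus ?thesis by simp
  qed
  have lo0: "lo \<longlonglongrightarrow> 0"
  proof -
    have 1: "(\<lambda>n. (ln (real n) + 1) * real n powr (- \<eta>)) \<longlonglongrightarrow> 0" using eta by real_asymp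
    have 2: "(\<lambda>n. real n powr (- 1 / 2)) \<longlonglongrightarrow> 0" by real_asymp
    have 3: "(\<lambda>n. (ln (real n) + 1) * real n powr (- 1 / 4)) \<longlonglongrightarrow> 0" by real_asymp
    have "(\<lambda>n. 2 * ((ln (real n) + 1) * real n powr (- \<eta>)) + real n powr (- 1 / 2)
       + 10 * real r ^ 5 * ((ln (real n) + 1) * real n powr (- 1 / 4))) \<longlonglongrightarrow> 2 * 0 + 0 + 10 * real r ^ 5 * 0"
      by (intro tendsto_intros 1 2 3)
    thus ?thesis unfolding lo_def mult.assoc by (simp only: mult_zero_right add_0_right)
  qed
  have large: "\<forall>\<^sub>F n in sequentially. r < n \<and> exp (real r - 1) \<le> D n"
    using eventually_gt_at_top[of r] Dtop[unfolded filterlim_at_top, rule_format, of "exp (real r - 1)"]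
    by eventually_elim auto
  have facts: "M n > 0" "D n = real (n - r + 1)" "1 / D n * real (n choose r) = M n" if "r < n" for n
  proof -
    show "M n > 0" unfolding M_def using that r0 by simp
    show Dn: "D n = real (n - r + 1)" using that by (simp add: D_def of_nat_diff)
    show "1 / D n * real (n choose r) = M n"
      unfolding Dn M_def using choose_ratio[of r n] that assms by simp
  qed
  have "\<forall>\<^sub>F n in sequentially. \<epsilon> n \<le> up n"
    using large
  proof eventually_elim
    case (elim n)
    note f = facts[of n]
    have "ln (real (num_paving n r)) \<le> M n * (ln (D n) + 1 - real r + up n)"
      using num_paving_upper[OF assms, of n] elim f(2) unfolding M_def up_def by simp
    hence "ln (real (num_paving n r)) / M n \<le> ln (D n) + 1 - real r + up n"
      using f(1) elim by (simp add: divide_le_eq mult.commute)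
    thus ?case by (simp add: \<epsilon>_def)
  qed
  moreover have "\<forall>\<^sub>F n in sequentially. - lo n \<le> \<epsilon> n"
    using large
  proof eventually_elim
    case (elim n)
    note f = facts[of n]
    have "M n * (ln (real n) + 1 - real r - lo n) \<le> ln (real (num_paving n r))"
      using num_paving_lower[of r n] assms elim unfolding M_def lo_def \<eta>_def by simp
    hence "ln (real n) + 1 - real r - lo n \<le> ln (real (num_paving n r)) / M n"
      using f(1) elim by (simp add: le_divide_eq mult.commute)
    \<comment> \<open>The lower bound contains ln n in place of ln D; as D \<le> n, the replacement
      only weakens it.\<close>
    moreover have "ln (D n) \<le> ln (real n)"
      using elim assms f(2) by (subst ln_le_cancel_iff) auto
    ultimately show ?case by (simp add: \<epsilon>_def)
  qed
  ultimately have "\<epsilon> \<longlonglongrightarrow> 0"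
    using tendsto_minus[OF lo0] up0 by (intro tendsto_sandwich[of "\<lambda>n. - lo n" \<epsilon> sequentially up]) auto
  moreover have "\<forall>\<^sub>F n in sequentially. ln (real (num_paving n r)) =
      1 / (real n - real r + 1) * real (n choose r) * (ln (real n - real r + 1) + 1 - real r + \<epsilon> n)"
    using large
  proof eventually_elim
    case (elim n)
    have "M n * (ln (D n) + 1 - real r + \<epsilon> n) = ln (real (num_paving n r))"
      using facts(1)[of n] elim by (simp add: \<epsilon>_def)
    thus ?case using facts(3)[of n] elim unfolding D_def by simp
  qed
  ultimately show ?thesis by blast
qed

end
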